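(* Let $F:\omega\to\mathrm{Adj}$ be the functor sending $k$ to $\mathrm{PTree}_{\bot(k)}$ and each arrow $f_k:k\to k+1$ to the adjunction $L_k\dashv R_k$. Let $p_\omega:\mathsf 1\to\omega$ be the functor mapping the unique object $\ast$ of the terminal category $\mathsf 1$ to $0$. Then the unique morphism of bifibrations $\mathrm{Bif}(p_\omega)\to\int_\omega F$ sending the atomic formula $\ast$ to the one-vertex tree is an equivalence of categories. In particular, $\mathrm{PTree}$ is equivalent to the fiber category $\mathrm{Bif}(p_\omega)_0$.
   Context: $\omega$ is the poset of natural numbers as a category. $\Delta$ is the category of finite ordinals (including the empty ordinal $\mathsf 0$) and order-preserving maps. $\mathrm{PTree}$ (finite rooted plane trees) is the full subcategory of the functor category $[\omega^{op},\Delta]$ on the functors $T$ such that $T(0)=\mathsf 1$ is the one-element ordinal and $T(k+1)=\mathsf 0$ for some $k$; $T(i)$ is the linearly ordered set of vertices of height $i$, and $T(i+1)\to T(i)$ is the parent map. The leftmost branch of $T$ is the path from the root obtained by repeatedly passing to the leftmost child (if any). $\mathrm{PTree}_{\bot(k)}$ has as objects the trees with a marked vertex of height $k$ on their leftmost branch (i.e. $T(k)\neq\mathsf 0$, and the least element of $T(k)$, which is the marked vertex, is sent to the least element of $T(j)$ for all $j\le k$), and as arrows the morphisms of $\mathrm{PTree}$ preserving the mark. $L_k:\mathrm{PTree}_{\bot(k)}\to\mathrm{PTree}_{\bot(k+1)}$ adds a fresh leaf as new leftmost child of the marked vertex and moves the mark to it; its right adjoint $R_k:\mathrm{PTree}_{\bot(k+1)}\to\mathrm{PTree}_{\bot(k)}$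 moves the mark to the parent of the marked vertex. The one-vertex tree is an object of $\mathrm{PTree}_{\bot(0)}\cong\mathrm{PTree}$. $\mathrm{Adj}$ is the 2-category of small categories and adjunctions (an arrow $\mathcal A\to\mathcal B$ is an adjunction with left adjoint $\mathcal A\to\mathcal B$). Composition is in diagrammatic order. A (cloven) bifibration is a functor $q:\mathcal E\to\mathcal C$ with, for every $f:A\to B$ in $\mathcal C$ and $S$ over $A$, a chosen $f_S:S\to f^+S$ over $f$ such that each $\alpha:S\to T$ over $fg$ factors uniquely as $\alpha=f_S\beta$ with $\beta$ over $g$; and for every $g:B\to C$ and $T$ over $C$, a chosen $\bar g_T:g^-T\to T$ over $g$ such that each $\alpha:S\to T$ over $fg$ factors uniquely as $\alpha=\beta\bar g_T$ with $\beta$ over $f$. Morphisms of bifibrations over $\mathcal C$ are functors over $\mathcal C$ sending chosen liftings to chosen liftings. The free bifibration on $p:\mathcal D\to\mathcal C$ is a bifibration $\Lambda_p:\mathrm{Bif}(p)\to\mathcal C$ with a functor $\eta_p:\mathcal D\to\mathrm{Bif}(p)$, $\Lambda_p\eta_p=p$, such that for every bifibration $q:\mathcal E\to\mathcal C$ and $\theta:\mathcal D\to\mathcal E$ with $q\theta=p$ there is a unique morphism of bifibrations $G$ with $G\eta_p=\theta$. The atomic formula $X$ is the object $\eta_p(X)$. The fiber category over $A$ consists of the objects over $A$ and the arrows over $\mathrm{id}_A$. For $F:\mathcal C\to\mathrm{Adj}$, the category of elements $\int_{\mathcal C}F$ has objects pairs $(A,S)$ with $S\in F(A)$, and arrows $(A,S)\to(B,T)$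 pairs $(f,\alpha)$ with $f:A\to B$ and $\alpha:F(f)^+(S)\to T$ in $F(B)$ (equivalently $S\to F(f)^-(T)$ in $F(A)$), where $F(f)^+\dashv F(f)^-$ is the adjunction $F(f)$; its projection to $\mathcal C$ is a bifibration with the evident chosen liftings. *)

theory Defs
  imports "HOL-Library.FuncSet"
begin

section \<open>Categories, functors, natural transformations\<close>

text \<open>Composition is written in diagrammatic order: \<open>f \<Zsemi> g\<close> is \<open>f\<close> followed by \<open>g\<close>.
  Objects and arrows are the elements of the carriers \<open>Obj\<close> and \<open>Arr\<close>.\<close>

record ('o, 'a) cat =
  Obj :: "'o set"
  Arr :: "'a set"
  Dom :: "'a \<Rightarrow> 'o"
  Cod :: "'a \<Rightarrow> 'o"
  Ident :: "'o \<Rightarrow> 'a"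
  Comp :: "'a \<Rightarrow> 'a \<Rightarrow> 'a"  (infixl "\<Zsemi>\<index>" 70)

definition is_category :: "('o, 'a) cat \<Rightarrow> bool" where
  "is_category C \<longleftrightarrow>
     (\<forall>f\<in>Arr C. Dom C f \<in> Obj C \<and> Cod C f \<in> Obj C) \<and>
     (\<forall>A\<in>Obj C. Ident C A \<in> Arr C \<and> Dom C (Ident C A) = A \<and> Cod C (Ident C A) = A) \<and>
     (\<forall>f\<in>Arr C. \<forall>g\<in>Arr C. Cod C f = Dom C g \<longrightarrow>
        f \<Zsemi>\<^bsub>C\<^esub> g \<in> Arr C \<and> Dom C (f \<Zsemi>\<^bsub>C\<^esub> g) = Dom C f \<and> Cod C (f \<Zsemi>\<^bsub>C\<^esub> g) = Cod C g) \<and>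
     (\<forall>f\<in>Arr C. Ident C (Dom C f) \<Zsemi>\<^bsub>C\<^esub> f = f \<and> f \<Zsemi>\<^bsub>C\<^esub> Ident C (Cod C f) = f) \<and>
     (\<forall>f\<in>Arr C. \<forall>g\<in>Arr C. \<forall>h\<in>Arr C. Cod C f = Dom C g \<longrightarrow> Cod C g = Dom C h \<longrightarrow>
        (f \<Zsemi>\<^bsub>C\<^esub> g) \<Zsemi>\<^bsub>C\<^esub> h = f \<Zsemi>\<^bsub>C\<^esub> (g \<Zsemi>\<^bsub>C\<^esub> h))"

definition op_cat :: "('o, 'a) cat \<Rightarrow> ('o, 'a) cat" where
  "op_cat C = \<lparr>Obj = Obj C, Arr = Arr C, Dom = Cod C, Cod = Dom C, Ident = Ident C,
     Comp = (\<lambda>f g. g \<Zsemi>\<^bsub>C\<^esub> f)\<rparr>"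

definition full_subcat :: "('o, 'a) cat \<Rightarrow> 'o set \<Rightarrow> ('o, 'a) cat" where
  "full_subcat C X = C\<lparr>Obj := Obj C \<inter> X, Arr := {f \<in> Arr C. Dom C f \<in> X \<and> Cod C f \<in> X}\<rparr>"

record ('o, 'a, 'p, 'b) ftor =
  Fo :: "'o \<Rightarrow> 'p"
  Fa :: "'a \<Rightarrow> 'b"

text \<open>Functors are required to be extensional (\<^const>\<open>undefined\<close> off the carriers), so that \<open>=\<close>
  on functors is equality of functors.\<close>

definition is_functor :: "('o, 'a) cat \<Rightarrow> ('p, 'b) cat \<Rightarrow> ('o, 'a, 'p, 'b) ftor \<Rightarrow> bool" where
  "is_functor C D F \<longleftrightarrow>
     is_category C \<and> is_category D \<and>
     Fo F \<in> Obj C \<rightarrow>\<^sub>E Obj D \<and> Fa F \<in> Arr C \<rightarrow>\<^sub>E Arr D \<and>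
     (\<forall>f\<in>Arr C. Dom D (Fa F f) = Fo F (Dom C f) \<and> Cod D (Fa F f) = Fo F (Cod C f)) \<and>
     (\<forall>A\<in>Obj C. Fa F (Ident C A) = Ident D (Fo F A)) \<and>
     (\<forall>f\<in>Arr C. \<forall>g\<in>Arr C. Cod C f = Dom C g \<longrightarrow>
        Fa F (f \<Zsemi>\<^bsub>C\<^esub> g) = Fa F f \<Zsemi>\<^bsub>D\<^esub> Fa F g)"

definition id_functor :: "('o, 'a) cat \<Rightarrow> ('o, 'a, 'o, 'a) ftor" where
  "id_functor C = \<lparr>Fo = (\<lambda>A\<in>Obj C. A), Fa = (\<lambda>f\<in>Arr C. f)\<rparr>"

text \<open>\<open>fcomp C F G\<close> is \<open>F\<close> followed by \<open>G\<close>, where \<open>C\<close> is the source of \<open>F\<close>.\<close>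

definition fcomp :: "('o, 'a) cat \<Rightarrow> ('o, 'a, 'p, 'b) ftor \<Rightarrow> ('p, 'b, 'q, 'c) ftor
    \<Rightarrow> ('o, 'a, 'q, 'c) ftor" where
  "fcomp C F G = \<lparr>Fo = compose (Obj C) (Fo G) (Fo F), Fa = compose (Arr C) (Fa G) (Fa F)\<rparr>"

record ('o, 'a, 'p, 'b) ntrans =
  Nsrc :: "('o, 'a, 'p, 'b) ftor"
  Ntgt :: "('o, 'a, 'p, 'b) ftor"
  Ncomp :: "'o \<Rightarrow> 'b"

definition is_ntrans :: "('o, 'a) cat \<Rightarrow> ('p, 'b) cat \<Rightarrow> ('o, 'a, 'p, 'b) ntrans \<Rightarrow> bool" where
  "is_ntrans C D t \<longleftrightarrow>
     is_functor C D (Nsrc t) \<and> is_functor C D (Ntgt t) \<and>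
     Ncomp t \<in> Obj C \<rightarrow>\<^sub>E Arr D \<and>
     (\<forall>A\<in>Obj C. Dom D (Ncomp t A) = Fo (Nsrc t) A \<and> Cod D (Ncomp t A) = Fo (Ntgt t) A) \<and>
     (\<forall>f\<in>Arr C. Fa (Nsrc t) f \<Zsemi>\<^bsub>D\<^esub> Ncomp t (Cod C f) = Ncomp t (Dom C f) \<Zsemi>\<^bsub>D\<^esub> Fa (Ntgt t) f)"

definition functor_cat :: "('o, 'a) cat \<Rightarrow> ('p, 'b) cat
    \<Rightarrow> (('o, 'a, 'p, 'b) ftor, ('o, 'a, 'p, 'b) ntrans) cat" where
  "functor_cat C D =
     \<lparr>Obj = {F. is_functor C D F}, Arr = {t. is_ntrans C D t}, Dom = Nsrc, Cod = Ntgt,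
      Ident = (\<lambda>F. \<lparr>Nsrc = F, Ntgt = F, Ncomp = (\<lambda>A\<in>Obj C. Ident D (Fo F A))\<rparr>),
      Comp = (\<lambda>s t. \<lparr>Nsrc = Nsrc s, Ntgt = Ntgt t, Ncomp = (\<lambda>A\<in>Obj C. Ncomp s A \<Zsemi>\<^bsub>D\<^esub> Ncomp t A)\<rparr>)\<rparr>"

definition isomorphic :: "('o, 'a) cat \<Rightarrow> 'o \<Rightarrow> 'o \<Rightarrow> bool" where
  "isomorphic C A B \<longleftrightarrow> A \<in> Obj C \<and> B \<in> Obj C \<and>
     (\<exists>f\<in>Arr C. \<exists>g\<in>Arr C. Dom C f = A \<and> Cod C f = B \<and> Dom C g = B \<and> Cod C g = A \<and>
        f \<Zsemi>\<^bsub>C\<^esub> g = Ident C A \<and> g \<Zsemi>\<^bsub>C\<^esub> f = Ident C B)"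

definition is_equivalence :: "('o, 'a) cat \<Rightarrow> ('p, 'b) cat \<Rightarrow> ('o, 'a, 'p, 'b) ftor \<Rightarrow> bool" where
  "is_equivalence C D G \<longleftrightarrow> is_functor C D G \<and>
     (\<exists>H. is_functor D C H \<and>
        isomorphic (functor_cat C C) (id_functor C) (fcomp C G H) \<and>
        isomorphic (functor_cat D D) (fcomp D H G) (id_functor D))"

definition equivalent_cats :: "('o, 'a) cat \<Rightarrow> ('p, 'b) cat \<Rightarrow> bool" where
  "equivalent_cats C D \<longleftrightarrow> (\<exists>G. is_equivalence C D G)"


section \<open>Bifibrations and free bifibrations\<close>

text \<open>A cloven bifibration: \<open>Push f S\<close> is the chosen lifting \<open>f\<^sub>S : S \<rightarrow> f\<^sup>+S\<close> (so the object
  \<open>f\<^sup>+S\<close> is its codomain) and \<open>Pull g T\<close> is the chosen lifting \<open>g\<^sup>-T \<rightarrow> T\<close>.\<close>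

record ('eo, 'ea, 'co, 'ca) bif =
  Tot :: "('eo, 'ea) cat"
  Proj :: "('eo, 'ea, 'co, 'ca) ftor"
  Push :: "'ca \<Rightarrow> 'eo \<Rightarrow> 'ea"
  Pull :: "'ca \<Rightarrow> 'eo \<Rightarrow> 'ea"

definition is_bifibration :: "('co, 'ca) cat \<Rightarrow> ('eo, 'ea, 'co, 'ca) bif \<Rightarrow> bool" where
  "is_bifibration C Q \<longleftrightarrow>
     is_functor (Tot Q) C (Proj Q) \<and>
     (\<forall>f\<in>Arr C. \<forall>S\<in>Obj (Tot Q). Fo (Proj Q) S = Dom C f \<longrightarrow>
        Push Q f S \<in> Arr (Tot Q) \<and> Dom (Tot Q) (Push Q f S) = S \<and> Fa (Proj Q) (Push Q f S) = f \<and>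
        (\<forall>g\<in>Arr C. Dom C g = Cod C f \<longrightarrow>
           (\<forall>\<alpha>\<in>Arr (Tot Q). Dom (Tot Q) \<alpha> = S \<longrightarrow> Fa (Proj Q) \<alpha> = f \<Zsemi>\<^bsub>C\<^esub> g \<longrightarrow>
              (\<exists>!\<beta>. \<beta> \<in> Arr (Tot Q) \<and> Dom (Tot Q) \<beta> = Cod (Tot Q) (Push Q f S) \<and>
                 Cod (Tot Q) \<beta> = Cod (Tot Q) \<alpha> \<and> Fa (Proj Q) \<beta> = g \<and>
                 \<alpha> = Push Q f S \<Zsemi>\<^bsub>Tot Q\<^esub> \<beta>)))) \<and>
     (\<forall>g\<in>Arr C. \<forall>T\<in>Obj (Tot Q). Fo (Proj Q) T = Cod C g \<longrightarrow>
        Pull Q g T \<in> Arr (Tot Q) \<and> Cod (Tot Q) (Pull Q g T) = T \<and> Fa (Proj Q) (Pull Q g T) = g \<and>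
        (\<forall>f\<in>Arr C. Cod C f = Dom C g \<longrightarrow>
           (\<forall>\<alpha>\<in>Arr (Tot Q). Cod (Tot Q) \<alpha> = T \<longrightarrow> Fa (Proj Q) \<alpha> = f \<Zsemi>\<^bsub>C\<^esub> g \<longrightarrow>
              (\<exists>!\<beta>. \<beta> \<in> Arr (Tot Q) \<and> Cod (Tot Q) \<beta> = Dom (Tot Q) (Pull Q g T) \<and>
                 Dom (Tot Q) \<beta> = Dom (Tot Q) \<alpha> \<and> Fa (Proj Q) \<beta> = f \<and>
                 \<alpha> = \<beta> \<Zsemi>\<^bsub>Tot Q\<^esub> Pull Q g T))))"

definition bif_morphism :: "('co, 'ca) cat \<Rightarrow> ('eo, 'ea, 'co, 'ca) bif \<Rightarrow> ('ho, 'ha, 'co, 'ca) bif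
    \<Rightarrow> ('eo, 'ea, 'ho, 'ha) ftor \<Rightarrow> bool" where
  "bif_morphism C Q Q' G \<longleftrightarrow>
     is_bifibration C Q \<and> is_bifibration C Q' \<and>
     is_functor (Tot Q) (Tot Q') G \<and> fcomp (Tot Q) G (Proj Q') = Proj Q \<and>
     (\<forall>f\<in>Arr C. \<forall>S\<in>Obj (Tot Q). Fo (Proj Q) S = Dom C f \<longrightarrow>
        Fa G (Push Q f S) = Push Q' f (Fo G S)) \<and>
     (\<forall>g\<in>Arr C. \<forall>T\<in>Obj (Tot Q). Fo (Proj Q) T = Cod C g \<longrightarrow>
        Fa G (Pull Q g T) = Pull Q' g (Fo G T))"

text \<open>\<open>free_bifibration TYPE('eo \<times> 'ea) D C p B \<eta>\<close>: the bifibration \<open>B\<close> with \<open>\<eta>\<close> is free on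
  \<open>p : D \<rightarrow> C\<close>. As HOL cannot quantify over types inside a formula, the size of the test
  bifibrations appears as a parameter: the universal property ranges over all bifibrations whose
  objects and arrows are drawn from the types \<open>'eo\<close> and \<open>'ea\<close>.\<close>

definition free_bifibration :: "('eo \<times> 'ea) itself \<Rightarrow> ('do, 'da) cat \<Rightarrow> ('co, 'ca) cat
    \<Rightarrow> ('do, 'da, 'co, 'ca) ftor \<Rightarrow> ('bo, 'ba, 'co, 'ca) bif \<Rightarrow> ('do, 'da, 'bo, 'ba) ftor \<Rightarrow> bool"
  where
  "free_bifibration _ D C p B \<eta> \<longleftrightarrow>
     is_functor D C p \<and> is_bifibration C B \<and>
     is_functor D (Tot B) \<eta> \<and> fcomp D \<eta> (Proj B) = p \<and>
     (\<forall>(Q :: ('eo, 'ea, 'co, 'ca) bif) \<theta>.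
        is_bifibration C Q \<longrightarrow> is_functor D (Tot Q) \<theta> \<longrightarrow> fcomp D \<theta> (Proj Q) = p \<longrightarrow>
        (\<exists>!G. bif_morphism C B Q G \<and> fcomp D \<eta> G = \<theta>))"

definition fiber :: "('co, 'ca) cat \<Rightarrow> ('eo, 'ea, 'co, 'ca) bif \<Rightarrow> 'co \<Rightarrow> ('eo, 'ea) cat" where
  "fiber C Q A = (Tot Q)\<lparr>Obj := {S \<in> Obj (Tot Q). Fo (Proj Q) S = A},
     Arr := {\<alpha> \<in> Arr (Tot Q). Fa (Proj Q) \<alpha> = Ident C A}\<rparr>"


section \<open>Adjunctions and the category of elements\<close>

record ('o, 'a) adjn =
  Asrc :: "('o, 'a) cat"
  Atgt :: "('o, 'a) cat"
  Aleft :: "('o, 'a, 'o, 'a) ftor"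
  Aright :: "('o, 'a, 'o, 'a) ftor"
  Aunit :: "('o, 'a, 'o, 'a) ntrans"
  Acounit :: "('o, 'a, 'o, 'a) ntrans"

definition is_adjunction :: "('o, 'a) adjn \<Rightarrow> bool" where
  "is_adjunction U \<longleftrightarrow>
     is_functor (Asrc U) (Atgt U) (Aleft U) \<and> is_functor (Atgt U) (Asrc U) (Aright U) \<and>
     is_ntrans (Asrc U) (Asrc U) (Aunit U) \<and>
     Nsrc (Aunit U) = id_functor (Asrc U) \<and>
     Ntgt (Aunit U) = fcomp (Asrc U) (Aleft U) (Aright U) \<and>
     is_ntrans (Atgt U) (Atgt U) (Acounit U) \<and>
     Nsrc (Acounit U) = fcomp (Atgt U) (Aright U) (Aleft U) \<and>
     Ntgt (Acounit U) = id_functor (Atgt U) \<and>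
     (\<forall>S\<in>Obj (Asrc U). Fa (Aleft U) (Ncomp (Aunit U) S) \<Zsemi>\<^bsub>Atgt U\<^esub> Ncomp (Acounit U) (Fo (Aleft U) S)
        = Ident (Atgt U) (Fo (Aleft U) S)) \<and>
     (\<forall>T\<in>Obj (Atgt U). Ncomp (Aunit U) (Fo (Aright U) T) \<Zsemi>\<^bsub>Asrc U\<^esub> Fa (Aright U) (Ncomp (Acounit U) T)
        = Ident (Asrc U) (Fo (Aright U) T))"

text \<open>The underlying category of the 2-category of categories and adjunctions, an arrow pointing
  in the direction of its left adjoint. Its 2-cells play no role for functors out of an ordinary
  category.\<close>

definition Adj :: "(('o, 'a) cat, ('o, 'a) adjn) cat" where
  "Adj = \<lparr>Obj = {A. is_category A}, Arr = {U. is_adjunction U}, Dom = Asrc, Cod = Atgt,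
     Ident = (\<lambda>A. \<lparr>Asrc = A, Atgt = A, Aleft = id_functor A, Aright = id_functor A,
        Aunit = Ident (functor_cat A A) (id_functor A),
        Acounit = Ident (functor_cat A A) (id_functor A)\<rparr>),
     Comp = (\<lambda>U V. \<lparr>Asrc = Asrc U, Atgt = Atgt V,
        Aleft = fcomp (Asrc U) (Aleft U) (Aleft V),
        Aright = fcomp (Atgt V) (Aright V) (Aright U),
        Aunit = \<lparr>Nsrc = id_functor (Asrc U),
          Ntgt = fcomp (Asrc U) (fcomp (Asrc U) (Aleft U) (Aleft V))
                                (fcomp (Atgt V) (Aright V) (Aright U)),
          Ncomp = (\<lambda>S\<in>Obj (Asrc U). Ncomp (Aunit U) S \<Zsemi>\<^bsub>Asrc U\<^esub>
                   Fa (Aright U) (Ncomp (Aunit V) (Fo (Aleft U) S)))\<rparr>,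
        Acounit = \<lparr>Nsrc = fcomp (Atgt V) (fcomp (Atgt V) (Aright V) (Aright U))
                                        (fcomp (Asrc U) (Aleft U) (Aleft V)),
          Ntgt = id_functor (Atgt V),
          Ncomp = (\<lambda>T\<in>Obj (Atgt V). Fa (Aleft V) (Ncomp (Acounit U) (Fo (Aright V) T)) \<Zsemi>\<^bsub>Atgt V\<^esub>
                   Ncomp (Acounit V) T)\<rparr>\<rparr>)\<rparr>"

text \<open>The category of elements of \<open>F : C \<rightarrow> Adj\<close>, with its chosen liftings. An arrow is stored
  together with its end points, as \<open>((A, S), (B, T), f, \<alpha>)\<close> where \<open>\<alpha> : F(f)\<^sup>+(S) \<rightarrow> T\<close>. The chosen
  pushforward lifting is \<open>(f, id)\<close>; the chosen pullback lifting is \<open>(g, \<epsilon>)\<close> for \<open>\<epsilon>\<close> the counit of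
  \<open>F(g)\<close>, i.e. the transpose of the identity on \<open>F(g)\<^sup>-(T)\<close>.\<close>

definition elements :: "('co, 'ca) cat \<Rightarrow> ('co, 'ca, ('o, 'a) cat, ('o, 'a) adjn) ftor
    \<Rightarrow> ('co \<times> 'o, ('co \<times> 'o) \<times> ('co \<times> 'o) \<times> 'ca \<times> 'a, 'co, 'ca) bif" where
  "elements C F =
    (let Ob = {(A, S). A \<in> Obj C \<and> S \<in> Obj (Fo F A)};
         Ar = {((A, S), (B, T), f, \<alpha>). f \<in> Arr C \<and> Dom C f = A \<and> Cod C f = B \<and>
                 S \<in> Obj (Fo F A) \<and> T \<in> Obj (Fo F B) \<and> \<alpha> \<in> Arr (Fo F B) \<and>
                 Dom (Fo F B) \<alpha> = Fo (Aleft (Fa F f)) S \<and> Cod (Fo F B) \<alpha> = T}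
     in \<lparr>Tot = \<lparr>Obj = Ob, Arr = Ar,
           Dom = (\<lambda>(X, Y, f, \<alpha>). X),
           Cod = (\<lambda>(X, Y, f, \<alpha>). Y),
           Ident = (\<lambda>(A, S). ((A, S), (A, S), Ident C A, Ident (Fo F A) S)),
           Comp = (\<lambda>(X, Y, f, \<alpha>) (Y', Z, g, \<beta>).
              (X, Z, f \<Zsemi>\<^bsub>C\<^esub> g, Fa (Aleft (Fa F g)) \<alpha> \<Zsemi>\<^bsub>Fo F (Cod C g)\<^esub> \<beta>))\<rparr>,
         Proj = \<lparr>Fo = (\<lambda>(A, S)\<in>Ob. A), Fa = (\<lambda>(X, Y, f, \<alpha>)\<in>Ar. f)\<rparr>,
         Push = (\<lambda>f (A, S). let T = Fo (Aleft (Fa F f)) S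
                   in ((A, S), (Cod C f, T), f, Ident (Fo F (Cod C f)) T)),
         Pull = (\<lambda>g (B, T). ((Dom C g, Fo (Aright (Fa F g)) T), (B, T), g,
                   Ncomp (Acounit (Fa F g)) T))\<rparr>)"


section \<open>The base categories and plane trees\<close>

definition omega :: "(nat, nat \<times> nat) cat" where
  "omega = \<lparr>Obj = UNIV, Arr = {(i, j). i \<le> j}, Dom = fst, Cod = snd,
     Ident = (\<lambda>i. (i, i)), Comp = (\<lambda>f g. (fst f, snd g))\<rparr>"

text \<open>The finite ordinal with \<open>n\<close> elements is \<open>{..<n}\<close>; an order-preserving map is stored with its
  domain and codomain.\<close>

type_synonym omap = "nat \<times> nat \<times> (nat \<Rightarrow> nat)"

abbreviation appl :: "omap \<Rightarrow> nat \<Rightarrow> nat" where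
  "appl a \<equiv> snd (snd a)"

definition Delta :: "(nat, omap) cat" where
  "Delta = \<lparr>Obj = UNIV,
     Arr = {(m, n, f). f \<in> {..<m} \<rightarrow>\<^sub>E {..<n} \<and> mono_on {..<m} f},
     Dom = fst, Cod = (\<lambda>a. fst (snd a)),
     Ident = (\<lambda>n. (n, n, \<lambda>x\<in>{..<n}. x)),
     Comp = (\<lambda>a b. (fst a, fst (snd b), compose {..<fst a} (appl b) (appl a)))\<rparr>"

definition terminal_cat :: "(unit, unit) cat" where
  "terminal_cat = \<lparr>Obj = UNIV, Arr = UNIV, Dom = (\<lambda>_. ()), Cod = (\<lambda>_. ()), Ident = (\<lambda>_. ()),
     Comp = (\<lambda>_ _. ())\<rparr>"

definition p_omega :: "(unit, unit, nat, nat \<times> nat) ftor" where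
  "p_omega = \<lparr>Fo = (\<lambda>_. 0), Fa = (\<lambda>_. (0, 0))\<rparr>"

type_synonym tree = "(nat, nat \<times> nat, nat, omap) ftor"
type_synonym tree_map = "(nat, nat \<times> nat, nat, omap) ntrans"

definition PTree :: "(tree, tree_map) cat" where
  "PTree = full_subcat (functor_cat (op_cat omega) Delta) {T. Fo T 0 = 1 \<and> (\<exists>k. Fo T (Suc k) = 0)}"

text \<open>For \<open>i \<le> j\<close>, the arrow \<open>(i, j)\<close> of \<^const>\<open>omega\<close> is an arrow from \<open>j\<close> to \<open>i\<close> of the
  opposite category; \<open>anc T i j\<close> maps a vertex of height \<open>j\<close> to its ancestor of height \<open>i\<close>.\<close>

definition anc :: "tree \<Rightarrow> nat \<Rightarrow> nat \<Rightarrow> nat \<Rightarrow> nat" where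
  "anc T i j = appl (Fa T (i, j))"

definition one_vertex :: tree where
  "one_vertex = (let n = (\<lambda>i. if i = 0 then 1 else 0) in
     \<lparr>Fo = n, Fa = (\<lambda>(i, j)\<in>Arr omega. (n j, n i, \<lambda>x\<in>{..<n j}. 0))\<rparr>)"

text \<open>The mark is the vertex \<open>0\<close> of height \<open>k\<close>.\<close>

definition PTree_bot :: "nat \<Rightarrow> (tree, tree_map) cat" where
  "PTree_bot k =
    (let Ob = {T \<in> Obj PTree. Fo T k \<noteq> 0 \<and> (\<forall>j\<le>k. anc T j k 0 = 0)}
     in PTree\<lparr>Obj := Ob,
          Arr := {t \<in> Arr PTree. Nsrc t \<in> Ob \<and> Ntgt t \<in> Ob \<and> appl (Ncomp t k) 0 = 0}\<rparr>)"

text \<open>Adding a fresh leaf below the mark: at height \<open>k + 1\<close> the fresh leaf is \<open>0\<close> and every old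
  vertex \<open>x\<close> becomes \<open>x + 1\<close>. \<open>old k i\<close> is the renumbering of the old vertices of height \<open>i\<close>, and
  \<open>extend k i h\<close> extends a function \<open>h\<close> on the old vertices of height \<open>i\<close> by sending the fresh leaf
  (if \<open>i = k + 1\<close>) to \<open>0\<close>.\<close>

definition old :: "nat \<Rightarrow> nat \<Rightarrow> nat \<Rightarrow> nat" where
  "old k i x = (if i = Suc k then Suc x else x)"

definition extend :: "nat \<Rightarrow> nat \<Rightarrow> (nat \<Rightarrow> nat) \<Rightarrow> nat \<Rightarrow> nat" where
  "extend k i h y = (if i = Suc k then (case y of 0 \<Rightarrow> 0 | Suc x \<Rightarrow> h x) else h y)"

text \<open>The functor \<open>L\<^sub>k\<close> on objects and on arrows.\<close>

definition add_leaf :: "nat \<Rightarrow> tree \<Rightarrow> tree" where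
  "add_leaf k T = (let n = (\<lambda>i. old k i (Fo T i)) in
     \<lparr>Fo = n,
      Fa = (\<lambda>(i, j)\<in>Arr omega. (n j, n i, \<lambda>y\<in>{..<n j}. extend k j (\<lambda>x. old k i (anc T i j x)) y))\<rparr>)"

definition add_leaf_map :: "nat \<Rightarrow> tree_map \<Rightarrow> tree_map" where
  "add_leaf_map k t = (let S = add_leaf k (Nsrc t); T = add_leaf k (Ntgt t) in
     \<lparr>Nsrc = S, Ntgt = T,
      Ncomp = (\<lambda>i. (Fo S i, Fo T i,
        \<lambda>y\<in>{..<Fo S i}. extend k i (\<lambda>x. old k i (appl (Ncomp t i) x)) y))\<rparr>)"

definition Lfun :: "nat \<Rightarrow> (tree, tree_map, tree, tree_map) ftor" where
  "Lfun k = \<lparr>Fo = restrict (add_leaf k) (Obj (PTree_bot k)),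
     Fa = restrict (add_leaf_map k) (Arr (PTree_bot k))\<rparr>"

text \<open>As the mark is not stored in a tree, moving it to its parent leaves the underlying data
  unchanged.\<close>

definition Rfun :: "nat \<Rightarrow> (tree, tree_map, tree, tree_map) ftor" where
  "Rfun k = \<lparr>Fo = (\<lambda>T\<in>Obj (PTree_bot (Suc k)). T), Fa = (\<lambda>t\<in>Arr (PTree_bot (Suc k)). t)\<rparr>"

text \<open>The unit includes the old vertices; the counit sends the fresh leaf to the marked vertex.\<close>

definition LR_adj :: "nat \<Rightarrow> (tree, tree_map) adjn" where
  "LR_adj k =
     \<lparr>Asrc = PTree_bot k, Atgt = PTree_bot (Suc k), Aleft = Lfun k, Aright = Rfun k,
      Aunit = \<lparr>Nsrc = id_functor (PTree_bot k), Ntgt = fcomp (PTree_bot k) (Lfun k) (Rfun k),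
        Ncomp = (\<lambda>S\<in>Obj (PTree_bot k). \<lparr>Nsrc = S, Ntgt = add_leaf k S,
          Ncomp = (\<lambda>i. (Fo S i, Fo (add_leaf k S) i, \<lambda>x\<in>{..<Fo S i}. old k i x))\<rparr>)\<rparr>,
      Acounit = \<lparr>Nsrc = fcomp (PTree_bot (Suc k)) (Rfun k) (Lfun k),
        Ntgt = id_functor (PTree_bot (Suc k)),
        Ncomp = (\<lambda>T\<in>Obj (PTree_bot (Suc k)). \<lparr>Nsrc = add_leaf k T, Ntgt = T,
          Ncomp = (\<lambda>i. (Fo (add_leaf k T) i, Fo T i,
            \<lambda>y\<in>{..<Fo (add_leaf k T) i}. extend k i (\<lambda>x. x) y))\<rparr>)\<rparr>\<rparr>"

text \<open>The functor from \<^const>\<open>omega\<close> to \<^const>\<open>Adj\<close> determined by the adjunctions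
  \<^term>\<open>LR_adj k\<close>: the arrow \<open>(i, i + n)\<close> goes to the composite of
  \<open>LR_adj i, \<dots>, LR_adj (i + n - 1)\<close>.\<close>

fun LR_iter :: "nat \<Rightarrow> nat \<Rightarrow> (tree, tree_map) adjn" where
  "LR_iter i 0 = Ident Adj (PTree_bot i)"
| "LR_iter i (Suc n) = LR_iter i n \<Zsemi>\<^bsub>Adj\<^esub> LR_adj (i + n)"

definition PTree_functor :: "(nat, nat \<times> nat, (tree, tree_map) cat, (tree, tree_map) adjn) ftor" where
  "PTree_functor = \<lparr>Fo = PTree_bot, Fa = (\<lambda>(i, j)\<in>Arr omega. LR_iter i (j - i))\<rparr>"

end

theory Submission
  imports Defs "HOL-Library.Countable"
begin

text \<open>Why the theorem holds. In a bifibration over \<open>\<omega>\<close> with a chosen object over \<open>0\<close>, every formula built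
from an atom by pushforwards and pullbacks denotes an object. In the category of elements the formula
\<open>A\<close> denotes a pair of its height and a marked tree, obtained by replaying the instructions ``add a path
below the mark'' (push) and ``move the mark towards the root'' (pull). Every marked tree arises in this
way (\<open>marked_tree_formula\<close>: the last leaf of the leftmost branch can be removed), so the comparison functor
is surjective on objects, and it remains to show that it is fully faithful (\<open>ff_surj_equivalence\<close>).

Since \<open>R\<close> does not change the underlying tree, transposing along \<open>L \<stileturn> R\<close> identifies the arrows from
\<open>(i, S)\<close> to \<open>(j, T)\<close> of the category of elements, for \<open>i \<le> j\<close>, with the tree maps \<open>S \<rightarrow> T\<close> that preserve the
vertex \<open>0\<close> of height \<open>i\<close> (\<open>und_bij\<close>). So the claim is that the arrows \<open>A \<rightarrow> B\<close> of the free bifibration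
are in bijection with these tree maps (\<open>tm_bij\<close>), which is shown by induction on \<open>A\<close> and \<open>B\<close>. If \<open>A\<close> is a
pushforward or \<open>B\<close> is a pullback, the universal property of the liftings removes that connective on both
sides. The remaining cases need two facts.

On the syntactic side, an arrow from an atom or pullback to an atom or pushforward is the identity of the
atom, or factors through the pullback lifting of its source, or factors through the pushforward lifting
of its target (\<open>der_pull_push_cases\<close>). This follows from cut elimination: call an arrow derivable if
it is built by the cut-free sequent rules \<open>der\<close>. The arrows that preserve derivability under
composition form a sub-bifibration (\<open>gen_bifibration\<close>), and a free bifibration has no proper
sub-bifibration containing its atom (\<open>free_generated\<close>). For composition in that sub-bifibration to
make sense, distinct formulas must denote distinct objects, which is seen by mapping the free bifibration to a bifibration
whose objects are the formulas and in which every hom-set over an arrow of \<open>\<omega>\<close> is a singleton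
(\<open>free_itp_inj\<close>).

On the side of trees, a map from \<open>S\<close>, marked at height \<open>k + m\<close>, to \<open>T\<close> with a fresh path attached to its mark
either preserves the mark of \<open>S\<close> or misses the fresh path and hence factors through \<open>T\<close>
(\<open>pull_push_dichotomy\<close>). These are the same two factorizations. Both can be available at once, and then the
map restricts to a map \<open>S \<rightarrow> T\<close> that preserves the mark of \<open>S\<close>; by the induction hypothesis this map comes from an
arrow of the free bifibration that reconciles the two ways to factor, whence injectivity.\<close>

section \<open>Categories, functors and natural transformations\<close>

lemma is_categoryI:
  assumes "\<And>f. f \<in> Arr C \<Longrightarrow> Dom C f \<in> Obj C" "\<And>f. f \<in> Arr C \<Longrightarrow> Cod C f \<in> Obj C"
    and "\<And>A. A \<in> Obj C \<Longrightarrow> Ident C A \<in> Arr C"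
    and "\<And>A. A \<in> Obj C \<Longrightarrow> Dom C (Ident C A) = A" "\<And>A. A \<in> Obj C \<Longrightarrow> Cod C (Ident C A) = A"
    and "\<And>f g. f \<in> Arr C \<Longrightarrow> g \<in> Arr C \<Longrightarrow> Cod C f = Dom C g \<Longrightarrow> f \<Zsemi>\<^bsub>C\<^esub> g \<in> Arr C"
    and "\<And>f g. f \<in> Arr C \<Longrightarrow> g \<in> Arr C \<Longrightarrow> Cod C f = Dom C g \<Longrightarrow> Dom C (f \<Zsemi>\<^bsub>C\<^esub> g) = Dom C f"
    and "\<And>f g. f \<in> Arr C \<Longrightarrow> g \<in> Arr C \<Longrightarrow> Cod C f = Dom C g \<Longrightarrow> Cod C (f \<Zsemi>\<^bsub>C\<^esub> g) = Cod C g"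
    and "\<And>f. f \<in> Arr C \<Longrightarrow> Ident C (Dom C f) \<Zsemi>\<^bsub>C\<^esub> f = f"
    and "\<And>f. f \<in> Arr C \<Longrightarrow> f \<Zsemi>\<^bsub>C\<^esub> Ident C (Cod C f) = f"
    and "\<And>f g h. f \<in> Arr C \<Longrightarrow> g \<in> Arr C \<Longrightarrow> h \<in> Arr C \<Longrightarrow> Cod C f = Dom C g \<Longrightarrow> Cod C g = Dom C h
      \<Longrightarrow> (f \<Zsemi>\<^bsub>C\<^esub> g) \<Zsemi>\<^bsub>C\<^esub> h = f \<Zsemi>\<^bsub>C\<^esub> (g \<Zsemi>\<^bsub>C\<^esub> h)"
  shows "is_category C"
  unfolding is_category_def by (intro conjI ballI impI) (rule assms; assumption)+

context
  fixes C :: "('o, 'a) cat"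
  assumes C: "is_category C"
begin

lemma cat_dom [simp]: "f \<in> Arr C \<Longrightarrow> Dom C f \<in> Obj C"
  and cat_cod [simp]: "f \<in> Arr C \<Longrightarrow> Cod C f \<in> Obj C"
  and cat_id [simp]: "A \<in> Obj C \<Longrightarrow> Ident C A \<in> Arr C"
  and cat_dom_id [simp]: "A \<in> Obj C \<Longrightarrow> Dom C (Ident C A) = A"
  and cat_cod_id [simp]: "A \<in> Obj C \<Longrightarrow> Cod C (Ident C A) = A"
  and cat_comp [simp]: "f \<in> Arr C \<Longrightarrow> g \<in> Arr C \<Longrightarrow> Cod C f = Dom C g \<Longrightarrow> f \<Zsemi>\<^bsub>C\<^esub> g \<in> Arr C"
  and cat_dom_comp [simp]: "f \<in> Arr C \<Longrightarrow> g \<in> Arr C \<Longrightarrow> Cod C f = Dom C g \<Longrightarrow> Dom C (f \<Zsemi>\<^bsub>C\<^esub> g) = Dom C f"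
  and cat_cod_comp [simp]: "f \<in> Arr C \<Longrightarrow> g \<in> Arr C \<Longrightarrow> Cod C f = Dom C g \<Longrightarrow> Cod C (f \<Zsemi>\<^bsub>C\<^esub> g) = Cod C g"
  and cat_id_left: "f \<in> Arr C \<Longrightarrow> Dom C f = A \<Longrightarrow> Ident C A \<Zsemi>\<^bsub>C\<^esub> f = f"
  and cat_id_right: "f \<in> Arr C \<Longrightarrow> Cod C f = A \<Longrightarrow> f \<Zsemi>\<^bsub>C\<^esub> Ident C A = f"
  and cat_assoc: "f \<in> Arr C \<Longrightarrow> g \<in> Arr C \<Longrightarrow> h \<in> Arr C \<Longrightarrow> Cod C f = Dom C g \<Longrightarrow> Cod C g = Dom C h
      \<Longrightarrow> (f \<Zsemi>\<^bsub>C\<^esub> g) \<Zsemi>\<^bsub>C\<^esub> h = f \<Zsemi>\<^bsub>C\<^esub> (g \<Zsemi>\<^bsub>C\<^esub> h)"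
  using C unfolding is_category_def by blast+

end

lemma is_functorI:
  assumes "is_category C" "is_category D"
    and "Fo F \<in> extensional (Obj C)" "Fa F \<in> extensional (Arr C)"
    and "\<And>A. A \<in> Obj C \<Longrightarrow> Fo F A \<in> Obj D"
    and "\<And>f. f \<in> Arr C \<Longrightarrow> Fa F f \<in> Arr D"
    and "\<And>f. f \<in> Arr C \<Longrightarrow> Dom D (Fa F f) = Fo F (Dom C f)"
    and "\<And>f. f \<in> Arr C \<Longrightarrow> Cod D (Fa F f) = Fo F (Cod C f)"
    and "\<And>A. A \<in> Obj C \<Longrightarrow> Fa F (Ident C A) = Ident D (Fo F A)"
    and "\<And>f g. f \<in> Arr C \<Longrightarrow> g \<in> Arr C \<Longrightarrow> Cod C f = Dom C g \<Longrightarrow> Fa F (f \<Zsemi>\<^bsub>C\<^esub> g) = Fa F f \<Zsemi>\<^bsub>D\<^esub> Fa F g"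
  shows "is_functor C D F"
  unfolding is_functor_def using assms by (auto simp: PiE_def)

context
  fixes C :: "('o, 'a) cat" and D :: "('p, 'b) cat" and F :: "('o, 'a, 'p, 'b) ftor"
  assumes F: "is_functor C D F"
begin

lemma functor_src: "is_category C"
  and functor_tgt: "is_category D"
  and functor_Fo [simp]: "A \<in> Obj C \<Longrightarrow> Fo F A \<in> Obj D"
  and functor_Fa [simp]: "f \<in> Arr C \<Longrightarrow> Fa F f \<in> Arr D"
  and functor_dom [simp]: "f \<in> Arr C \<Longrightarrow> Dom D (Fa F f) = Fo F (Dom C f)"
  and functor_cod [simp]: "f \<in> Arr C \<Longrightarrow> Cod D (Fa F f) = Fo F (Cod C f)"
  and functor_id [simp]: "A \<in> Obj C \<Longrightarrow> Fa F (Ident C A) = Ident D (Fo F A)"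
  and functor_comp: "f \<in> Arr C \<Longrightarrow> g \<in> Arr C \<Longrightarrow> Cod C f = Dom C g \<Longrightarrow> Fa F (f \<Zsemi>\<^bsub>C\<^esub> g) = Fa F f \<Zsemi>\<^bsub>D\<^esub> Fa F g"
  and functor_Fo_ext: "Fo F \<in> extensional (Obj C)"
  and functor_Fa_ext: "Fa F \<in> extensional (Arr C)"
  using F unfolding is_functor_def PiE_def by auto

end

lemma functor_eqI:
  fixes F G :: "('o, 'a, 'p, 'b) ftor"
  assumes F: "is_functor C D F" and G: "is_functor C D' G"
    and "\<And>A. A \<in> Obj C \<Longrightarrow> Fo F A = Fo G A" "\<And>f. f \<in> Arr C \<Longrightarrow> Fa F f = Fa G f"
  shows "F = G"
proof -
  have "Fo F = Fo G"
    by (rule extensionalityI[OF functor_Fo_ext[OF F] functor_Fo_ext[OF G]]) (rule assms)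
  moreover have "Fa F = Fa G"
    by (rule extensionalityI[OF functor_Fa_ext[OF F] functor_Fa_ext[OF G]]) (rule assms)
  ultimately show ?thesis by (cases F; cases G) simp
qed

lemma id_functor_simps [simp]:
  "A \<in> Obj C \<Longrightarrow> Fo (id_functor C) A = A" "f \<in> Arr C \<Longrightarrow> Fa (id_functor C) f = f"
  by (simp_all add: id_functor_def)

lemma fcomp_simps [simp]:
  "A \<in> Obj C \<Longrightarrow> Fo (fcomp C F G) A = Fo G (Fo F A)"
  "f \<in> Arr C \<Longrightarrow> Fa (fcomp C F G) f = Fa G (Fa F f)"
  by (simp_all add: fcomp_def compose_def)

lemma id_functor_functor: "is_category C \<Longrightarrow> is_functor C C (id_functor C)"
  by (rule is_functorI) (auto simp: id_functor_def)

lemma fcomp_functor: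
  assumes F: "is_functor C D F" and G: "is_functor D E G"
  shows "is_functor C E (fcomp C F G)"
proof (rule is_functorI)
  show "is_category C" "is_category E" using functor_src[OF F] functor_tgt[OF G] by auto
  show "Fo (fcomp C F G) \<in> extensional (Obj C)" "Fa (fcomp C F G) \<in> extensional (Arr C)"
    by (simp_all add: fcomp_def)
qed (use functor_src[OF F] F G in \<open>simp_all add: functor_comp[OF F] functor_comp[OF G]\<close>)

lemma fcomp_assoc:
  assumes "is_functor A B F" "is_functor B C G" "is_functor C D H"
  shows "fcomp A (fcomp A F G) H = fcomp A F (fcomp B G H)"
  by (rule functor_eqI[of A D _ D]) (use assms in \<open>simp_all add: fcomp_functor[of _ _ _ D] fcomp_functor[of _ C _ D]
     fcomp_functor[of _ B _ D] fcomp_functor[of _ B _ C]\<close>)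

lemma fcomp_id_left: "is_functor C D F \<Longrightarrow> fcomp C (id_functor C) F = F"
  by (rule functor_eqI[of C D _ D]) (simp_all add: fcomp_functor[OF id_functor_functor] functor_src)

lemma fcomp_id_right: "is_functor C D F \<Longrightarrow> fcomp C F (id_functor D) = F"
  by (rule functor_eqI[of C D _ D]) (simp_all add: fcomp_functor[OF _ id_functor_functor] functor_tgt)

lemma is_ntransI:
  assumes "is_functor C D (Nsrc t)" "is_functor C D (Ntgt t)" "Ncomp t \<in> extensional (Obj C)"
    and "\<And>A. A \<in> Obj C \<Longrightarrow> Ncomp t A \<in> Arr D"
    and "\<And>A. A \<in> Obj C \<Longrightarrow> Dom D (Ncomp t A) = Fo (Nsrc t) A"
    and "\<And>A. A \<in> Obj C \<Longrightarrow> Cod D (Ncomp t A) = Fo (Ntgt t) A"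
    and "\<And>f. f \<in> Arr C \<Longrightarrow> Fa (Nsrc t) f \<Zsemi>\<^bsub>D\<^esub> Ncomp t (Cod C f) = Ncomp t (Dom C f) \<Zsemi>\<^bsub>D\<^esub> Fa (Ntgt t) f"
  shows "is_ntrans C D t"
  unfolding is_ntrans_def using assms by (auto simp: PiE_def)

context
  fixes C :: "('o, 'a) cat" and D :: "('p, 'b) cat" and t :: "('o, 'a, 'p, 'b) ntrans"
  assumes t: "is_ntrans C D t"
begin

lemma ntrans_src: "is_functor C D (Nsrc t)"
  and ntrans_tgt: "is_functor C D (Ntgt t)"
  and ntrans_arr [simp]: "A \<in> Obj C \<Longrightarrow> Ncomp t A \<in> Arr D"
  and ntrans_dom [simp]: "A \<in> Obj C \<Longrightarrow> Dom D (Ncomp t A) = Fo (Nsrc t) A"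
  and ntrans_cod [simp]: "A \<in> Obj C \<Longrightarrow> Cod D (Ncomp t A) = Fo (Ntgt t) A"
  and ntrans_nat: "f \<in> Arr C \<Longrightarrow> Fa (Nsrc t) f \<Zsemi>\<^bsub>D\<^esub> Ncomp t (Cod C f) = Ncomp t (Dom C f) \<Zsemi>\<^bsub>D\<^esub> Fa (Ntgt t) f"
  and ntrans_ext: "Ncomp t \<in> extensional (Obj C)"
  using t unfolding is_ntrans_def PiE_def by auto

end

lemma ntrans_eqI:
  fixes s t :: "('o, 'a, 'p, 'b) ntrans"
  assumes s: "is_ntrans C D s" and t: "is_ntrans C D t"
    and "Nsrc s = Nsrc t" "Ntgt s = Ntgt t" "\<And>A. A \<in> Obj C \<Longrightarrow> Ncomp s A = Ncomp t A"
  shows "s = t"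
proof -
  have "Ncomp s = Ncomp t"
    by (rule extensionalityI[OF ntrans_ext[OF s] ntrans_ext[OF t]]) (rule assms)
  then show ?thesis using assms(3,4) by (cases s; cases t) simp
qed

lemma functor_cat_simps [simp]:
  "Obj (functor_cat C D) = {F. is_functor C D F}" "Arr (functor_cat C D) = {t. is_ntrans C D t}"
  "Dom (functor_cat C D) = Nsrc" "Cod (functor_cat C D) = Ntgt"
  "Nsrc (Ident (functor_cat C D) F) = F" "Ntgt (Ident (functor_cat C D) F) = F"
  "A \<in> Obj C \<Longrightarrow> Ncomp (Ident (functor_cat C D) F) A = Ident D (Fo F A)"
  "Nsrc (s \<Zsemi>\<^bsub>functor_cat C D\<^esub> t) = Nsrc s" "Ntgt (s \<Zsemi>\<^bsub>functor_cat C D\<^esub> t) = Ntgt t"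
  "A \<in> Obj C \<Longrightarrow> Ncomp (s \<Zsemi>\<^bsub>functor_cat C D\<^esub> t) A = Ncomp s A \<Zsemi>\<^bsub>D\<^esub> Ncomp t A"
  by (simp_all add: functor_cat_def)

lemma ntrans_id:
  assumes F: "is_functor C D F"
  shows "is_ntrans C D (Ident (functor_cat C D) F)"
proof (rule is_ntransI)
  show "Ncomp (Ident (functor_cat C D) F) \<in> extensional (Obj C)"
    by (simp add: functor_cat_def)
next
  fix f assume "f \<in> Arr C"
  then show "Fa (Nsrc (Ident (functor_cat C D) F)) f \<Zsemi>\<^bsub>D\<^esub> Ncomp (Ident (functor_cat C D) F) (Cod C f)
    = Ncomp (Ident (functor_cat C D) F) (Dom C f) \<Zsemi>\<^bsub>D\<^esub> Fa (Ntgt (Ident (functor_cat C D) F)) f"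
    using F functor_src[OF F] functor_tgt[OF F] by (simp add: cat_id_left cat_id_right)
qed (use F functor_src[OF F] functor_tgt[OF F] in simp_all)

lemma ntrans_comp:
  assumes s: "is_ntrans C D s" and t: "is_ntrans C D t" and st: "Ntgt s = Nsrc t"
  shows "is_ntrans C D (s \<Zsemi>\<^bsub>functor_cat C D\<^esub> t)"
proof (rule is_ntransI)
  note C = functor_src[OF ntrans_src[OF s]] and D = functor_tgt[OF ntrans_src[OF s]]
  note F = ntrans_src[OF s] ntrans_src[OF t] ntrans_tgt[OF s] ntrans_tgt[OF t]
  show "Ncomp (s \<Zsemi>\<^bsub>functor_cat C D\<^esub> t) \<in> extensional (Obj C)"
    by (simp add: functor_cat_def)
  fix f assume f: "f \<in> Arr C"
  have "Fa (Nsrc s) f \<Zsemi>\<^bsub>D\<^esub> (Ncomp s (Cod C f) \<Zsemi>\<^bsub>D\<^esub> Ncomp t (Cod C f))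
      = (Fa (Nsrc s) f \<Zsemi>\<^bsub>D\<^esub> Ncomp s (Cod C f)) \<Zsemi>\<^bsub>D\<^esub> Ncomp t (Cod C f)"
    using f C D s t st F by (simp add: cat_assoc)
  also have "\<dots> = Ncomp s (Dom C f) \<Zsemi>\<^bsub>D\<^esub> (Fa (Nsrc t) f \<Zsemi>\<^bsub>D\<^esub> Ncomp t (Cod C f))"
    using f C D s t st F by (simp add: cat_assoc ntrans_nat[OF s])
  also have "\<dots> = Ncomp s (Dom C f) \<Zsemi>\<^bsub>D\<^esub> Ncomp t (Dom C f) \<Zsemi>\<^bsub>D\<^esub> Fa (Ntgt t) f"
    using f C D s t st F by (simp add: cat_assoc ntrans_nat[OF t])
  finally show "Fa (Nsrc (s \<Zsemi>\<^bsub>functor_cat C D\<^esub> t)) f \<Zsemi>\<^bsub>D\<^esub> Ncomp (s \<Zsemi>\<^bsub>functor_cat C D\<^esub> t) (Cod C f)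
    = Ncomp (s \<Zsemi>\<^bsub>functor_cat C D\<^esub> t) (Dom C f) \<Zsemi>\<^bsub>D\<^esub> Fa (Ntgt (s \<Zsemi>\<^bsub>functor_cat C D\<^esub> t)) f"
    using f C by simp
qed (use assms ntrans_src[OF s] ntrans_tgt[OF t] functor_tgt[OF ntrans_src[OF s]] in simp_all)

lemma functor_cat_category:
  assumes "is_category C" "is_category D"
  shows "is_category (functor_cat C D)"
proof (rule is_categoryI, goal_cases)
  case (9 f)
  then have f: "is_ntrans C D f" by simp
  show ?case
    by (rule ntrans_eqI[of C D]) (use f assms ntrans_src[OF f] in
      \<open>simp_all add: ntrans_comp ntrans_id cat_id_left\<close>)
next
  case (10 f)
  then have f: "is_ntrans C D f" by simp
  show ?case
    by (rule ntrans_eqI[of C D]) (use f assms ntrans_tgt[OF f] in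
      \<open>simp_all add: ntrans_comp ntrans_id cat_id_right\<close>)
next
  case (11 f g h)
  then have f: "is_ntrans C D f" "is_ntrans C D g" "is_ntrans C D h" by simp_all
  show ?case
    by (rule ntrans_eqI[of C D]) (use f assms 11 in
      \<open>simp_all add: ntrans_comp cat_assoc\<close>)
qed (auto simp: ntrans_src ntrans_tgt ntrans_id ntrans_comp)

lemma full_subcat_simps [simp]:
  "Obj (full_subcat C X) = Obj C \<inter> X" "Arr (full_subcat C X) = {f \<in> Arr C. Dom C f \<in> X \<and> Cod C f \<in> X}"
  "Dom (full_subcat C X) = Dom C" "Cod (full_subcat C X) = Cod C" "Ident (full_subcat C X) = Ident C"
  "Comp (full_subcat C X) = Comp C"
  by (simp_all add: full_subcat_def)

lemma full_subcat_category: "is_category C \<Longrightarrow> is_category (full_subcat C X)"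
  by (rule is_categoryI) (simp_all add: cat_id_left cat_id_right cat_assoc)

lemma op_cat_simps [simp]:
  "Obj (op_cat C) = Obj C" "Arr (op_cat C) = Arr C" "Dom (op_cat C) = Cod C" "Cod (op_cat C) = Dom C"
  "Ident (op_cat C) = Ident C" "f \<Zsemi>\<^bsub>op_cat C\<^esub> g = g \<Zsemi>\<^bsub>C\<^esub> f"
  by (simp_all add: op_cat_def)

lemma op_cat_category: "is_category C \<Longrightarrow> is_category (op_cat C)"
  by (rule is_categoryI) (simp_all add: cat_id_left cat_id_right cat_assoc)

subsection \<open>Fully faithful functors that are surjective on objects are equivalences\<close>

text \<open>The set of arrows from \<open>A\<close> to \<open>B\<close>.\<close>

definition hom :: "('o, 'a) cat \<Rightarrow> 'o \<Rightarrow> 'o \<Rightarrow> 'a set" where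
  "hom C A B = {f \<in> Arr C. Dom C f = A \<and> Cod C f = B}"

lemma isomorphicI:
  assumes "A \<in> Obj C" "B \<in> Obj C" "f \<in> Arr C" "g \<in> Arr C" "Dom C f = A" "Cod C f = B" "Dom C g = B" "Cod C g = A"
    and "f \<Zsemi>\<^bsub>C\<^esub> g = Ident C A" "g \<Zsemi>\<^bsub>C\<^esub> f = Ident C B"
  shows "isomorphic C A B"
  unfolding isomorphic_def using assms by blast

lemma isomorphic_sym: "isomorphic C A B \<Longrightarrow> isomorphic C B A"
  unfolding isomorphic_def by blast

lemma equivalence_inverse:
  assumes "is_equivalence C D G" shows "\<exists>H. is_equivalence D C H"
proof -
  from assms obtain H where "is_functor C D G" "is_functor D C H"
    "isomorphic (functor_cat C C) (id_functor C) (fcomp C G H)"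
    "isomorphic (functor_cat D D) (fcomp D H G) (id_functor D)"
    unfolding is_equivalence_def by blast
  then have "is_equivalence D C H"
    unfolding is_equivalence_def by (auto intro!: exI[of _ G] isomorphic_sym)
  then show ?thesis ..
qed

text \<open>Surjectivity on objects is required literally, not up to isomorphism. The chosen inverse is then a strict
section, so that only one of the two natural isomorphisms is not an identity.\<close>

lemma ff_surj_equivalence:
  assumes G: "is_functor C D G"
    and surj: "Fo G ` Obj C = Obj D"
    and ff: "\<And>A B. A \<in> Obj C \<Longrightarrow> B \<in> Obj C \<Longrightarrow> bij_betw (Fa G) (hom C A B) (hom D (Fo G A) (Fo G B))"
  shows "is_equivalence C D G"
proof -
  note C = functor_src[OF G] and D = functor_tgt[OF G]
  define h where "h B = (SOME A. A \<in> Obj C \<and> Fo G A = B)" for B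
  have h: "h B \<in> Obj C" "Fo G (h B) = B" if "B \<in> Obj D" for B
  proof -
    have "\<exists>A. A \<in> Obj C \<and> Fo G A = B" using that unfolding surj[symmetric] by auto
    from someI_ex[OF this] show "h B \<in> Obj C" "Fo G (h B) = B" by (auto simp: h_def)
  qed
  define l where "l A B b = the_inv_into (hom C A B) (Fa G) b" for A B b
  have l: "l A B b \<in> Arr C" "Dom C (l A B b) = A" "Cod C (l A B b) = B" "Fa G (l A B b) = b"
    if "A \<in> Obj C" "B \<in> Obj C" "b \<in> Arr D" "Dom D b = Fo G A" "Cod D b = Fo G B" for A B b
  proof -
    note bij = ff[OF that(1,2)]
    have b: "b \<in> Fa G ` hom C A B" using bij that by (auto simp: bij_betw_def hom_def)
    have "l A B b \<in> hom C A B"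
      unfolding l_def by (rule the_inv_into_into[OF bij_betw_imp_inj_on[OF bij] b]) simp
    then show "l A B b \<in> Arr C" "Dom C (l A B b) = A" "Cod C (l A B b) = B" by (auto simp: hom_def)
    show "Fa G (l A B b) = b"
      unfolding l_def by (rule f_the_inv_into_f[OF bij_betw_imp_inj_on[OF bij] b])
  qed
  have faithful: "f = g" if "f \<in> Arr C" "g \<in> Arr C" "Dom C f = Dom C g" "Cod C f = Cod C g" "Fa G f = Fa G g" for f g
    using bij_betw_imp_inj_on[OF ff[of "Dom C f" "Cod C f"]] that C by (auto simp: hom_def inj_on_def)
  define H where "H = \<lparr>Fo = restrict h (Obj D), Fa = (\<lambda>b\<in>Arr D. l (h (Dom D b)) (h (Cod D b)) b)\<rparr>"
  have Ho: "Fo H B = h B" if "B \<in> Obj D" for B using that by (simp add: H_def)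
  have Ha: "Fa H b \<in> Arr C" "Dom C (Fa H b) = h (Dom D b)" "Cod C (Fa H b) = h (Cod D b)" "Fa G (Fa H b) = b"
    if "b \<in> Arr D" for b
    using l[of "h (Dom D b)" "h (Cod D b)" b] that D by (simp_all add: H_def h)
  have H: "is_functor D C H"
  proof (rule is_functorI)
    show "Fo H \<in> extensional (Obj D)" "Fa H \<in> extensional (Arr D)" by (simp_all add: H_def)
    show "Fa H (Ident D B) = Ident C (Fo H B)" if "B \<in> Obj D" for B
      by (rule faithful) (use that C D G in \<open>simp_all add: Ha Ho h\<close>)
    show "Fa H (f \<Zsemi>\<^bsub>D\<^esub> g) = Fa H f \<Zsemi>\<^bsub>C\<^esub> Fa H g" if "f \<in> Arr D" "g \<in> Arr D" "Cod D f = Dom D g" for f g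
      by (rule faithful) (use that C D G in \<open>simp_all add: Ha functor_comp[OF G]\<close>)
  qed (use C D in \<open>simp_all add: Ha Ho h\<close>)
  have HG: "is_functor D D (fcomp D H G)" and GH: "is_functor C C (fcomp C G H)"
    by (rule fcomp_functor[OF H G] fcomp_functor[OF G H])+
  have idC: "is_functor C C (id_functor C)" and idD: "is_functor D D (id_functor D)"
    using C D by (simp_all add: id_functor_functor)
  have "fcomp D H G = id_functor D"
    by (rule functor_eqI[OF HG idD]) (simp_all add: Ha Ho h)
  moreover have "isomorphic (functor_cat D D) (id_functor D) (id_functor D)"
  proof -
    let ?i = "Ident (functor_cat D D) (id_functor D)"
    have "is_ntrans D D ?i" by (rule ntrans_id[OF idD])
    moreover have "?i \<Zsemi>\<^bsub>functor_cat D D\<^esub> ?i = ?i"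
      by (rule cat_id_left[OF functor_cat_category[OF D D]]) (simp_all add: ntrans_id[OF idD])
    ultimately show ?thesis using idD by (intro isomorphicI[of _ _ _ ?i ?i]) simp_all
  qed
  moreover have "isomorphic (functor_cat C C) (id_functor C) (fcomp C G H)"
  proof -
    define s where "s = \<lparr>Nsrc = id_functor C, Ntgt = fcomp C G H,
      Ncomp = (\<lambda>A\<in>Obj C. l A (h (Fo G A)) (Ident D (Fo G A)))\<rparr>"
    define t where "t = \<lparr>Nsrc = fcomp C G H, Ntgt = id_functor C,
      Ncomp = (\<lambda>A\<in>Obj C. l (h (Fo G A)) A (Ident D (Fo G A)))\<rparr>"
    have sf: "Nsrc s = id_functor C" "Ntgt s = fcomp C G H" "Nsrc t = fcomp C G H" "Ntgt t = id_functor C"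
      by (simp_all add: s_def t_def)
    have sa: "Ncomp s A \<in> Arr C" "Dom C (Ncomp s A) = A" "Cod C (Ncomp s A) = h (Fo G A)"
      "Fa G (Ncomp s A) = Ident D (Fo G A)" if "A \<in> Obj C" for A
      using that l[of A "h (Fo G A)" "Ident D (Fo G A)"] h[of "Fo G A"] G C D by (simp_all add: s_def)
    have ta: "Ncomp t A \<in> Arr C" "Cod C (Ncomp t A) = A" "Dom C (Ncomp t A) = h (Fo G A)"
      "Fa G (Ncomp t A) = Ident D (Fo G A)" if "A \<in> Obj C" for A
      using that l[of "h (Fo G A)" A "Ident D (Fo G A)"] h[of "Fo G A"] G C D by (simp_all add: t_def)
    have s: "is_ntrans C C s"
    proof (rule is_ntransI)
      show "Ncomp s \<in> extensional (Obj C)" by (simp add: s_def)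
      fix f assume f: "f \<in> Arr C"
      show "Fa (Nsrc s) f \<Zsemi>\<^bsub>C\<^esub> Ncomp s (Cod C f) = Ncomp s (Dom C f) \<Zsemi>\<^bsub>C\<^esub> Fa (Ntgt s) f"
        by (rule faithful) (use f C D G in \<open>simp_all add: sf sa Ha functor_comp[OF G] cat_id_left cat_id_right\<close>)
    qed (use sf idC GH sa G Ho in simp_all)
    have t: "is_ntrans C C t"
    proof (rule is_ntransI)
      show "Ncomp t \<in> extensional (Obj C)" by (simp add: t_def)
      fix f assume f: "f \<in> Arr C"
      show "Fa (Nsrc t) f \<Zsemi>\<^bsub>C\<^esub> Ncomp t (Cod C f) = Ncomp t (Dom C f) \<Zsemi>\<^bsub>C\<^esub> Fa (Ntgt t) f"
        by (rule faithful) (use f C D G in \<open>simp_all add: sf ta Ha functor_comp[OF G] cat_id_left cat_id_right\<close>)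
    qed (use sf idC GH ta G Ho in simp_all)
    have "s \<Zsemi>\<^bsub>functor_cat C C\<^esub> t = Ident (functor_cat C C) (id_functor C)"
    proof (rule ntrans_eqI[of C C])
      fix A assume A: "A \<in> Obj C"
      show "Ncomp (s \<Zsemi>\<^bsub>functor_cat C C\<^esub> t) A = Ncomp (Ident (functor_cat C C) (id_functor C)) A"
        by (rule faithful) (use A C D G in \<open>simp_all add: sa ta functor_comp[OF G] cat_id_left\<close>)
    qed (simp_all add: s t sf ntrans_comp ntrans_id idC)
    moreover have "t \<Zsemi>\<^bsub>functor_cat C C\<^esub> s = Ident (functor_cat C C) (fcomp C G H)"
    proof (rule ntrans_eqI[of C C])
      fix A assume A: "A \<in> Obj C"
      show "Ncomp (t \<Zsemi>\<^bsub>functor_cat C C\<^esub> s) A = Ncomp (Ident (functor_cat C C) (fcomp C G H)) A"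
        by (rule faithful) (use A C D G h[of "Fo G A"] in \<open>simp_all add: Ho sa ta functor_comp[OF G] cat_id_left\<close>)
    qed (simp_all add: s t sf ntrans_comp ntrans_id GH)
    ultimately show ?thesis
      using s t sf idC GH by (intro isomorphicI[of _ _ _ s t]) simp_all
  qed
  ultimately show ?thesis
    unfolding is_equivalence_def using G H by (auto intro!: exI[of _ H])
qed

section \<open>Adjunctions and their category\<close>

lemma adjn_is_adjunctionI:
  assumes L: "is_functor (Asrc U) (Atgt U) (Aleft U)" and R: "is_functor (Atgt U) (Asrc U) (Aright U)"
    and u: "Nsrc (Aunit U) = id_functor (Asrc U)" "Ntgt (Aunit U) = fcomp (Asrc U) (Aleft U) (Aright U)"
      "Ncomp (Aunit U) \<in> extensional (Obj (Asrc U))"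
    and c: "Nsrc (Acounit U) = fcomp (Atgt U) (Aright U) (Aleft U)" "Ntgt (Acounit U) = id_functor (Atgt U)"
      "Ncomp (Acounit U) \<in> extensional (Obj (Atgt U))"
    and ua: "\<And>S. S \<in> Obj (Asrc U) \<Longrightarrow> Ncomp (Aunit U) S \<in> hom (Asrc U) S (Fo (Aright U) (Fo (Aleft U) S))"
    and ca: "\<And>T. T \<in> Obj (Atgt U) \<Longrightarrow> Ncomp (Acounit U) T \<in> hom (Atgt U) (Fo (Aleft U) (Fo (Aright U) T)) T"
    and un: "\<And>f. f \<in> Arr (Asrc U) \<Longrightarrow> f \<Zsemi>\<^bsub>Asrc U\<^esub> Ncomp (Aunit U) (Cod (Asrc U) f)
       = Ncomp (Aunit U) (Dom (Asrc U) f) \<Zsemi>\<^bsub>Asrc U\<^esub> Fa (Aright U) (Fa (Aleft U) f)"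
    and cn: "\<And>g. g \<in> Arr (Atgt U) \<Longrightarrow> Fa (Aleft U) (Fa (Aright U) g) \<Zsemi>\<^bsub>Atgt U\<^esub> Ncomp (Acounit U) (Cod (Atgt U) g)
       = Ncomp (Acounit U) (Dom (Atgt U) g) \<Zsemi>\<^bsub>Atgt U\<^esub> g"
    and t1: "\<And>S. S \<in> Obj (Asrc U) \<Longrightarrow> Fa (Aleft U) (Ncomp (Aunit U) S) \<Zsemi>\<^bsub>Atgt U\<^esub> Ncomp (Acounit U) (Fo (Aleft U) S)
        = Ident (Atgt U) (Fo (Aleft U) S)"
    and t2: "\<And>T. T \<in> Obj (Atgt U) \<Longrightarrow> Ncomp (Aunit U) (Fo (Aright U) T) \<Zsemi>\<^bsub>Asrc U\<^esub> Fa (Aright U) (Ncomp (Acounit U) T)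
        = Ident (Asrc U) (Fo (Aright U) T)"
  shows "is_adjunction U"
proof -
  note cats = functor_src[OF L] functor_tgt[OF L]
  note LR = fcomp_functor[OF L R] fcomp_functor[OF R L]
  have "is_ntrans (Asrc U) (Asrc U) (Aunit U)"
    by (rule is_ntransI) (use u ua un LR cats L R in \<open>auto simp: id_functor_functor hom_def\<close>)
  moreover have "is_ntrans (Atgt U) (Atgt U) (Acounit U)"
    by (rule is_ntransI) (use c ca cn LR cats L R in \<open>auto simp: id_functor_functor hom_def\<close>)
  ultimately show ?thesis
    unfolding is_adjunction_def using assms by auto
qed

context
  fixes U :: "('o, 'a) adjn"
  assumes U: "is_adjunction U"
begin

lemma adjn_left: "is_functor (Asrc U) (Atgt U) (Aleft U)"
  and adjn_right: "is_functor (Atgt U) (Asrc U) (Aright U)"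
  and adjn_unit: "is_ntrans (Asrc U) (Asrc U) (Aunit U)"
  and adjn_counit: "is_ntrans (Atgt U) (Atgt U) (Acounit U)"
  and adjn_unit_src: "Nsrc (Aunit U) = id_functor (Asrc U)"
  and adjn_unit_tgt: "Ntgt (Aunit U) = fcomp (Asrc U) (Aleft U) (Aright U)"
  and adjn_counit_src: "Nsrc (Acounit U) = fcomp (Atgt U) (Aright U) (Aleft U)"
  and adjn_counit_tgt: "Ntgt (Acounit U) = id_functor (Atgt U)"
  and adjn_tri1: "S \<in> Obj (Asrc U) \<Longrightarrow> Fa (Aleft U) (Ncomp (Aunit U) S) \<Zsemi>\<^bsub>Atgt U\<^esub> Ncomp (Acounit U) (Fo (Aleft U) S)
        = Ident (Atgt U) (Fo (Aleft U) S)"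
  and adjn_tri2: "T \<in> Obj (Atgt U) \<Longrightarrow> Ncomp (Aunit U) (Fo (Aright U) T) \<Zsemi>\<^bsub>Asrc U\<^esub> Fa (Aright U) (Ncomp (Acounit U) T)
        = Ident (Asrc U) (Fo (Aright U) T)"
  using U unfolding is_adjunction_def by auto

lemma adjn_src_cat: "is_category (Asrc U)" and adjn_tgt_cat: "is_category (Atgt U)"
  using functor_src[OF adjn_left] functor_tgt[OF adjn_left] by auto

lemma adjn_unit_arr [simp]: "S \<in> Obj (Asrc U) \<Longrightarrow> Ncomp (Aunit U) S \<in> Arr (Asrc U)"
  and adjn_unit_dom [simp]: "S \<in> Obj (Asrc U) \<Longrightarrow> Dom (Asrc U) (Ncomp (Aunit U) S) = S"
  and adjn_unit_cod [simp]: "S \<in> Obj (Asrc U) \<Longrightarrow> Cod (Asrc U) (Ncomp (Aunit U) S) = Fo (Aright U) (Fo (Aleft U) S)"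
  using adjn_unit by (simp_all add: adjn_unit_src adjn_unit_tgt ntrans_ext)

lemma adjn_counit_arr [simp]: "T \<in> Obj (Atgt U) \<Longrightarrow> Ncomp (Acounit U) T \<in> Arr (Atgt U)"
  and adjn_counit_dom [simp]: "T \<in> Obj (Atgt U) \<Longrightarrow> Dom (Atgt U) (Ncomp (Acounit U) T) = Fo (Aleft U) (Fo (Aright U) T)"
  and adjn_counit_cod [simp]: "T \<in> Obj (Atgt U) \<Longrightarrow> Cod (Atgt U) (Ncomp (Acounit U) T) = T"
  using adjn_counit by (simp_all add: adjn_counit_src adjn_counit_tgt ntrans_ext)

lemma adjn_unit_nat: "f \<in> Arr (Asrc U) \<Longrightarrow> Dom (Asrc U) f = S \<Longrightarrow> Cod (Asrc U) f = S' \<Longrightarrow>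
    f \<Zsemi>\<^bsub>Asrc U\<^esub> Ncomp (Aunit U) S' = Ncomp (Aunit U) S \<Zsemi>\<^bsub>Asrc U\<^esub> Fa (Aright U) (Fa (Aleft U) f)"
  using ntrans_nat[OF adjn_unit, of f] adjn_src_cat by (simp add: adjn_unit_src adjn_unit_tgt)

lemma adjn_counit_nat: "g \<in> Arr (Atgt U) \<Longrightarrow> Dom (Atgt U) g = T \<Longrightarrow> Cod (Atgt U) g = T' \<Longrightarrow>
    Fa (Aleft U) (Fa (Aright U) g) \<Zsemi>\<^bsub>Atgt U\<^esub> Ncomp (Acounit U) T' = Ncomp (Acounit U) T \<Zsemi>\<^bsub>Atgt U\<^esub> g"
  using ntrans_nat[OF adjn_counit, of g] adjn_tgt_cat by (simp add: adjn_counit_src adjn_counit_tgt)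

text \<open>The two transpositions between arrows \<open>L S \<rightarrow> T\<close> and arrows \<open>S \<rightarrow> R T\<close> are mutually inverse.\<close>

lemma adjn_transpose_inv:
  assumes "S \<in> Obj (Asrc U)" "T \<in> Obj (Atgt U)" "b \<in> hom (Asrc U) S (Fo (Aright U) T)"
  shows "Ncomp (Aunit U) S \<Zsemi>\<^bsub>Asrc U\<^esub> Fa (Aright U) (Fa (Aleft U) b \<Zsemi>\<^bsub>Atgt U\<^esub> Ncomp (Acounit U) T) = b"
proof -
  let ?A = "Asrc U" and ?R = "Fa (Aright U)" and ?L = "Fa (Aleft U)"
  note fs = adjn_left adjn_right adjn_src_cat adjn_tgt_cat
  have b: "b \<in> Arr ?A" "Dom ?A b = S" "Cod ?A b = Fo (Aright U) T" using assms by (auto simp: hom_def)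
  have "Ncomp (Aunit U) S \<Zsemi>\<^bsub>?A\<^esub> ?R (?L b \<Zsemi>\<^bsub>Atgt U\<^esub> Ncomp (Acounit U) T)
      = (Ncomp (Aunit U) S \<Zsemi>\<^bsub>?A\<^esub> ?R (?L b)) \<Zsemi>\<^bsub>?A\<^esub> ?R (Ncomp (Acounit U) T)"
    using assms b fs by (simp add: functor_comp[OF adjn_right] cat_assoc)
  also have "\<dots> = b \<Zsemi>\<^bsub>?A\<^esub> (Ncomp (Aunit U) (Fo (Aright U) T) \<Zsemi>\<^bsub>?A\<^esub> ?R (Ncomp (Acounit U) T))"
    using assms b fs by (simp add: adjn_unit_nat[OF b, symmetric] cat_assoc)
  also have "\<dots> = b" using assms b fs by (simp add: adjn_tri2 cat_id_right)
  finally show ?thesis .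
qed

lemma adjn_transpose_inv':
  assumes "S \<in> Obj (Asrc U)" "T \<in> Obj (Atgt U)" "a \<in> hom (Atgt U) (Fo (Aleft U) S) T"
  shows "Fa (Aleft U) (Ncomp (Aunit U) S \<Zsemi>\<^bsub>Asrc U\<^esub> Fa (Aright U) a) \<Zsemi>\<^bsub>Atgt U\<^esub> Ncomp (Acounit U) T = a"
proof -
  let ?B = "Atgt U" and ?R = "Fa (Aright U)" and ?L = "Fa (Aleft U)"
  note fs = adjn_left adjn_right adjn_src_cat adjn_tgt_cat
  have a: "a \<in> Arr ?B" "Dom ?B a = Fo (Aleft U) S" "Cod ?B a = T" using assms by (auto simp: hom_def)
  have "?L (Ncomp (Aunit U) S \<Zsemi>\<^bsub>Asrc U\<^esub> ?R a) \<Zsemi>\<^bsub>?B\<^esub> Ncomp (Acounit U) T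
      = ?L (Ncomp (Aunit U) S) \<Zsemi>\<^bsub>?B\<^esub> (?L (?R a) \<Zsemi>\<^bsub>?B\<^esub> Ncomp (Acounit U) T)"
    using assms a fs by (simp add: functor_comp[OF adjn_left] cat_assoc)
  also have "\<dots> = (?L (Ncomp (Aunit U) S) \<Zsemi>\<^bsub>?B\<^esub> Ncomp (Acounit U) (Fo (Aleft U) S)) \<Zsemi>\<^bsub>?B\<^esub> a"
    using assms a fs by (simp add: adjn_counit_nat[OF a] cat_assoc)
  also have "\<dots> = a" using assms a fs by (simp add: adjn_tri1 cat_id_left)
  finally show ?thesis .
qed

lemma adjn_transpose_in:
  assumes "S \<in> Obj (Asrc U)" "T \<in> Obj (Atgt U)" "a \<in> hom (Atgt U) (Fo (Aleft U) S) T"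
  shows "Ncomp (Aunit U) S \<Zsemi>\<^bsub>Asrc U\<^esub> Fa (Aright U) a \<in> hom (Asrc U) S (Fo (Aright U) T)"
  using assms adjn_src_cat adjn_right adjn_left by (auto simp: hom_def)

lemma adjn_transpose_in':
  assumes "S \<in> Obj (Asrc U)" "T \<in> Obj (Atgt U)" "b \<in> hom (Asrc U) S (Fo (Aright U) T)"
  shows "Fa (Aleft U) b \<Zsemi>\<^bsub>Atgt U\<^esub> Ncomp (Acounit U) T \<in> hom (Atgt U) (Fo (Aleft U) S) T"
  using assms adjn_tgt_cat adjn_right adjn_left by (auto simp: hom_def)

lemma adjn_transpose_bij:
  assumes "S \<in> Obj (Asrc U)" "T \<in> Obj (Atgt U)"
  shows "bij_betw (\<lambda>a. Ncomp (Aunit U) S \<Zsemi>\<^bsub>Asrc U\<^esub> Fa (Aright U) a)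
    (hom (Atgt U) (Fo (Aleft U) S) T) (hom (Asrc U) S (Fo (Aright U) T))"
  by (rule bij_betw_byWitness[where f' = "\<lambda>b. Fa (Aleft U) b \<Zsemi>\<^bsub>Atgt U\<^esub> Ncomp (Acounit U) T"])
    (use assms adjn_transpose_inv adjn_transpose_inv' adjn_transpose_in adjn_transpose_in' in auto)

end

lemma adjn_eqI:
  fixes U V :: "('o, 'a) adjn"
  assumes U: "is_adjunction U" and V: "is_adjunction V"
    and eq: "Asrc U = Asrc V" "Atgt U = Atgt V" "Aleft U = Aleft V" "Aright U = Aright V"
    and un: "\<And>S. S \<in> Obj (Asrc U) \<Longrightarrow> Ncomp (Aunit U) S = Ncomp (Aunit V) S"
    and co: "\<And>T. T \<in> Obj (Atgt U) \<Longrightarrow> Ncomp (Acounit U) T = Ncomp (Acounit V) T"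
  shows "U = V"
proof -
  have "Aunit U = Aunit V"
    by (rule ntrans_eqI[of "Asrc U" "Asrc U"]) (use adjn_unit[OF U] adjn_unit[OF V] eq un in
      \<open>simp_all add: adjn_unit_src[OF U] adjn_unit_src[OF V] adjn_unit_tgt[OF U] adjn_unit_tgt[OF V]\<close>)
  moreover have "Acounit U = Acounit V"
    by (rule ntrans_eqI[of "Atgt U" "Atgt U"]) (use adjn_counit[OF U] adjn_counit[OF V] eq co in
      \<open>simp_all add: adjn_counit_src[OF U] adjn_counit_src[OF V] adjn_counit_tgt[OF U] adjn_counit_tgt[OF V]\<close>)
  ultimately show ?thesis using eq by (cases U; cases V) simp
qed

lemma Adj_simps [simp]:
  "Obj Adj = {A. is_category A}" "Arr Adj = {U. is_adjunction U}" "Dom Adj = Asrc" "Cod Adj = Atgt"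
  "Asrc (Ident Adj A) = A" "Atgt (Ident Adj A) = A" "Aleft (Ident Adj A) = id_functor A"
  "Aright (Ident Adj A) = id_functor A"
  "S \<in> Obj A \<Longrightarrow> Ncomp (Aunit (Ident Adj A)) S = Ident A S"
  "S \<in> Obj A \<Longrightarrow> Ncomp (Acounit (Ident Adj A)) S = Ident A S"
  "Asrc (U \<Zsemi>\<^bsub>Adj\<^esub> V) = Asrc U" "Atgt (U \<Zsemi>\<^bsub>Adj\<^esub> V) = Atgt V"
  "Aleft (U \<Zsemi>\<^bsub>Adj\<^esub> V) = fcomp (Asrc U) (Aleft U) (Aleft V)"
  "Aright (U \<Zsemi>\<^bsub>Adj\<^esub> V) = fcomp (Atgt V) (Aright V) (Aright U)"
  "S \<in> Obj (Asrc U) \<Longrightarrow> Ncomp (Aunit (U \<Zsemi>\<^bsub>Adj\<^esub> V)) S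
     = Ncomp (Aunit U) S \<Zsemi>\<^bsub>Asrc U\<^esub> Fa (Aright U) (Ncomp (Aunit V) (Fo (Aleft U) S))"
  "T \<in> Obj (Atgt V) \<Longrightarrow> Ncomp (Acounit (U \<Zsemi>\<^bsub>Adj\<^esub> V)) T
     = Fa (Aleft V) (Ncomp (Acounit U) (Fo (Aright V) T)) \<Zsemi>\<^bsub>Atgt V\<^esub> Ncomp (Acounit V) T"
  by (simp_all add: Adj_def)

lemma Adj_id:
  assumes A: "is_category A"
  shows "is_adjunction (Ident Adj A)"
proof (rule adjn_is_adjunctionI)
  let ?I = "Ident Adj A"
  show "Nsrc (Aunit ?I) = id_functor (Asrc ?I)"
    "Ncomp (Aunit ?I) \<in> extensional (Obj (Asrc ?I))"
    "Ntgt (Acounit ?I) = id_functor (Atgt ?I)"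
    "Ncomp (Acounit ?I) \<in> extensional (Obj (Atgt ?I))"
    by (simp_all add: Adj_def functor_cat_def)
  show "Ntgt (Aunit ?I) = fcomp (Asrc ?I) (Aleft ?I) (Aright ?I)"
    "Nsrc (Acounit ?I) = fcomp (Atgt ?I) (Aright ?I) (Aleft ?I)"
    using fcomp_id_left[OF id_functor_functor[OF A]] by (simp_all add: Adj_def)
qed (use A in \<open>simp_all add: id_functor_functor hom_def cat_id_left cat_id_right\<close>)

lemma Adj_comp:
  assumes U: "is_adjunction U" and V: "is_adjunction V" and UV: "Atgt U = Asrc V"
  shows "is_adjunction (U \<Zsemi>\<^bsub>Adj\<^esub> V)"
proof (rule adjn_is_adjunctionI)
  let ?W = "U \<Zsemi>\<^bsub>Adj\<^esub> V"
  let ?A = "Asrc U" and ?B = "Asrc V" and ?C = "Atgt V"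
  let ?L = "Aleft U" and ?R = "Aright U" and ?L' = "Aleft V" and ?R' = "Aright V"
  let ?e = "Ncomp (Aunit U)" and ?e' = "Ncomp (Aunit V)" and ?c = "Ncomp (Acounit U)" and ?c' = "Ncomp (Acounit V)"
  note fs = adjn_left[OF U, unfolded UV] adjn_right[OF U, unfolded UV] adjn_left[OF V] adjn_right[OF V]
  note cats = adjn_src_cat[OF U] adjn_src_cat[OF V] adjn_tgt_cat[OF V]
  note us = adjn_unit_arr[OF U] adjn_unit_dom[OF U] adjn_unit_cod[OF U]
    adjn_counit_arr[OF U, unfolded UV] adjn_counit_dom[OF U, unfolded UV] adjn_counit_cod[OF U, unfolded UV]
    adjn_unit_arr[OF V] adjn_unit_dom[OF V] adjn_unit_cod[OF V]
    adjn_counit_arr[OF V] adjn_counit_dom[OF V] adjn_counit_cod[OF V]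
  note comps = functor_comp[OF fs(1)] functor_comp[OF fs(2)] functor_comp[OF fs(3)] functor_comp[OF fs(4)]
  show "is_functor (Asrc ?W) (Atgt ?W) (Aleft ?W)"
    "is_functor (Atgt ?W) (Asrc ?W) (Aright ?W)"
    using fcomp_functor[OF fs(1,3)] fcomp_functor[OF fs(4,2)] by simp_all
  show "Nsrc (Aunit ?W) = id_functor (Asrc ?W)"
    "Ncomp (Aunit ?W) \<in> extensional (Obj (Asrc ?W))"
    "Ntgt (Acounit ?W) = id_functor (Atgt ?W)"
    "Ncomp (Acounit ?W) \<in> extensional (Obj (Atgt ?W))"
    "Ntgt (Aunit ?W) = fcomp (Asrc ?W) (Aleft ?W) (Aright ?W)"
    "Nsrc (Acounit ?W) = fcomp (Atgt ?W) (Aright ?W) (Aleft ?W)"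
    by (simp_all add: Adj_def)
  show "Ncomp (Aunit ?W) S \<in> hom (Asrc ?W) S (Fo (Aright ?W) (Fo (Aleft ?W) S))"
    if "S \<in> Obj (Asrc ?W)" for S
    using that fs cats us by (simp add: hom_def)
  show "Ncomp (Acounit ?W) T \<in> hom (Atgt ?W) (Fo (Aleft ?W) (Fo (Aright ?W) T)) T"
    if "T \<in> Obj (Atgt ?W)" for T
    using that fs cats us by (simp add: hom_def)
  show "f \<Zsemi>\<^bsub>Asrc ?W\<^esub> Ncomp (Aunit ?W) (Cod (Asrc ?W) f)
       = Ncomp (Aunit ?W) (Dom (Asrc ?W) f) \<Zsemi>\<^bsub>Asrc ?W\<^esub> Fa (Aright ?W) (Fa (Aleft ?W) f)"
    if "f \<in> Arr (Asrc ?W)" for f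
  proof -
    define S S' where "S = Dom ?A f" and "S' = Cod ?A f"
    have f: "f \<in> Arr ?A" "Dom ?A f = S" "Cod ?A f = S'" "S \<in> Obj ?A" "S' \<in> Obj ?A"
      using that cats by (auto simp: S_def S'_def)
    have "f \<Zsemi>\<^bsub>?A\<^esub> (?e S' \<Zsemi>\<^bsub>?A\<^esub> Fa ?R (?e' (Fo ?L S')))
      = (f \<Zsemi>\<^bsub>?A\<^esub> ?e S') \<Zsemi>\<^bsub>?A\<^esub> Fa ?R (?e' (Fo ?L S'))"
      using f fs cats us by (simp add: cat_assoc)
    also have "\<dots> = ?e S \<Zsemi>\<^bsub>?A\<^esub> Fa ?R (Fa ?L f \<Zsemi>\<^bsub>?B\<^esub> ?e' (Fo ?L S'))"
      using f fs cats us by (simp add: adjn_unit_nat[OF U f(1-3)] cat_assoc comps)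
    also have "\<dots> = ?e S \<Zsemi>\<^bsub>?A\<^esub> Fa ?R (?e' (Fo ?L S) \<Zsemi>\<^bsub>?B\<^esub> Fa ?R' (Fa ?L' (Fa ?L f)))"
      using f fs cats us by (simp add: adjn_unit_nat[OF V, of "Fa ?L f" "Fo ?L S" "Fo ?L S'"])
    finally show ?thesis using f fs cats us by (simp add: cat_assoc comps)
  qed
  show "Fa (Aleft ?W) (Fa (Aright ?W) g) \<Zsemi>\<^bsub>Atgt ?W\<^esub> Ncomp (Acounit ?W) (Cod (Atgt ?W) g)
       = Ncomp (Acounit ?W) (Dom (Atgt ?W) g) \<Zsemi>\<^bsub>Atgt ?W\<^esub> g"
    if "g \<in> Arr (Atgt ?W)" for g
  proof -
    define S S' where "S = Dom ?C g" and "S' = Cod ?C g"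
    have f: "g \<in> Arr ?C" "Dom ?C g = S" "Cod ?C g = S'" "S \<in> Obj ?C" "S' \<in> Obj ?C"
      using that cats by (auto simp: S_def S'_def)
    have "Fa ?L' (Fa ?L (Fa ?R (Fa ?R' g))) \<Zsemi>\<^bsub>?C\<^esub> (Fa ?L' (?c (Fo ?R' S')) \<Zsemi>\<^bsub>?C\<^esub> ?c' S')
      = Fa ?L' (Fa ?L (Fa ?R (Fa ?R' g)) \<Zsemi>\<^bsub>?B\<^esub> ?c (Fo ?R' S')) \<Zsemi>\<^bsub>?C\<^esub> ?c' S'"
      using f fs cats us by (simp add: cat_assoc comps)
    also have "\<dots> = Fa ?L' (?c (Fo ?R' S)) \<Zsemi>\<^bsub>?C\<^esub> (Fa ?L' (Fa ?R' g) \<Zsemi>\<^bsub>?C\<^esub> ?c' S')"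
      using f fs cats us by (simp add: adjn_counit_nat[OF U, unfolded UV, of "Fa ?R' g" "Fo ?R' S" "Fo ?R' S'"] cat_assoc comps)
    also have "\<dots> = Fa ?L' (?c (Fo ?R' S)) \<Zsemi>\<^bsub>?C\<^esub> (?c' S \<Zsemi>\<^bsub>?C\<^esub> g)"
      using f fs cats us by (simp add: adjn_counit_nat[OF V f(1-3)])
    finally show ?thesis using f fs cats us by (simp add: cat_assoc)
  qed
  show "Fa (Aleft ?W) (Ncomp (Aunit ?W) S) \<Zsemi>\<^bsub>Atgt ?W\<^esub> Ncomp (Acounit ?W) (Fo (Aleft ?W) S)
        = Ident (Atgt ?W) (Fo (Aleft ?W) S)"
    if "S \<in> Obj (Asrc ?W)" for S
  proof -
    have S: "S \<in> Obj ?A" "Fo ?L S \<in> Obj ?B" using that fs by auto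
    let ?X = "Fo ?L' (Fo ?L S)"
    have "Fa ?L' (Fa ?L (?e S \<Zsemi>\<^bsub>?A\<^esub> Fa ?R (?e' (Fo ?L S)))) \<Zsemi>\<^bsub>?C\<^esub> (Fa ?L' (?c (Fo ?R' ?X)) \<Zsemi>\<^bsub>?C\<^esub> ?c' ?X)
      = Fa ?L' (Fa ?L (?e S) \<Zsemi>\<^bsub>?B\<^esub> (Fa ?L (Fa ?R (?e' (Fo ?L S))) \<Zsemi>\<^bsub>?B\<^esub> ?c (Fo ?R' ?X))) \<Zsemi>\<^bsub>?C\<^esub> ?c' ?X"
      using S fs cats us by (simp add: cat_assoc comps)
    also have "\<dots> = Fa ?L' ((Fa ?L (?e S) \<Zsemi>\<^bsub>?B\<^esub> ?c (Fo ?L S)) \<Zsemi>\<^bsub>?B\<^esub> ?e' (Fo ?L S)) \<Zsemi>\<^bsub>?C\<^esub> ?c' ?X"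
      using S fs cats us by (simp add: adjn_counit_nat[OF U, unfolded UV, of "?e' (Fo ?L S)" "Fo ?L S"] cat_assoc)
    also have "\<dots> = Ident ?C ?X"
      using S fs cats us adjn_tri1[OF U, unfolded UV] adjn_tri1[OF V] by (simp add: cat_id_left)
    finally show ?thesis using S fs cats us by simp
  qed
  show "Ncomp (Aunit ?W) (Fo (Aright ?W) T) \<Zsemi>\<^bsub>Asrc ?W\<^esub> Fa (Aright ?W) (Ncomp (Acounit ?W) T)
        = Ident (Asrc ?W) (Fo (Aright ?W) T)"
    if "T \<in> Obj (Atgt ?W)" for T
  proof -
    have T: "T \<in> Obj ?C" "Fo ?R' T \<in> Obj ?B" using that fs by auto
    let ?X = "Fo ?R (Fo ?R' T)"
    have "(?e ?X \<Zsemi>\<^bsub>?A\<^esub> Fa ?R (?e' (Fo ?L ?X))) \<Zsemi>\<^bsub>?A\<^esub> Fa ?R (Fa ?R' (Fa ?L' (?c (Fo ?R' T)) \<Zsemi>\<^bsub>?C\<^esub> ?c' T))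
      = ?e ?X \<Zsemi>\<^bsub>?A\<^esub> Fa ?R ((?e' (Fo ?L ?X) \<Zsemi>\<^bsub>?B\<^esub> Fa ?R' (Fa ?L' (?c (Fo ?R' T)))) \<Zsemi>\<^bsub>?B\<^esub> Fa ?R' (?c' T))"
      using T fs cats us by (simp add: cat_assoc comps)
    also have "\<dots> = ?e ?X \<Zsemi>\<^bsub>?A\<^esub> Fa ?R (?c (Fo ?R' T) \<Zsemi>\<^bsub>?B\<^esub> (?e' (Fo ?R' T) \<Zsemi>\<^bsub>?B\<^esub> Fa ?R' (?c' T)))"
      using T fs cats us by (simp add: adjn_unit_nat[OF V, of "?c (Fo ?R' T)" "Fo ?L ?X" "Fo ?R' T", symmetric] cat_assoc)
    also have "\<dots> = Ident ?A ?X"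
      using T fs cats us adjn_tri2[OF U, unfolded UV] adjn_tri2[OF V] by (simp add: cat_id_right)
    finally show ?thesis using T fs cats us by simp
  qed
qed

lemma Adj_category: "is_category Adj"
proof (rule is_categoryI, goal_cases)
  case (9 U)
  then have U: "is_adjunction U" by simp
  show ?case
    by (rule adjn_eqI) (use U adjn_left[OF U] adjn_right[OF U] in
      \<open>simp_all add: Adj_comp Adj_id adjn_src_cat adjn_tgt_cat fcomp_id_left fcomp_id_right cat_id_left\<close>)
next
  case (10 U)
  then have U: "is_adjunction U" by simp
  show ?case
    by (rule adjn_eqI) (use U adjn_left[OF U] adjn_right[OF U] in
      \<open>simp_all add: Adj_comp Adj_id adjn_src_cat adjn_tgt_cat fcomp_id_left fcomp_id_right cat_id_right\<close>)
next
  case (11 U V W)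
  then have U: "is_adjunction U" and V: "is_adjunction V" and W: "is_adjunction W"
    and UV: "Atgt U = Asrc V" and VW: "Atgt V = Asrc W" by simp_all
  note fs = adjn_left[OF U, unfolded UV] adjn_right[OF U, unfolded UV] adjn_left[OF V, unfolded VW]
    adjn_right[OF V, unfolded VW] adjn_left[OF W] adjn_right[OF W]
  note cats = adjn_src_cat[OF U] adjn_src_cat[OF V] adjn_src_cat[OF W] adjn_tgt_cat[OF W]
  note us = adjn_unit_arr[OF U] adjn_unit_dom[OF U] adjn_unit_cod[OF U]
    adjn_counit_arr[OF U, unfolded UV] adjn_counit_dom[OF U, unfolded UV] adjn_counit_cod[OF U, unfolded UV]
    adjn_unit_arr[OF V] adjn_unit_dom[OF V] adjn_unit_cod[OF V]
    adjn_counit_arr[OF V, unfolded VW] adjn_counit_dom[OF V, unfolded VW] adjn_counit_cod[OF V, unfolded VW]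
    adjn_unit_arr[OF W] adjn_unit_dom[OF W] adjn_unit_cod[OF W]
    adjn_counit_arr[OF W] adjn_counit_dom[OF W] adjn_counit_cod[OF W]
  show ?case
  proof (rule adjn_eqI)
    show "Aleft (U \<Zsemi>\<^bsub>Adj\<^esub> V \<Zsemi>\<^bsub>Adj\<^esub> W) = Aleft (U \<Zsemi>\<^bsub>Adj\<^esub> (V \<Zsemi>\<^bsub>Adj\<^esub> W))"
      using fcomp_assoc[OF fs(1,3,5)] by simp
    show "Aright (U \<Zsemi>\<^bsub>Adj\<^esub> V \<Zsemi>\<^bsub>Adj\<^esub> W) = Aright (U \<Zsemi>\<^bsub>Adj\<^esub> (V \<Zsemi>\<^bsub>Adj\<^esub> W))"
      using fcomp_assoc[OF fs(6,4,2)] VW by simp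
    show "Ncomp (Aunit (U \<Zsemi>\<^bsub>Adj\<^esub> V \<Zsemi>\<^bsub>Adj\<^esub> W)) S = Ncomp (Aunit (U \<Zsemi>\<^bsub>Adj\<^esub> (V \<Zsemi>\<^bsub>Adj\<^esub> W))) S"
      if "S \<in> Obj (Asrc (U \<Zsemi>\<^bsub>Adj\<^esub> V \<Zsemi>\<^bsub>Adj\<^esub> W))" for S
      using that fs cats us by (simp add: UV VW cat_assoc functor_comp[OF fs(2)])
    show "Ncomp (Acounit (U \<Zsemi>\<^bsub>Adj\<^esub> V \<Zsemi>\<^bsub>Adj\<^esub> W)) S = Ncomp (Acounit (U \<Zsemi>\<^bsub>Adj\<^esub> (V \<Zsemi>\<^bsub>Adj\<^esub> W))) S"
      if "S \<in> Obj (Atgt (U \<Zsemi>\<^bsub>Adj\<^esub> V \<Zsemi>\<^bsub>Adj\<^esub> W))" for S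
      using that fs cats us by (simp add: UV VW cat_assoc functor_comp[OF fs(5)])
  qed (use U V W UV VW in \<open>simp_all add: Adj_comp\<close>)
qed (auto simp: Adj_id Adj_comp adjn_src_cat adjn_tgt_cat)

section \<open>The category of elements is a bifibration\<close>

lemma is_bifibrationI:
  assumes "is_functor (Tot Q) C (Proj Q)"
    and "\<And>f S. f \<in> Arr C \<Longrightarrow> S \<in> Obj (Tot Q) \<Longrightarrow> Fo (Proj Q) S = Dom C f \<Longrightarrow>
      Push Q f S \<in> Arr (Tot Q) \<and> Dom (Tot Q) (Push Q f S) = S \<and> Fa (Proj Q) (Push Q f S) = f"
    and "\<And>f S g \<alpha>. f \<in> Arr C \<Longrightarrow> S \<in> Obj (Tot Q) \<Longrightarrow> Fo (Proj Q) S = Dom C f \<Longrightarrow>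
      g \<in> Arr C \<Longrightarrow> Dom C g = Cod C f \<Longrightarrow> \<alpha> \<in> Arr (Tot Q) \<Longrightarrow> Dom (Tot Q) \<alpha> = S \<Longrightarrow> Fa (Proj Q) \<alpha> = f \<Zsemi>\<^bsub>C\<^esub> g \<Longrightarrow>
      \<exists>!\<beta>. \<beta> \<in> Arr (Tot Q) \<and> Dom (Tot Q) \<beta> = Cod (Tot Q) (Push Q f S) \<and>
                 Cod (Tot Q) \<beta> = Cod (Tot Q) \<alpha> \<and> Fa (Proj Q) \<beta> = g \<and> \<alpha> = Push Q f S \<Zsemi>\<^bsub>Tot Q\<^esub> \<beta>"
    and "\<And>g T. g \<in> Arr C \<Longrightarrow> T \<in> Obj (Tot Q) \<Longrightarrow> Fo (Proj Q) T = Cod C g \<Longrightarrow>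
      Pull Q g T \<in> Arr (Tot Q) \<and> Cod (Tot Q) (Pull Q g T) = T \<and> Fa (Proj Q) (Pull Q g T) = g"
    and "\<And>g T f \<alpha>. g \<in> Arr C \<Longrightarrow> T \<in> Obj (Tot Q) \<Longrightarrow> Fo (Proj Q) T = Cod C g \<Longrightarrow>
      f \<in> Arr C \<Longrightarrow> Cod C f = Dom C g \<Longrightarrow> \<alpha> \<in> Arr (Tot Q) \<Longrightarrow> Cod (Tot Q) \<alpha> = T \<Longrightarrow> Fa (Proj Q) \<alpha> = f \<Zsemi>\<^bsub>C\<^esub> g \<Longrightarrow>
      \<exists>!\<beta>. \<beta> \<in> Arr (Tot Q) \<and> Cod (Tot Q) \<beta> = Dom (Tot Q) (Pull Q g T) \<and>
                 Dom (Tot Q) \<beta> = Dom (Tot Q) \<alpha> \<and> Fa (Proj Q) \<beta> = f \<and> \<alpha> = \<beta> \<Zsemi>\<^bsub>Tot Q\<^esub> Pull Q g T"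
  shows "is_bifibration C Q"
  unfolding is_bifibration_def
  by (intro conjI ballI impI) (use assms(1,2,4) in \<open>simp_all\<close>, (rule assms(3,5); assumption)+)

lemma elements_Obj [simp]: "(A, S) \<in> Obj (Tot (elements C F)) \<longleftrightarrow> A \<in> Obj C \<and> S \<in> Obj (Fo F A)"
  by (simp add: elements_def Let_def)

lemma elements_Arr [simp]: "((A, S), (B, T), f, a) \<in> Arr (Tot (elements C F)) \<longleftrightarrow>
    f \<in> Arr C \<and> A = Dom C f \<and> B = Cod C f \<and> S \<in> Obj (Fo F A) \<and> T \<in> Obj (Fo F B) \<and>
    a \<in> hom (Fo F B) (Fo (Aleft (Fa F f)) S) T"
  by (auto simp add: elements_def Let_def hom_def)

lemma elements_simps [simp]:
  "Dom (Tot (elements C F)) = fst" "Cod (Tot (elements C F)) = (\<lambda>x. fst (snd x))"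
  "Ident (Tot (elements C F)) (A, S) = ((A, S), (A, S), Ident C A, Ident (Fo F A) S)"
  "(X, Y, f, a) \<Zsemi>\<^bsub>Tot (elements C F)\<^esub> (Y', Z, g, b)
     = (X, Z, f \<Zsemi>\<^bsub>C\<^esub> g, Fa (Aleft (Fa F g)) a \<Zsemi>\<^bsub>Fo F (Cod C g)\<^esub> b)"
  "Push (elements C F) f (A, S) = ((A, S), (Cod C f, Fo (Aleft (Fa F f)) S), f,
      Ident (Fo F (Cod C f)) (Fo (Aleft (Fa F f)) S))"
  "Pull (elements C F) g (B, T) = ((Dom C g, Fo (Aright (Fa F g)) T), (B, T), g, Ncomp (Acounit (Fa F g)) T)"
  by (auto simp add: elements_def Let_def fun_eq_iff split: prod.splits)

lemma elements_Proj_simps [simp]: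
  "X \<in> Obj (Tot (elements C F)) \<Longrightarrow> Fo (Proj (elements C F)) X = fst X"
  "x \<in> Arr (Tot (elements C F)) \<Longrightarrow> Fa (Proj (elements C F)) x = fst (snd (snd x))"
  by (auto simp add: elements_def Let_def)

lemma elements_ObjE:
  assumes "X \<in> Obj (Tot (elements C F))"
  obtains A S where "X = (A, S)" "A \<in> Obj C" "S \<in> Obj (Fo F A)"
  using assms by (cases X) auto

lemma elements_ArrE:
  assumes "x \<in> Arr (Tot (elements C F))"
  obtains S T f a where "x = ((Dom C f, S), (Cod C f, T), f, a)" "f \<in> Arr C" "S \<in> Obj (Fo F (Dom C f))"
    "T \<in> Obj (Fo F (Cod C f))" "a \<in> hom (Fo F (Cod C f)) (Fo (Aleft (Fa F f)) S) T"
proof -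
  obtain A S B T f a where "x = ((A, S), (B, T), f, a)" by (metis prod.exhaust)
  with assms that show thesis by auto
qed

context
  fixes C :: "('co, 'ca) cat" and F :: "('co, 'ca, ('o, 'a) cat, ('o, 'a) adjn) ftor"
  assumes F: "is_functor C Adj F"
begin

lemma Adj_functor_adjn: "f \<in> Arr C \<Longrightarrow> is_adjunction (Fa F f)"
  and Adj_functor_src: "f \<in> Arr C \<Longrightarrow> Asrc (Fa F f) = Fo F (Dom C f)"
  and Adj_functor_tgt: "f \<in> Arr C \<Longrightarrow> Atgt (Fa F f) = Fo F (Cod C f)"
  and Adj_functor_cat: "A \<in> Obj C \<Longrightarrow> is_category (Fo F A)"
  using functor_Fa[OF F] functor_dom[OF F] functor_cod[OF F] functor_Fo[OF F] by auto

lemma Adj_functor_left: "f \<in> Arr C \<Longrightarrow> is_functor (Fo F (Dom C f)) (Fo F (Cod C f)) (Aleft (Fa F f))"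
  and Adj_functor_right: "f \<in> Arr C \<Longrightarrow> is_functor (Fo F (Cod C f)) (Fo F (Dom C f)) (Aright (Fa F f))"
  using adjn_left[OF Adj_functor_adjn] adjn_right[OF Adj_functor_adjn]
  by (simp_all add: Adj_functor_src Adj_functor_tgt)

lemma Adj_functor_left_id [simp]: "A \<in> Obj C \<Longrightarrow> Aleft (Fa F (Ident C A)) = id_functor (Fo F A)"
  by (simp add: functor_id[OF F])

lemma Adj_functor_left_comp: "f \<in> Arr C \<Longrightarrow> g \<in> Arr C \<Longrightarrow> Cod C f = Dom C g \<Longrightarrow>
    Aleft (Fa F (f \<Zsemi>\<^bsub>C\<^esub> g)) = fcomp (Fo F (Dom C f)) (Aleft (Fa F f)) (Aleft (Fa F g))"
  by (simp add: functor_comp[OF F] Adj_functor_src)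

lemma elements_category: "is_category (Tot (elements C F))"
proof (rule is_categoryI)
  let ?E = "Tot (elements C F)"
  note C = functor_src[OF F]
  fix x assume x: "x \<in> Arr ?E"
  show "Dom ?E x \<in> Obj ?E" "Cod ?E x \<in> Obj ?E"
    using x C by (auto elim!: elements_ArrE)
  show "Ident ?E (Dom ?E x) \<Zsemi>\<^bsub>?E\<^esub> x = x"
    using x C Adj_functor_left Adj_functor_cat
    by (elim elements_ArrE) (auto simp: cat_id_left hom_def functor_id[OF Adj_functor_left])
  show "x \<Zsemi>\<^bsub>?E\<^esub> Ident ?E (Cod ?E x) = x"
    using x C Adj_functor_left Adj_functor_cat
    by (elim elements_ArrE) (auto simp: cat_id_right hom_def)
  fix y assume y: "y \<in> Arr ?E" and xy: "Cod ?E x = Dom ?E y"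
  obtain S T f a where x': "x = ((Dom C f, S), (Cod C f, T), f, a)" "f \<in> Arr C" "S \<in> Obj (Fo F (Dom C f))"
    "T \<in> Obj (Fo F (Cod C f))" "a \<in> hom (Fo F (Cod C f)) (Fo (Aleft (Fa F f)) S) T"
    using x by (rule elements_ArrE)
  obtain T' U g b where y': "y = ((Dom C g, T'), (Cod C g, U), g, b)" "g \<in> Arr C" "T' \<in> Obj (Fo F (Dom C g))"
    "U \<in> Obj (Fo F (Cod C g))" "b \<in> hom (Fo F (Cod C g)) (Fo (Aleft (Fa F g)) T') U"
    using y by (rule elements_ArrE)
  have fg: "Cod C f = Dom C g" "T' = T" using xy x' y' by auto
  note L = Adj_functor_left[OF x'(2), unfolded fg] Adj_functor_left[OF y'(2)]
  note cats = Adj_functor_cat[OF cat_cod[OF C y'(2)]] Adj_functor_cat[OF cat_dom[OF C y'(2)]]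
  show "x \<Zsemi>\<^bsub>?E\<^esub> y \<in> Arr ?E"
    using x' y' fg C L cats by (simp add: hom_def Adj_functor_left_comp)
  show "Dom ?E (x \<Zsemi>\<^bsub>?E\<^esub> y) = Dom ?E x"
    "Cod ?E (x \<Zsemi>\<^bsub>?E\<^esub> y) = Cod ?E y"
    using x' y' by auto
  fix z assume z: "z \<in> Arr ?E" and yz: "Cod ?E y = Dom ?E z"
  obtain U' V h c where z': "z = ((Dom C h, U'), (Cod C h, V), h, c)" "h \<in> Arr C" "U' \<in> Obj (Fo F (Dom C h))"
    "V \<in> Obj (Fo F (Cod C h))" "c \<in> hom (Fo F (Cod C h)) (Fo (Aleft (Fa F h)) U') V"
    using z by (rule elements_ArrE)
  have gh: "Cod C g = Dom C h" "U' = U" using yz y' z' by auto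
  note L' = Adj_functor_left[OF z'(2)]
  note cats' = Adj_functor_cat[OF cat_cod[OF C z'(2)]]
  show "(x \<Zsemi>\<^bsub>?E\<^esub> y) \<Zsemi>\<^bsub>?E\<^esub> z = x \<Zsemi>\<^bsub>?E\<^esub> (y \<Zsemi>\<^bsub>?E\<^esub> z)"
    using x' y' z' fg gh C L L' cats cats'
    by (simp add: hom_def Adj_functor_left_comp cat_assoc functor_comp[OF L'])
next
  let ?E = "Tot (elements C F)"
  fix X assume X: "X \<in> Obj ?E"
  show "Ident ?E X \<in> Arr ?E"
    "Dom ?E (Ident ?E X) = X"
    "Cod ?E (Ident ?E X) = X"
    using X functor_src[OF F] Adj_functor_cat by (auto elim!: elements_ObjE simp: hom_def)
qed

lemma elements_bifibration: "is_bifibration C (elements C F)"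
proof (rule is_bifibrationI)
  let ?E = "Tot (elements C F)"
  note C = functor_src[OF F]
  show "is_functor ?E C (Proj (elements C F))"
  proof (rule is_functorI)
    show "Fo (Proj (elements C F)) \<in> extensional (Obj ?E)" "Fa (Proj (elements C F)) \<in> extensional (Arr ?E)"
      by (simp_all add: elements_def Let_def)
    show "Fa (Proj (elements C F)) (Ident ?E X) = Ident C (Fo (Proj (elements C F)) X)" if "X \<in> Obj ?E" for X
      using that cat_id[OF elements_category that] by (auto elim!: elements_ObjE)
    show "Fa (Proj (elements C F)) (x \<Zsemi>\<^bsub>?E\<^esub> y) = Fa (Proj (elements C F)) x \<Zsemi>\<^bsub>C\<^esub> Fa (Proj (elements C F)) y"
      if "x \<in> Arr ?E" "y \<in> Arr ?E" "Cod ?E x = Dom ?E y" for x y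
      using that cat_comp[OF elements_category that] by (cases x; cases y) auto
    show "Dom C (Fa (Proj (elements C F)) x) = Fo (Proj (elements C F)) (Dom ?E x)" if "x \<in> Arr ?E" for x
      using that C by (elim elements_ArrE) simp
    show "Cod C (Fa (Proj (elements C F)) x) = Fo (Proj (elements C F)) (Cod ?E x)" if "x \<in> Arr ?E" for x
      using that C by (elim elements_ArrE) simp
  qed (auto simp: C elements_category elim: elements_ObjE elements_ArrE)
next
  let ?E = "Tot (elements C F)"
  note C = functor_src[OF F]
  fix f X assume f: "f \<in> Arr C" and X: "X \<in> Obj ?E" "Fo (Proj (elements C F)) X = Dom C f"
  then obtain S where X': "X = (Dom C f, S)" "S \<in> Obj (Fo F (Dom C f))" by (cases X) auto
  note L = Adj_functor_left[OF f] and catB = Adj_functor_cat[OF cat_cod[OF C f]]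
  have P: "Push (elements C F) f X \<in> Arr ?E"
    using X' f C L catB by (simp add: hom_def)
  then show "Push (elements C F) f X \<in> Arr ?E \<and> Dom ?E (Push (elements C F) f X) = X \<and>
      Fa (Proj (elements C F)) (Push (elements C F) f X) = f"
    using X' by simp
  fix g x assume g: "g \<in> Arr C" "Dom C g = Cod C f" and x: "x \<in> Arr ?E" "Dom ?E x = X"
    "Fa (Proj (elements C F)) x = f \<Zsemi>\<^bsub>C\<^esub> g"
  obtain T a where x': "x = ((Dom C f, S), (Cod C g, T), f \<Zsemi>\<^bsub>C\<^esub> g, a)" "T \<in> Obj (Fo F (Cod C g))"
    "a \<in> hom (Fo F (Cod C g)) (Fo (Aleft (Fa F g)) (Fo (Aleft (Fa F f)) S)) T"
    using x f g C X' L by (elim elements_ArrE) (simp add: Adj_functor_left_comp)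
  let ?T = "Fo (Aleft (Fa F f)) S"
  have idL: "Fa (Aleft (Fa F g)) (Ident (Fo F (Cod C f)) ?T) \<Zsemi>\<^bsub>Fo F (Cod C g)\<^esub> b = b"
    if "b \<in> hom (Fo F (Cod C g)) (Fo (Aleft (Fa F g)) ?T) T" for b
    using that Adj_functor_left[OF g(1)] L X' g Adj_functor_cat[of "Cod C g"] C
    by (simp add: cat_id_left hom_def)
  show "\<exists>!\<beta>. \<beta> \<in> Arr ?E \<and> Dom ?E \<beta> = Cod ?E (Push (elements C F) f X) \<and>
      Cod ?E \<beta> = Cod ?E x \<and> Fa (Proj (elements C F)) \<beta> = g \<and> x = Push (elements C F) f X \<Zsemi>\<^bsub>?E\<^esub> \<beta>"
  proof (rule ex1I)
    show "((Cod C f, ?T), (Cod C g, T), g, a) \<in> Arr ?E \<and>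
      Dom ?E ((Cod C f, ?T), (Cod C g, T), g, a) = Cod ?E (Push (elements C F) f X) \<and>
      Cod ?E ((Cod C f, ?T), (Cod C g, T), g, a) = Cod ?E x \<and>
      Fa (Proj (elements C F)) ((Cod C f, ?T), (Cod C g, T), g, a) = g \<and>
      x = Push (elements C F) f X \<Zsemi>\<^bsub>?E\<^esub> ((Cod C f, ?T), (Cod C g, T), g, a)"
      using x' X' g f C L idL by simp
    fix y assume y: "y \<in> Arr ?E \<and> Dom ?E y = Cod ?E (Push (elements C F) f X) \<and>
      Cod ?E y = Cod ?E x \<and> Fa (Proj (elements C F)) y = g \<and> x = Push (elements C F) f X \<Zsemi>\<^bsub>?E\<^esub> y"
    then have "y \<in> Arr ?E" by blast
    then obtain b where b: "y = ((Cod C f, ?T), (Cod C g, T), g, b)" "b \<in> hom (Fo F (Cod C g)) (Fo (Aleft (Fa F g)) ?T) T"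
      by (rule elements_ArrE) (use conjunct1[OF conjunct2[OF y]] conjunct1[OF conjunct2[OF conjunct2[OF y]]]
        conjunct1[OF conjunct2[OF conjunct2[OF conjunct2[OF y]]]] y[THEN conjunct1] X' x' g in simp)
    have "x = Push (elements C F) f X \<Zsemi>\<^bsub>?E\<^esub> y" using y by blast
    then have "a = b" using b X' x' idL by simp
    then show "y = ((Cod C f, ?T), (Cod C g, T), g, a)" using b by simp
  qed
next
  let ?E = "Tot (elements C F)"
  note C = functor_src[OF F]
  fix g Y assume g: "g \<in> Arr C" and Y: "Y \<in> Obj ?E" "Fo (Proj (elements C F)) Y = Cod C g"
  then obtain T where Y': "Y = (Cod C g, T)" "T \<in> Obj (Fo F (Cod C g))" by (cases Y) auto
  note R = Adj_functor_right[OF g] and adj = Adj_functor_adjn[OF g]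
    and src = Adj_functor_src[OF g] and tgt = Adj_functor_tgt[OF g]
  have P: "Pull (elements C F) g Y \<in> Arr ?E"
    using Y' g C R adjn_counit_arr[OF adj] adjn_counit_dom[OF adj] adjn_counit_cod[OF adj]
    by (simp add: hom_def tgt)
  then show "Pull (elements C F) g Y \<in> Arr ?E \<and> Cod ?E (Pull (elements C F) g Y) = Y \<and>
      Fa (Proj (elements C F)) (Pull (elements C F) g Y) = g"
    using Y' by simp
  fix f x assume f: "f \<in> Arr C" "Cod C f = Dom C g" and x: "x \<in> Arr ?E" "Cod ?E x = Y"
    "Fa (Proj (elements C F)) x = f \<Zsemi>\<^bsub>C\<^esub> g"
  note L = Adj_functor_left[OF f(1), unfolded f(2)]
  obtain S a where x': "x = ((Dom C f, S), (Cod C g, T), f \<Zsemi>\<^bsub>C\<^esub> g, a)" "S \<in> Obj (Fo F (Dom C f))"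
    "a \<in> hom (Fo F (Cod C g)) (Fo (Aleft (Fa F g)) (Fo (Aleft (Fa F f)) S)) T"
    using x f g C Y' L by (elim elements_ArrE) (simp add: Adj_functor_left_comp)
  let ?S = "Fo (Aleft (Fa F f)) S" and ?T = "Fo (Aright (Fa F g)) T"
  have S: "?S \<in> Obj (Asrc (Fa F g))" and T: "T \<in> Obj (Atgt (Fa F g))"
    using x' L Y' by (simp_all add: src tgt)
  note tr = adjn_transpose_in[OF adj S T, unfolded src tgt, OF x'(3)]
    adjn_transpose_inv'[OF adj S T, unfolded src tgt, OF x'(3)]
  let ?b = "Ncomp (Aunit (Fa F g)) ?S \<Zsemi>\<^bsub>Fo F (Dom C g)\<^esub> Fa (Aright (Fa F g)) a"
  show "\<exists>!\<beta>. \<beta> \<in> Arr ?E \<and> Cod ?E \<beta> = Dom ?E (Pull (elements C F) g Y) \<and>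
      Dom ?E \<beta> = Dom ?E x \<and> Fa (Proj (elements C F)) \<beta> = f \<and> x = \<beta> \<Zsemi>\<^bsub>?E\<^esub> Pull (elements C F) g Y"
  proof (rule ex1I)
    show "((Dom C f, S), (Dom C g, ?T), f, ?b) \<in> Arr ?E \<and>
      Cod ?E ((Dom C f, S), (Dom C g, ?T), f, ?b) = Dom ?E (Pull (elements C F) g Y) \<and>
      Dom ?E ((Dom C f, S), (Dom C g, ?T), f, ?b) = Dom ?E x \<and>
      Fa (Proj (elements C F)) ((Dom C f, S), (Dom C g, ?T), f, ?b) = f \<and>
      x = ((Dom C f, S), (Dom C g, ?T), f, ?b) \<Zsemi>\<^bsub>?E\<^esub> Pull (elements C F) g Y"
      using x' Y' g f C R tr by simp
    fix y assume y: "y \<in> Arr ?E \<and> Cod ?E y = Dom ?E (Pull (elements C F) g Y) \<and>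
      Dom ?E y = Dom ?E x \<and> Fa (Proj (elements C F)) y = f \<and> x = y \<Zsemi>\<^bsub>?E\<^esub> Pull (elements C F) g Y"
    then have "y \<in> Arr ?E" by blast
    then obtain b where b: "y = ((Dom C f, S), (Dom C g, ?T), f, b)" "b \<in> hom (Fo F (Dom C g)) ?S ?T"
      by (rule elements_ArrE) (use conjunct1[OF conjunct2[OF y]] conjunct1[OF conjunct2[OF conjunct2[OF y]]]
        conjunct1[OF conjunct2[OF conjunct2[OF conjunct2[OF y]]]] y[THEN conjunct1] Y' x' f in simp)
    have "x = y \<Zsemi>\<^bsub>?E\<^esub> Pull (elements C F) g Y" using y by blast
    then have "a = Fa (Aleft (Fa F g)) b \<Zsemi>\<^bsub>Fo F (Cod C g)\<^esub> Ncomp (Acounit (Fa F g)) T"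
      using b Y' x' by simp
    then show "y = ((Dom C f, S), (Dom C g, ?T), f, ?b)"
      using b adjn_transpose_inv[OF adj S T, unfolded src tgt, OF b(2)] by simp
  qed
qed

end

section \<open>Plane trees\<close>

lemma omega_simps [simp]:
  "Obj omega = UNIV" "((i, j) \<in> Arr omega) = (i \<le> j)" "Dom omega = fst" "Cod omega = snd"
  "Ident omega i = (i, i)" "f \<Zsemi>\<^bsub>omega\<^esub> g = (fst f, snd g)"
  by (simp_all add: omega_def)

lemma omega_category: "is_category omega"
  by (rule is_categoryI) auto

lemma Delta_simps [simp]:
  "Obj Delta = UNIV" "Dom Delta = fst" "Cod Delta a = fst (snd a)"
  "Ident Delta n = (n, n, \<lambda>x\<in>{..<n}. x)"
  "a \<Zsemi>\<^bsub>Delta\<^esub> b = (fst a, fst (snd b), compose {..<fst a} (appl b) (appl a))"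
  by (simp_all add: Delta_def)

lemma Delta_Arr: "(m, n, f) \<in> Arr Delta \<longleftrightarrow> f \<in> extensional {..<m} \<and> (\<forall>x<m. f x < n) \<and>
    (\<forall>x y. x \<le> y \<longrightarrow> y < m \<longrightarrow> f x \<le> f y)"
  by (auto simp: Delta_def monotone_on_def PiE_def Pi_def)

lemma Delta_category: "is_category Delta"
proof (rule is_categoryI)
  fix a assume a: "a \<in> Arr Delta"
  obtain m n f where af: "a = (m, n, f)" by (metis prod.exhaust)
  show "Ident Delta (Dom Delta a) \<Zsemi>\<^bsub>Delta\<^esub> a = a"
    using a by (auto simp: af Delta_Arr compose_def extensional_def fun_eq_iff)
  show "a \<Zsemi>\<^bsub>Delta\<^esub> Ident Delta (Cod Delta a) = a"
    using a by (auto simp: af Delta_Arr compose_def extensional_def fun_eq_iff)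
  fix b assume b: "b \<in> Arr Delta" and ab: "Cod Delta a = Dom Delta b"
  obtain l g where bg: "b = (n, l, g)" using ab af by (cases b) auto
  show "a \<Zsemi>\<^bsub>Delta\<^esub> b \<in> Arr Delta"
    using a b by (auto simp: af bg Delta_Arr compose_def)
  fix c assume c: "c \<in> Arr Delta" and bc: "Cod Delta b = Dom Delta c"
  show "(a \<Zsemi>\<^bsub>Delta\<^esub> b) \<Zsemi>\<^bsub>Delta\<^esub> c = a \<Zsemi>\<^bsub>Delta\<^esub> (b \<Zsemi>\<^bsub>Delta\<^esub> c)"
    using a b c by (auto simp: af bg Delta_Arr compose_def fun_eq_iff)
qed (auto simp: Delta_Arr)

lemmas tree_cat = functor_cat_category[OF op_cat_category[OF omega_category] Delta_category]

subsection \<open>Trees and their maps in elementary terms\<close>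

text \<open>The tree with \<open>n i\<close> vertices of height \<open>i\<close> and ancestor maps \<open>a i j\<close>, from height \<open>j\<close> to height \<open>i \<le> j\<close>.
Every tree is of this form.\<close>

definition mk_tree :: "(nat \<Rightarrow> nat) \<Rightarrow> (nat \<Rightarrow> nat \<Rightarrow> nat \<Rightarrow> nat) \<Rightarrow> tree" where
  "mk_tree n a = \<lparr>Fo = n, Fa = (\<lambda>(i, j)\<in>Arr omega. (n j, n i, \<lambda>x\<in>{..<n j}. a i j x))\<rparr>"

lemma mk_tree_Fo [simp]: "Fo (mk_tree n a) = n"
  and mk_tree_anc [simp]: "i \<le> j \<Longrightarrow> x < n j \<Longrightarrow> anc (mk_tree n a) i j x = a i j x"
  by (simp_all add: mk_tree_def anc_def)

lemma mk_tree_functor: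
  assumes "\<And>i j x. i \<le> j \<Longrightarrow> x < n j \<Longrightarrow> a i j x < n i"
    and "\<And>i j x y. i \<le> j \<Longrightarrow> x \<le> y \<Longrightarrow> y < n j \<Longrightarrow> a i j x \<le> a i j y"
    and "\<And>i x. x < n i \<Longrightarrow> a i i x = x"
    and "\<And>i j l x. i \<le> j \<Longrightarrow> j \<le> l \<Longrightarrow> x < n l \<Longrightarrow> a i l x = a i j (a j l x)"
  shows "is_functor (op_cat omega) Delta (mk_tree n a)"
proof (rule is_functorI)
  show "is_category (op_cat omega)" "is_category Delta"
    by (simp_all add: op_cat_category omega_category Delta_category)
  show "Fo (mk_tree n a) \<in> extensional (Obj (op_cat omega))" by simp
  show "Fa (mk_tree n a) \<in> extensional (Arr (op_cat omega))" by (simp add: mk_tree_def)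
  show "Fa (mk_tree n a) f \<in> Arr Delta" if "f \<in> Arr (op_cat omega)" for f
    using that assms(1,2) by (cases f) (auto simp: mk_tree_def Delta_Arr)
  show "Fa (mk_tree n a) (Ident (op_cat omega) i) = Ident Delta (Fo (mk_tree n a) i)" for i
    using assms(3) by (auto simp: mk_tree_def fun_eq_iff)
  show "Fa (mk_tree n a) (f \<Zsemi>\<^bsub>op_cat omega\<^esub> g) = Fa (mk_tree n a) f \<Zsemi>\<^bsub>Delta\<^esub> Fa (mk_tree n a) g"
    if "f \<in> Arr (op_cat omega)" "g \<in> Arr (op_cat omega)" "Cod (op_cat omega) f = Dom (op_cat omega) g" for f g
  proof -
    obtain i j j' l where "f = (j, l)" "g = (i, j')" by (cases f, cases g)
    with that have fg: "f = (j, l)" "g = (i, j)" "i \<le> j" "j \<le> l" by simp_all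
    then show ?thesis using assms(1,4) by (simp add: mk_tree_def compose_def fun_eq_iff)
  qed
qed (auto simp: mk_tree_def)

context
  fixes T :: tree
  assumes T: "is_functor (op_cat omega) Delta T"
begin

lemma tree_Fa: "i \<le> j \<Longrightarrow> Fa T (i, j) = (Fo T j, Fo T i, anc T i j)"
  using functor_dom[OF T, of "(i, j)"] functor_cod[OF T, of "(i, j)"]
  by (cases "Fa T (i, j)") (simp add: anc_def)

lemma tree_anc_ext: "i \<le> j \<Longrightarrow> anc T i j \<in> extensional {..<Fo T j}"
  and tree_anc_less: "i \<le> j \<Longrightarrow> x < Fo T j \<Longrightarrow> anc T i j x < Fo T i"
  and tree_anc_mono: "i \<le> j \<Longrightarrow> x \<le> y \<Longrightarrow> y < Fo T j \<Longrightarrow> anc T i j x \<le> anc T i j y"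
  using functor_Fa[OF T, of "(i, j)"] tree_Fa[of i j] by (auto simp: Delta_Arr)

lemma tree_anc_refl: "x < Fo T i \<Longrightarrow> anc T i i x = x"
  using functor_id[OF T, of i] tree_Fa[of i i] by simp

lemma tree_anc_trans: "i \<le> j \<Longrightarrow> j \<le> l \<Longrightarrow> x < Fo T l \<Longrightarrow> anc T i j (anc T j l x) = anc T i l x"
  using functor_comp[OF T, of "(j, l)" "(i, j)"] tree_Fa[of i j] tree_Fa[of j l] tree_Fa[of i l]
  by (simp add: compose_def)

lemma tree_empty_above: "Fo T i = 0 \<Longrightarrow> i \<le> j \<Longrightarrow> Fo T j = 0"
  using tree_anc_less[of i j 0] by auto

end

lemma tree_eqI:
  assumes S: "is_functor (op_cat omega) Delta S" and T: "is_functor (op_cat omega) Delta T"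
    and n: "\<And>i. Fo S i = Fo T i" and a: "\<And>i j x. i \<le> j \<Longrightarrow> x < Fo S j \<Longrightarrow> anc S i j x = anc T i j x"
  shows "S = T"
proof (rule functor_eqI[OF S T])
  show "Fo S A = Fo T A" for A by (rule n)
  fix f assume "f \<in> Arr (op_cat omega)"
  then obtain i j where f: "f = (i, j)" "i \<le> j" by (cases f) simp
  have "anc S i j = anc T i j"
    using a[OF f(2)] tree_anc_ext[OF S f(2)] tree_anc_ext[OF T f(2)] n
    by (intro extensionalityI[of _ "{..<Fo S j}"]) auto
  then show "Fa S f = Fa T f" using f n by (simp add: tree_Fa[OF S] tree_Fa[OF T])
qed

text \<open>The tree map given by a family of functions on the vertices, one for each height. It is truncated to
the vertices of the source.\<close>

definition mk_map :: "tree \<Rightarrow> tree \<Rightarrow> (nat \<Rightarrow> nat \<Rightarrow> nat) \<Rightarrow> tree_map" where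
  "mk_map S T f = \<lparr>Nsrc = S, Ntgt = T, Ncomp = (\<lambda>i. (Fo S i, Fo T i, \<lambda>x\<in>{..<Fo S i}. f i x))\<rparr>"

text \<open>The image of a vertex \<open>x\<close> of height \<open>i\<close>.\<close>

definition img :: "tree_map \<Rightarrow> nat \<Rightarrow> nat \<Rightarrow> nat" where
  "img t i = appl (Ncomp t i)"

lemma mk_map_simps [simp]:
  "Nsrc (mk_map S T f) = S" "Ntgt (mk_map S T f) = T" "x < Fo S i \<Longrightarrow> img (mk_map S T f) i x = f i x"
  by (simp_all add: mk_map_def img_def)

lemma PTree_Obj: "T \<in> Obj PTree \<longleftrightarrow> is_functor (op_cat omega) Delta T \<and> Fo T 0 = 1 \<and> (\<exists>k. Fo T (Suc k) = 0)"
  by (simp add: PTree_def)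

lemma PTree_Arr: "t \<in> Arr PTree \<longleftrightarrow> is_ntrans (op_cat omega) Delta t \<and> Nsrc t \<in> Obj PTree \<and> Ntgt t \<in> Obj PTree"
  by (auto simp: PTree_def ntrans_src ntrans_tgt)

lemma PTree_simps [simp]: "Dom PTree = Nsrc" "Cod PTree = Ntgt"
  by (simp_all add: PTree_def)

lemma PTree_category: "is_category PTree"
  unfolding PTree_def by (rule full_subcat_category[OF tree_cat])

lemma PTree_functor_tree: "T \<in> Obj PTree \<Longrightarrow> is_functor (op_cat omega) Delta T"
  by (simp add: PTree_Obj)

lemma hom_PTree: "t \<in> hom PTree S T \<longleftrightarrow> is_ntrans (op_cat omega) Delta t \<and> Nsrc t = S \<and> Ntgt t = T \<and>
    S \<in> Obj PTree \<and> T \<in> Obj PTree"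
  by (auto simp: hom_def PTree_Arr)

lemma mk_map_hom:
  assumes S: "S \<in> Obj PTree" and T: "T \<in> Obj PTree"
    and "\<And>i x. x < Fo S i \<Longrightarrow> f i x < Fo T i"
    and "\<And>i x y. x \<le> y \<Longrightarrow> y < Fo S i \<Longrightarrow> f i x \<le> f i y"
    and "\<And>i j x. i \<le> j \<Longrightarrow> x < Fo S j \<Longrightarrow> f i (anc S i j x) = anc T i j (f j x)"
  shows "mk_map S T f \<in> hom PTree S T"
proof -
  have S': "is_functor (op_cat omega) Delta S" and T': "is_functor (op_cat omega) Delta T"
    using S T by (simp_all add: PTree_Obj)
  have "is_ntrans (op_cat omega) Delta (mk_map S T f)"
  proof (rule is_ntransI)
    show "Ncomp (mk_map S T f) \<in> extensional (Obj (op_cat omega))" by simp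
    show "Ncomp (mk_map S T f) A \<in> Arr Delta" for A
      using assms(3,4) by (auto simp: mk_map_def Delta_Arr)
    fix p assume "p \<in> Arr (op_cat omega)"
    then obtain i j where p: "p = (i, j)" "i \<le> j" by (cases p) simp
    show "Fa (Nsrc (mk_map S T f)) p \<Zsemi>\<^bsub>Delta\<^esub> Ncomp (mk_map S T f) (Cod (op_cat omega) p) =
         Ncomp (mk_map S T f) (Dom (op_cat omega) p) \<Zsemi>\<^bsub>Delta\<^esub> Fa (Ntgt (mk_map S T f)) p"
      using p tree_anc_less[OF S'] assms(3,5)
      by (auto simp: mk_map_def tree_Fa[OF S'] tree_Fa[OF T'] compose_def fun_eq_iff)
  qed (use S' T' in \<open>simp_all add: mk_map_def\<close>)
  then show ?thesis using S T by (simp add: hom_PTree)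
qed

context
  fixes t :: tree_map and S T :: tree
  assumes t: "t \<in> hom PTree S T"
begin

lemma tmap_Ncomp: "Ncomp t i = (Fo S i, Fo T i, img t i)"
  using t ntrans_dom[of "op_cat omega" Delta t i] ntrans_cod[of "op_cat omega" Delta t i]
  by (cases "Ncomp t i") (simp add: hom_PTree img_def)

lemma tmap_src: "S \<in> Obj PTree" and tmap_tgt: "T \<in> Obj PTree"
  and tmap_Nsrc: "Nsrc t = S" and tmap_Ntgt: "Ntgt t = T"
  using t by (simp_all add: hom_PTree)

lemma tmap_ext: "img t i \<in> extensional {..<Fo S i}"
  and tmap_less: "x < Fo S i \<Longrightarrow> img t i x < Fo T i"
  and tmap_mono: "x \<le> y \<Longrightarrow> y < Fo S i \<Longrightarrow> img t i x \<le> img t i y"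
  using t ntrans_arr[of "op_cat omega" Delta t i] tmap_Ncomp[of i]
  by (auto simp: hom_PTree Delta_Arr)

lemma tmap_anc: "i \<le> j \<Longrightarrow> x < Fo S j \<Longrightarrow> img t i (anc S i j x) = anc T i j (img t j x)"
  using t ntrans_nat[of "op_cat omega" Delta t "(i, j)"] tmap_Ncomp[of i] tmap_Ncomp[of j]
    tree_Fa[of S i j] tree_Fa[of T i j]
  by (simp add: hom_PTree PTree_Obj compose_def fun_eq_iff) metis

end

lemma tmap_eqI:
  assumes s: "s \<in> hom PTree S T" and t: "t \<in> hom PTree S T"
    and "\<And>i x. x < Fo S i \<Longrightarrow> img s i x = img t i x"
  shows "s = t"
proof (rule ntrans_eqI[of "op_cat omega" Delta])
  fix i
  have "img s i = img t i"
    using assms(3)[of _ i] tmap_ext[OF s, of i] tmap_ext[OF t, of i]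
    by (intro extensionalityI[of _ "{..<Fo S i}"]) auto
  then show "Ncomp s i = Ncomp t i" using tmap_Ncomp[OF s] tmap_Ncomp[OF t] by simp
qed (use s t in \<open>simp_all add: hom_PTree\<close>)

lemma img_comp: "s \<in> Arr PTree \<Longrightarrow> x < Fo (Nsrc s) i \<Longrightarrow> img (s \<Zsemi>\<^bsub>PTree\<^esub> t) i x = img t i (img s i x)"
  using arg_cong[OF tmap_Ncomp[of s "Nsrc s" "Ntgt s" i], of fst]
  by (simp add: PTree_def img_def functor_cat_def compose_def hom_def)

lemma tmap_comp: "s \<in> hom PTree S T \<Longrightarrow> t \<in> hom PTree T U \<Longrightarrow> s \<Zsemi>\<^bsub>PTree\<^esub> t \<in> hom PTree S U"
  using cat_comp[OF PTree_category, of s t] cat_dom_comp[OF PTree_category, of s t]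
    cat_cod_comp[OF PTree_category, of s t] by (simp add: hom_def)

lemma img_comp_hom: "s \<in> hom PTree S T \<Longrightarrow> x < Fo S i \<Longrightarrow> img (s \<Zsemi>\<^bsub>PTree\<^esub> t) i x = img t i (img s i x)"
  by (rule img_comp) (auto simp: hom_def)

lemma img_id: "T \<in> Obj PTree \<Longrightarrow> x < Fo T i \<Longrightarrow> img (Ident PTree T) i x = x"
  by (simp add: PTree_def functor_cat_def img_def)

lemma id_hom_PTree: "T \<in> Obj PTree \<Longrightarrow> Ident PTree T \<in> hom PTree T T"
  using PTree_category by (simp add: hom_def del: PTree_simps)

subsection \<open>Marked trees\<close>

lemma PTree_bot_Obj: "T \<in> Obj (PTree_bot k) \<longleftrightarrow> T \<in> Obj PTree \<and> Fo T k \<noteq> 0 \<and> (\<forall>j\<le>k. anc T j k 0 = 0)"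
  by (simp add: PTree_bot_def Let_def)

lemma PTree_bot_simps [simp]:
  "Dom (PTree_bot k) = Nsrc" "Cod (PTree_bot k) = Ntgt" "Comp (PTree_bot k) = Comp PTree"
  "Ident (PTree_bot k) = Ident PTree"
  by (simp_all add: PTree_bot_def Let_def)

lemma PTree_bot_Arr: "t \<in> Arr (PTree_bot k) \<longleftrightarrow> t \<in> Arr PTree \<and> Nsrc t \<in> Obj (PTree_bot k) \<and>
    Ntgt t \<in> Obj (PTree_bot k) \<and> img t k 0 = 0"
  by (auto simp: PTree_bot_def Let_def img_def)

lemma hom_PTree_bot: "t \<in> hom (PTree_bot k) S T \<longleftrightarrow> t \<in> hom PTree S T \<and> S \<in> Obj (PTree_bot k) \<and>
    T \<in> Obj (PTree_bot k) \<and> img t k 0 = 0"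
  by (auto simp: hom_def PTree_bot_Arr)

lemma PTree_bot_category: "is_category (PTree_bot k)"
proof (rule is_categoryI)
  note P = PTree_category
  show "Ident (PTree_bot k) T \<in> Arr (PTree_bot k)" "Dom (PTree_bot k) (Ident (PTree_bot k) T) = T"
    "Cod (PTree_bot k) (Ident (PTree_bot k) T) = T" if "T \<in> Obj (PTree_bot k)" for T
    using that id_hom_PTree[of T] by (auto simp: PTree_bot_Arr PTree_bot_Obj img_id hom_def)
  fix s assume s: "s \<in> Arr (PTree_bot k)"
  then show "Dom (PTree_bot k) s \<in> Obj (PTree_bot k)" "Cod (PTree_bot k) s \<in> Obj (PTree_bot k)"
    by (auto simp: PTree_bot_Arr)
  show "Ident (PTree_bot k) (Dom (PTree_bot k) s) \<Zsemi>\<^bsub>PTree_bot k\<^esub> s = s"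
    "s \<Zsemi>\<^bsub>PTree_bot k\<^esub> Ident (PTree_bot k) (Cod (PTree_bot k) s) = s"
    using s cat_id_left[OF P, of s] cat_id_right[OF P, of s] by (simp_all add: PTree_bot_Arr)
  fix t assume t: "t \<in> Arr (PTree_bot k)" and st: "Cod (PTree_bot k) s = Dom (PTree_bot k) t"
  show "s \<Zsemi>\<^bsub>PTree_bot k\<^esub> t \<in> Arr (PTree_bot k)"
    "Dom (PTree_bot k) (s \<Zsemi>\<^bsub>PTree_bot k\<^esub> t) = Dom (PTree_bot k) s"
    "Cod (PTree_bot k) (s \<Zsemi>\<^bsub>PTree_bot k\<^esub> t) = Cod (PTree_bot k) t"
    using s t st cat_comp[OF P, of s t] cat_dom_comp[OF P, of s t] cat_cod_comp[OF P, of s t]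
    by (auto simp: PTree_bot_Arr PTree_bot_Obj img_comp)
  show "s \<Zsemi>\<^bsub>PTree_bot k\<^esub> t \<Zsemi>\<^bsub>PTree_bot k\<^esub> u = s \<Zsemi>\<^bsub>PTree_bot k\<^esub> (t \<Zsemi>\<^bsub>PTree_bot k\<^esub> u)"
    if "u \<in> Arr (PTree_bot k)" "Cod (PTree_bot k) t = Dom (PTree_bot k) u" for u
    using s t st that cat_assoc[OF P, of s t u] by (simp add: PTree_bot_Arr)
qed

lemma marked_tree: "T \<in> Obj (PTree_bot k) \<Longrightarrow> is_functor (op_cat omega) Delta T"
  by (simp add: PTree_bot_Obj PTree_Obj)

lemma marked_PTree: "T \<in> Obj (PTree_bot k) \<Longrightarrow> T \<in> Obj PTree"
  by (simp add: PTree_bot_Obj)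

lemma marked_pos: "T \<in> Obj (PTree_bot k) \<Longrightarrow> j \<le> k \<Longrightarrow> 0 < Fo T j"
  using tree_empty_above[of T j k] by (auto simp: PTree_bot_Obj PTree_Obj)

lemma marked_anc: "T \<in> Obj (PTree_bot k) \<Longrightarrow> i \<le> j \<Longrightarrow> j \<le> k \<Longrightarrow> anc T i j 0 = 0"
  using tree_anc_trans[OF marked_tree, of T k i j k 0] by (auto simp: PTree_bot_Obj)

lemma marked_antimono: "T \<in> Obj (PTree_bot k) \<Longrightarrow> j \<le> k \<Longrightarrow> T \<in> Obj (PTree_bot j)"
  using marked_pos[of T k j] marked_anc[of T k _ j] by (auto simp: PTree_bot_Obj)

text \<open>Preserving the mark at height \<open>k\<close> entails preserving its ancestors. Together with \<open>marked_antimono\<close> this makes the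
right adjoint \<open>R\<close> an inclusion of categories.\<close>

lemma mark_preserved_below:
  assumes t: "t \<in> hom PTree S T" "S \<in> Obj (PTree_bot k)" "T \<in> Obj (PTree_bot k)" "img t k 0 = 0" "j \<le> k"
  shows "img t j 0 = 0"
  using tmap_anc[OF t(1,5), of 0] marked_pos[OF t(2)] marked_anc[OF t(2), of j k] marked_anc[OF t(3), of j k] t
  by simp

text \<open>The root is the only vertex of height \<open>0\<close>, so marking it is no condition.\<close>

lemma PTree_bot_0: "PTree_bot 0 = PTree"
proof -
  have O: "{T \<in> Obj PTree. Fo T 0 \<noteq> 0 \<and> (\<forall>j\<le>0. anc T j 0 0 = 0)} = Obj PTree"
    by (auto simp: PTree_Obj tree_anc_refl)
  have "img t 0 0 = 0" if "t \<in> Arr PTree" for t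
    using tmap_less[of t "Nsrc t" "Ntgt t" 0 0] that by (auto simp: hom_def PTree_Arr PTree_Obj)
  then have "{t \<in> Arr PTree. Nsrc t \<in> Obj PTree \<and> Ntgt t \<in> Obj PTree \<and> appl (Ncomp t 0) 0 = 0} = Arr PTree"
    by (auto simp: PTree_Arr img_def)
  then show ?thesis unfolding PTree_bot_def Let_def O by simp
qed

subsection \<open>Adding a leaf is left adjoint to moving the mark\<close>

lemma extend_old [simp]: "extend k i h (old k i x) = h x"
  by (simp add: extend_def old_def)

lemma extend_leaf [simp]: "extend k (Suc k) h 0 = 0"
  by (simp add: extend_def)

lemma old_leaf [simp]: "old k (Suc k) x = Suc x"
  and extend_leaf_Suc [simp]: "extend k (Suc k) h (Suc x) = h x"
  by (simp_all add: extend_def old_def)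

lemma old_less_iff [simp]: "old k i x < old k i y \<longleftrightarrow> x < y"
  and old_le_iff [simp]: "old k i x \<le> old k i y \<longleftrightarrow> x \<le> y"
  and old_inject [simp]: "old k i x = old k i y \<longleftrightarrow> x = y"
  by (auto simp: old_def)

lemma old_below: "i \<noteq> Suc k \<Longrightarrow> old k i x = x"
  by (simp add: old_def)

lemma old_cases:
  assumes "y < old k i m"
  obtains (leaf) "i = Suc k" "y = 0" | (old) x where "x < m" "y = old k i x"
  using assms by (cases y) (auto simp: old_def split: if_splits)

lemma extend_mono:
  assumes "y \<le> z" "z < old k i m" "\<And>x x'. x \<le> x' \<Longrightarrow> x' < m \<Longrightarrow> h x \<le> h x'"
  shows "extend k i h y \<le> extend k i h z"
  using order.strict_trans1[OF assms(1,2)]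
proof (cases rule: old_cases)
  case (old x)
  show ?thesis using assms(2)
  proof (cases rule: old_cases)
    case leaf
    then show ?thesis using assms(1) old by simp
  next
    case (old x')
    then show ?thesis using assms(1,3) \<open>y = old k i x\<close> by simp
  qed
qed simp

lemma add_leaf_mk_tree:
  "add_leaf k T = mk_tree (\<lambda>i. old k i (Fo T i)) (\<lambda>i j. extend k j (\<lambda>x. old k i (anc T i j x)))"
  by (simp add: add_leaf_def mk_tree_def Let_def)

lemma add_leaf_Fo [simp]: "Fo (add_leaf k T) i = old k i (Fo T i)"
  by (simp add: add_leaf_mk_tree)

lemma add_leaf_anc: "i \<le> j \<Longrightarrow> y < old k j (Fo T j) \<Longrightarrow> anc (add_leaf k T) i j y = extend k j (\<lambda>x. old k i (anc T i j x)) y"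
  by (simp add: add_leaf_mk_tree)

lemma add_leaf_functor:
  assumes "T \<in> Obj (PTree_bot k)"
  shows "is_functor (op_cat omega) Delta (add_leaf k T)"
  unfolding add_leaf_mk_tree
proof (rule mk_tree_functor)
  note T = marked_tree[OF assms]
  have pos: "0 < old k i (Fo T i)" if "i \<le> Suc k" for i
    using marked_pos[OF assms, of i] that by (auto simp: old_def)
  show "extend k j (\<lambda>x. old k i (anc T i j x)) y < old k i (Fo T i)" if "i \<le> j" "y < old k j (Fo T j)" for i j y
    using that(2) by (cases rule: old_cases) (use that pos tree_anc_less[OF T] in auto)
  show "extend k j (\<lambda>x. old k i (anc T i j x)) y \<le> extend k j (\<lambda>x. old k i (anc T i j x)) z"
    if "i \<le> j" "y \<le> z" "z < old k j (Fo T j)" for i j y z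
    by (rule extend_mono[OF that(2,3)]) (use that tree_anc_mono[OF T] in simp)
  show "extend k i (\<lambda>x. old k i (anc T i i x)) y = y" if "y < old k i (Fo T i)" for i y
    using that by (cases rule: old_cases) (auto simp: tree_anc_refl[OF T])
  show "extend k l (\<lambda>x. old k i (anc T i l x)) y = extend k j (\<lambda>x. old k i (anc T i j x)) (extend k l (\<lambda>x. old k j (anc T j l x)) y)"
    if "i \<le> j" "j \<le> l" "y < old k l (Fo T l)" for i j l y
    using that(3)
  proof (cases rule: old_cases)
    case leaf
    have "extend k j (\<lambda>x. old k i (anc T i j x)) 0 = 0"
      using that leaf marked_anc[OF assms, of i j] by (auto simp: extend_def old_def)
    then show ?thesis using leaf by simp
  qed (use that tree_anc_trans[OF T] in simp)
qed

lemma add_leaf_marked: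
  assumes "T \<in> Obj (PTree_bot k)"
  shows "add_leaf k T \<in> Obj (PTree_bot (Suc k))"
proof -
  note T = marked_tree[OF assms]
  obtain K where K: "Fo T (Suc K) = 0" using assms by (auto simp: PTree_bot_Obj PTree_Obj)
  have "k < Suc K" using marked_pos[OF assms, of "Suc K"] K by (cases "Suc K \<le> k") auto
  then have "Fo (add_leaf k T) (Suc (Suc K)) = 0"
    using tree_empty_above[OF T K, of "Suc (Suc K)"] by (simp add: old_def)
  moreover have "Fo (add_leaf k T) 0 = 1" using assms by (simp add: old_def PTree_bot_Obj PTree_Obj)
  ultimately show ?thesis
    using add_leaf_functor[OF assms]
    by (auto simp: PTree_bot_Obj PTree_Obj add_leaf_anc simp del: add_leaf_Fo intro: exI[of _ "Suc K"]) (simp_all add: old_def)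
qed

lemma add_leaf_map_mk_map: "add_leaf_map k t = mk_map (add_leaf k (Nsrc t)) (add_leaf k (Ntgt t))
    (\<lambda>i. extend k i (\<lambda>x. old k i (img t i x)))"
  by (simp add: add_leaf_map_def mk_map_def Let_def img_def)

lemma add_leaf_map_hom:
  assumes t: "t \<in> hom (PTree_bot k) S T"
  shows "add_leaf_map k t \<in> hom (PTree_bot (Suc k)) (add_leaf k S) (add_leaf k T)"
proof -
  have S: "S \<in> Obj (PTree_bot k)" and T: "T \<in> Obj (PTree_bot k)" and t': "t \<in> hom PTree S T"
    using t by (simp_all add: hom_PTree_bot)
  have "add_leaf_map k t \<in> hom PTree (add_leaf k S) (add_leaf k T)"
    unfolding add_leaf_map_mk_map tmap_Nsrc[OF t'] tmap_Ntgt[OF t']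
  proof (rule mk_map_hom)
    show "extend k i (\<lambda>x. old k i (img t i x)) y < Fo (add_leaf k T) i" if "y < Fo (add_leaf k S) i" for i y
      using that[simplified] by (cases rule: old_cases) (auto simp: tmap_less[OF t'])
    show "extend k i (\<lambda>x. old k i (img t i x)) y \<le> extend k i (\<lambda>x. old k i (img t i x)) z"
      if "y \<le> z" "z < Fo (add_leaf k S) i" for i y z
      by (rule extend_mono[OF that[simplified]]) (use tmap_mono[OF t'] in simp)
    show "extend k i (\<lambda>x. old k i (img t i x)) (anc (add_leaf k S) i j y) =
        anc (add_leaf k T) i j (extend k j (\<lambda>x. old k j (img t j x)) y)"
      if "i \<le> j" "y < Fo (add_leaf k S) j" for i j y
      using that(2)[simplified]
    proof (cases rule: old_cases)
      case leaf
      have "extend k i (\<lambda>x. old k i (img t i x)) 0 = 0" if "i \<noteq> Suc k"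
        using mark_preserved_below[OF t' S T, of i] t leaf \<open>i \<le> j\<close> that
        by (auto simp: extend_def hom_PTree_bot old_below)
      then show ?thesis using leaf that by (cases "i = Suc k") (auto simp: add_leaf_anc old_def)
    next
      case (old x)
      then show ?thesis using that tmap_less[OF t'] by (simp add: add_leaf_anc tmap_anc[OF t'])
    qed
  qed (use add_leaf_marked[OF S] add_leaf_marked[OF T] in \<open>simp_all add: PTree_bot_Obj\<close>)
  then show ?thesis
    using add_leaf_marked[OF S] add_leaf_marked[OF T] tmap_Nsrc[OF t']
    by (simp add: hom_PTree_bot add_leaf_map_mk_map old_def)
qed

lemma img_add_leaf_map:
  "y < old k i (Fo (Nsrc t) i) \<Longrightarrow> img (add_leaf_map k t) i y = extend k i (\<lambda>x. old k i (img t i x)) y"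
  by (simp add: add_leaf_map_mk_map)

text \<open>The components of the unit and of the counit of \<open>L \<stileturn> R\<close>.\<close>

definition leaf_unit :: "nat \<Rightarrow> tree \<Rightarrow> tree_map" where
  "leaf_unit k S = mk_map S (add_leaf k S) (old k)"

lemma img_leaf_unit: "x < Fo S i \<Longrightarrow> img (leaf_unit k S) i x = old k i x"
  by (simp add: leaf_unit_def)

definition leaf_counit :: "nat \<Rightarrow> tree \<Rightarrow> tree_map" where
  "leaf_counit k T = mk_map (add_leaf k T) T (\<lambda>i. extend k i (\<lambda>x. x))"

lemma img_leaf_counit: "y < old k i (Fo T i) \<Longrightarrow> img (leaf_counit k T) i y = extend k i (\<lambda>x. x) y"
  by (simp add: leaf_counit_def)

lemma leaf_unit_hom:
  assumes S: "S \<in> Obj (PTree_bot k)"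
  shows "leaf_unit k S \<in> hom (PTree_bot k) S (add_leaf k S)"
proof -
  have LS: "add_leaf k S \<in> Obj (PTree_bot k)" by (rule marked_antimono[OF add_leaf_marked[OF S]]) simp
  have "leaf_unit k S \<in> hom PTree S (add_leaf k S)"
    unfolding leaf_unit_def
    by (rule mk_map_hom) (use S LS in \<open>auto simp: PTree_bot_Obj add_leaf_anc\<close>)
  then show ?thesis using S LS marked_pos[OF S, of k] by (simp add: hom_PTree_bot leaf_unit_def old_def)
qed

lemma leaf_counit_hom:
  assumes T: "T \<in> Obj (PTree_bot (Suc k))"
  shows "leaf_counit k T \<in> hom (PTree_bot (Suc k)) (add_leaf k T) T"
proof -
  have T': "T \<in> Obj (PTree_bot k)" by (rule marked_antimono[OF T]) simp
  note LT = add_leaf_marked[OF T']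
  have "leaf_counit k T \<in> hom PTree (add_leaf k T) T"
    unfolding leaf_counit_def
  proof (rule mk_map_hom)
    show "add_leaf k T \<in> Obj PTree" "T \<in> Obj PTree" using T LT by (simp_all add: PTree_bot_Obj)
    show "extend k i (\<lambda>x. x) y < Fo T i" if "y < Fo (add_leaf k T) i" for i y
      using that[simplified] by (cases rule: old_cases) (use marked_pos[OF T] in auto)
    show "extend k i (\<lambda>x. x) y \<le> extend k i (\<lambda>x. x) z" if "y \<le> z" "z < Fo (add_leaf k T) i" for i y z
      by (rule extend_mono[OF that[simplified]])
    show "extend k i (\<lambda>x. x) (anc (add_leaf k T) i j y) = anc T i j (extend k j (\<lambda>x. x) y)"
      if "i \<le> j" "y < Fo (add_leaf k T) j" for i j y
      using that(2)[simplified]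
      by (cases rule: old_cases) (use that marked_anc[OF T, of i "Suc k"] in
        \<open>auto simp: add_leaf_anc old_def extend_def\<close>)
  qed
  then show ?thesis using T LT by (simp add: hom_PTree_bot leaf_counit_def old_def)
qed

lemma Lfun_functor: "is_functor (PTree_bot k) (PTree_bot (Suc k)) (Lfun k)"
proof (rule is_functorI)
  note C = PTree_bot_category
  show "is_category (PTree_bot k)" "is_category (PTree_bot (Suc k))" by (rule C)+
  show "Fo (Lfun k) \<in> extensional (Obj (PTree_bot k))" "Fa (Lfun k) \<in> extensional (Arr (PTree_bot k))"
    by (simp_all add: Lfun_def)
  show "Fo (Lfun k) T \<in> Obj (PTree_bot (Suc k))" if "T \<in> Obj (PTree_bot k)" for T
    using that by (simp add: Lfun_def add_leaf_marked)
  show "Fa (Lfun k) t \<in> Arr (PTree_bot (Suc k))" "Dom (PTree_bot (Suc k)) (Fa (Lfun k) t) = Fo (Lfun k) (Dom (PTree_bot k) t)"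
    "Cod (PTree_bot (Suc k)) (Fa (Lfun k) t) = Fo (Lfun k) (Cod (PTree_bot k) t)"
    if "t \<in> Arr (PTree_bot k)" for t
    using add_leaf_map_hom[of t k "Nsrc t" "Ntgt t"] that by (auto simp: Lfun_def hom_def PTree_bot_Arr)
  show "Fa (Lfun k) (Ident (PTree_bot k) T) = Ident (PTree_bot (Suc k)) (Fo (Lfun k) T)"
    if T: "T \<in> Obj (PTree_bot k)" for T
  proof -
    have i: "Ident PTree T \<in> hom (PTree_bot k) T T"
      using cat_id[OF C T] cat_dom_id[OF C T] cat_cod_id[OF C T] by (simp add: hom_def)
    then have h: "add_leaf_map k (Ident PTree T) \<in> hom PTree (add_leaf k T) (add_leaf k T)"
      using add_leaf_map_hom hom_PTree_bot by blast
    have "add_leaf_map k (Ident PTree T) = Ident PTree (add_leaf k T)"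
    proof (rule tmap_eqI[OF h id_hom_PTree])
      show "add_leaf k T \<in> Obj PTree" by (rule marked_PTree[OF add_leaf_marked[OF T]])
      fix i y assume y: "y < Fo (add_leaf k T) i"
      show "img (add_leaf_map k (Ident PTree T)) i y = img (Ident PTree (add_leaf k T)) i y"
        using y[simplified] y marked_PTree[OF T] marked_PTree[OF add_leaf_marked[OF T]] id_hom_PTree[of T]
        by (cases rule: old_cases) (auto simp: img_id img_add_leaf_map hom_def)
    qed
    then show ?thesis using T i by (simp add: Lfun_def hom_def)
  qed
  show "Fa (Lfun k) (s \<Zsemi>\<^bsub>PTree_bot k\<^esub> t) = Fa (Lfun k) s \<Zsemi>\<^bsub>PTree_bot (Suc k)\<^esub> Fa (Lfun k) t"
    if s: "s \<in> Arr (PTree_bot k)" and t: "t \<in> Arr (PTree_bot k)" and st: "Cod (PTree_bot k) s = Dom (PTree_bot k) t" for s t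
  proof -
    let ?S = "Nsrc s" and ?T = "Nsrc t" and ?U = "Ntgt t"
    have s': "s \<in> hom (PTree_bot k) ?S ?T" and t': "t \<in> hom (PTree_bot k) ?T ?U"
      using s t st by (auto simp: hom_def)
    then have s'': "s \<in> hom PTree ?S ?T" and t'': "t \<in> hom PTree ?T ?U" by (simp_all add: hom_PTree_bot)
    have st': "s \<Zsemi>\<^bsub>PTree\<^esub> t \<in> hom (PTree_bot k) ?S ?U"
      using cat_comp[OF C s t st] cat_dom_comp[OF C s t st] cat_cod_comp[OF C s t st] by (simp add: hom_def)
    have h: "add_leaf_map k (s \<Zsemi>\<^bsub>PTree\<^esub> t) \<in> hom PTree (add_leaf k ?S) (add_leaf k ?U)"
      "add_leaf_map k s \<in> hom PTree (add_leaf k ?S) (add_leaf k ?T)"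
      "add_leaf_map k t \<in> hom PTree (add_leaf k ?T) (add_leaf k ?U)"
      using add_leaf_map_hom[OF st'] add_leaf_map_hom[OF s'] add_leaf_map_hom[OF t']
      by (simp_all add: hom_PTree_bot)
    have "add_leaf_map k (s \<Zsemi>\<^bsub>PTree\<^esub> t) = add_leaf_map k s \<Zsemi>\<^bsub>PTree\<^esub> add_leaf_map k t"
    proof (rule tmap_eqI[OF h(1) tmap_comp[OF h(2,3)]])
      fix i y assume y: "y < Fo (add_leaf k ?S) i"
      have n: "Nsrc (s \<Zsemi>\<^bsub>PTree\<^esub> t) = ?S" using st' by (simp add: hom_def)
      show "img (add_leaf_map k (s \<Zsemi>\<^bsub>PTree\<^esub> t)) i y = img (add_leaf_map k s \<Zsemi>\<^bsub>PTree\<^esub> add_leaf_map k t) i y"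
        using y[simplified]
      proof (cases rule: old_cases)
        case leaf
        then show ?thesis using y by (simp add: img_comp_hom[OF h(2)] img_add_leaf_map n old_def)
      next
        case (old x)
        then show ?thesis using y tmap_less[OF s'']
          by (simp add: img_comp_hom[OF h(2)] img_comp_hom[OF s''] img_add_leaf_map n)
      qed
    qed
    then show ?thesis using s t st' by (simp add: Lfun_def hom_def)
  qed
qed

lemma marked_hom_antimono: "t \<in> hom (PTree_bot k) S T \<Longrightarrow> j \<le> k \<Longrightarrow> t \<in> hom (PTree_bot j) S T"
  using marked_antimono[of _ k j] mark_preserved_below[of t S T k j] by (simp add: hom_PTree_bot)

lemma Rfun_functor: "is_functor (PTree_bot (Suc k)) (PTree_bot k) (Rfun k)"
proof (rule is_functorI)
  note C = PTree_bot_category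
  show "is_category (PTree_bot k)" "is_category (PTree_bot (Suc k))" by (rule C)+
  show "Fa (Rfun k) t \<in> Arr (PTree_bot k)" if "t \<in> Arr (PTree_bot (Suc k))" for t
    using marked_hom_antimono[of t "Suc k" "Nsrc t" "Ntgt t" k] that by (simp add: Rfun_def hom_def)
  show "Fo (Rfun k) T \<in> Obj (PTree_bot k)" if "T \<in> Obj (PTree_bot (Suc k))" for T
    using marked_antimono[of T "Suc k" k] that by (simp add: Rfun_def)
  show "Fa (Rfun k) (Ident (PTree_bot (Suc k)) T) = Ident (PTree_bot k) (Fo (Rfun k) T)"
    if "T \<in> Obj (PTree_bot (Suc k))" for T
    using cat_id[OF C that] that by (simp add: Rfun_def)
  show "Fa (Rfun k) (s \<Zsemi>\<^bsub>PTree_bot (Suc k)\<^esub> t) = Fa (Rfun k) s \<Zsemi>\<^bsub>PTree_bot k\<^esub> Fa (Rfun k) t"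
    if "s \<in> Arr (PTree_bot (Suc k))" "t \<in> Arr (PTree_bot (Suc k))"
      "Cod (PTree_bot (Suc k)) s = Dom (PTree_bot (Suc k)) t" for s t
    using cat_comp[OF C that] that by (simp add: Rfun_def)
qed (auto simp: Rfun_def PTree_bot_Arr)

lemma LR_adj_simps [simp]:
  "Asrc (LR_adj k) = PTree_bot k" "Atgt (LR_adj k) = PTree_bot (Suc k)"
  "Aleft (LR_adj k) = Lfun k" "Aright (LR_adj k) = Rfun k"
  "S \<in> Obj (PTree_bot k) \<Longrightarrow> Ncomp (Aunit (LR_adj k)) S = leaf_unit k S"
  "T \<in> Obj (PTree_bot (Suc k)) \<Longrightarrow> Ncomp (Acounit (LR_adj k)) T = leaf_counit k T"
  by (simp_all add: LR_adj_def leaf_unit_def leaf_counit_def mk_map_def)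

lemma Lfun_simps [simp]:
  "S \<in> Obj (PTree_bot k) \<Longrightarrow> Fo (Lfun k) S = add_leaf k S"
  "s \<in> Arr (PTree_bot k) \<Longrightarrow> Fa (Lfun k) s = add_leaf_map k s"
  by (simp_all add: Lfun_def)

lemma Rfun_simps [simp]:
  "T \<in> Obj (PTree_bot (Suc k)) \<Longrightarrow> Fo (Rfun k) T = T"
  "t \<in> Arr (PTree_bot (Suc k)) \<Longrightarrow> Fa (Rfun k) t = t"
  by (simp_all add: Rfun_def)

lemma LR_adj_adjunction: "is_adjunction (LR_adj k)"
proof (rule adjn_is_adjunctionI)
  let ?U = "LR_adj k"
  show "Ntgt (Aunit ?U) = fcomp (Asrc ?U) (Aleft ?U) (Aright ?U)"
    "Nsrc (Aunit ?U) = id_functor (Asrc ?U)"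
    "Nsrc (Acounit ?U) = fcomp (Atgt ?U) (Aright ?U) (Aleft ?U)"
    "Ntgt (Acounit ?U) = id_functor (Atgt ?U)"
    "Ncomp (Aunit ?U) \<in> extensional (Obj (Asrc ?U))"
    "Ncomp (Acounit ?U) \<in> extensional (Obj (Atgt ?U))"
    by (simp_all add: LR_adj_def)
  show "is_functor (Asrc ?U) (Atgt ?U) (Aleft ?U)"
    "is_functor (Atgt ?U) (Asrc ?U) (Aright ?U)"
    by (simp_all add: Lfun_functor Rfun_functor)
  have mk: "T \<in> Obj (PTree_bot k)" if "T \<in> Obj (PTree_bot (Suc k))" for T
    by (rule marked_antimono[OF that]) simp
  show "Ncomp (Aunit ?U) S \<in> hom (Asrc ?U) S (Fo (Aright ?U) (Fo (Aleft ?U) S))"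
    if "S \<in> Obj (Asrc ?U)" for S
    using that leaf_unit_hom add_leaf_marked by simp
  show "Ncomp (Acounit ?U) T \<in> hom (Atgt ?U) (Fo (Aleft ?U) (Fo (Aright ?U) T)) T"
    if "T \<in> Obj (Atgt ?U)" for T
    using that leaf_counit_hom mk by simp
  show "f \<Zsemi>\<^bsub>Asrc ?U\<^esub> Ncomp (Aunit ?U) (Cod (Asrc ?U) f)
       = Ncomp (Aunit ?U) (Dom (Asrc ?U) f) \<Zsemi>\<^bsub>Asrc ?U\<^esub> Fa (Aright ?U) (Fa (Aleft ?U) f)"
    if "f \<in> Arr (Asrc ?U)" for f
  proof -
    let ?S = "Nsrc f" and ?T = "Ntgt f"
    have f: "f \<in> hom (PTree_bot k) ?S ?T" using that by (simp add: hom_def)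
    then have f': "f \<in> hom PTree ?S ?T" "?S \<in> Obj (PTree_bot k)" "?T \<in> Obj (PTree_bot k)" by (simp_all add: hom_PTree_bot)
    have u: "leaf_unit k ?S \<in> hom PTree ?S (add_leaf k ?S)" "leaf_unit k ?T \<in> hom PTree ?T (add_leaf k ?T)"
      "add_leaf_map k f \<in> hom PTree (add_leaf k ?S) (add_leaf k ?T)"
      using leaf_unit_hom[OF f'(2)] leaf_unit_hom[OF f'(3)] add_leaf_map_hom[OF f] by (simp_all add: hom_PTree_bot)
    have "f \<Zsemi>\<^bsub>PTree\<^esub> leaf_unit k ?T = leaf_unit k ?S \<Zsemi>\<^bsub>PTree\<^esub> add_leaf_map k f"
      by (rule tmap_eqI[OF tmap_comp[OF f'(1) u(2)] tmap_comp[OF u(1,3)]])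
        (simp add: img_comp_hom[OF f'(1)] img_comp_hom[OF u(1)] img_leaf_unit tmap_less[OF f'(1)] img_add_leaf_map)
    then show ?thesis
      using f f' add_leaf_map_hom[OF f] that by (simp add: hom_def)
  qed
  show "Fa (Aleft ?U) (Fa (Aright ?U) g) \<Zsemi>\<^bsub>Atgt ?U\<^esub> Ncomp (Acounit ?U) (Cod (Atgt ?U) g)
       = Ncomp (Acounit ?U) (Dom (Atgt ?U) g) \<Zsemi>\<^bsub>Atgt ?U\<^esub> g"
    if "g \<in> Arr (Atgt ?U)" for g
  proof -
    let ?S = "Nsrc g" and ?T = "Ntgt g"
    have g: "g \<in> hom (PTree_bot (Suc k)) ?S ?T" using that by (simp add: hom_def)
    then have g': "g \<in> hom PTree ?S ?T" "?S \<in> Obj (PTree_bot (Suc k))" "?T \<in> Obj (PTree_bot (Suc k))"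
      "img g (Suc k) 0 = 0" by (simp_all add: hom_PTree_bot)
    have gk: "g \<in> hom (PTree_bot k) ?S ?T" by (rule marked_hom_antimono[OF g]) simp
    have u: "leaf_counit k ?S \<in> hom PTree (add_leaf k ?S) ?S" "leaf_counit k ?T \<in> hom PTree (add_leaf k ?T) ?T"
      "add_leaf_map k g \<in> hom PTree (add_leaf k ?S) (add_leaf k ?T)"
      using leaf_counit_hom[OF g'(2)] leaf_counit_hom[OF g'(3)] add_leaf_map_hom[OF gk] by (simp_all add: hom_PTree_bot)
    have "add_leaf_map k g \<Zsemi>\<^bsub>PTree\<^esub> leaf_counit k ?T = leaf_counit k ?S \<Zsemi>\<^bsub>PTree\<^esub> g"
    proof (rule tmap_eqI[OF tmap_comp[OF u(3,2)] tmap_comp[OF u(1) g'(1)]])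
      fix i y assume y: "y < Fo (add_leaf k ?S) i"
      show "img (add_leaf_map k g \<Zsemi>\<^bsub>PTree\<^esub> leaf_counit k ?T) i y = img (leaf_counit k ?S \<Zsemi>\<^bsub>PTree\<^esub> g) i y"
        using y[simplified]
      proof (cases rule: old_cases)
        case leaf
        then show ?thesis using y g'(4)
          by (simp add: img_comp_hom[OF u(3)] img_comp_hom[OF u(1)] img_leaf_counit img_add_leaf_map old_def)
      next
        case (old x)
        then show ?thesis using y tmap_less[OF g'(1)]
          by (simp add: img_comp_hom[OF u(3)] img_comp_hom[OF u(1)] img_leaf_counit img_add_leaf_map)
      qed
    qed
    then show ?thesis
      using gk g' that by (simp add: hom_def)
  qed
  show "Fa (Aleft ?U) (Ncomp (Aunit ?U) S) \<Zsemi>\<^bsub>Atgt ?U\<^esub> Ncomp (Acounit ?U) (Fo (Aleft ?U) S)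
        = Ident (Atgt ?U) (Fo (Aleft ?U) S)"
    if "S \<in> Obj (Asrc ?U)" for S
  proof -
    have S: "S \<in> Obj (PTree_bot k)" using that by simp
    note LS = add_leaf_marked[OF S]
    note u = leaf_unit_hom[OF S]
    have h: "add_leaf_map k (leaf_unit k S) \<in> hom PTree (add_leaf k S) (add_leaf k (add_leaf k S))"
      "leaf_counit k (add_leaf k S) \<in> hom PTree (add_leaf k (add_leaf k S)) (add_leaf k S)"
      using add_leaf_map_hom[OF u] leaf_counit_hom[OF LS] by (simp_all add: hom_PTree_bot)
    have "add_leaf_map k (leaf_unit k S) \<Zsemi>\<^bsub>PTree\<^esub> leaf_counit k (add_leaf k S) = Ident PTree (add_leaf k S)"
    proof (rule tmap_eqI[OF tmap_comp[OF h] id_hom_PTree[OF marked_PTree[OF LS]]])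
      fix i y assume y: "y < Fo (add_leaf k S) i"
      have n: "Nsrc (leaf_unit k S) = S" by (simp add: leaf_unit_def)
      show "img (add_leaf_map k (leaf_unit k S) \<Zsemi>\<^bsub>PTree\<^esub> leaf_counit k (add_leaf k S)) i y = img (Ident PTree (add_leaf k S)) i y"
        using y[simplified]
      proof (cases rule: old_cases)
        case leaf
        then show ?thesis using y
          by (simp add: img_comp_hom[OF h(1)] img_id[OF marked_PTree[OF LS]] img_leaf_counit img_add_leaf_map n old_def)
      next
        case (old x)
        then show ?thesis using y
          by (simp add: img_comp_hom[OF h(1)] img_id[OF marked_PTree[OF LS]] img_leaf_counit img_leaf_unit img_add_leaf_map n)
      qed
    qed
    then show ?thesis using S LS u by (simp add: hom_def)
  qed
  show "Ncomp (Aunit ?U) (Fo (Aright ?U) T) \<Zsemi>\<^bsub>Asrc ?U\<^esub> Fa (Aright ?U) (Ncomp (Acounit ?U) T)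
        = Ident (Asrc ?U) (Fo (Aright ?U) T)"
    if "T \<in> Obj (Atgt ?U)" for T
  proof -
    have T: "T \<in> Obj (PTree_bot (Suc k))" using that by simp
    note T' = mk[OF T]
    have h: "leaf_unit k T \<in> hom PTree T (add_leaf k T)" "leaf_counit k T \<in> hom PTree (add_leaf k T) T"
      using leaf_unit_hom[OF T'] leaf_counit_hom[OF T] by (simp_all add: hom_PTree_bot)
    have "leaf_unit k T \<Zsemi>\<^bsub>PTree\<^esub> leaf_counit k T = Ident PTree T"
      by (rule tmap_eqI[OF tmap_comp[OF h] id_hom_PTree[OF marked_PTree[OF T]]])
        (simp add: img_comp_hom[OF h(1)] img_id[OF marked_PTree[OF T]] img_leaf_unit img_leaf_counit)
    then show ?thesis using T T' leaf_counit_hom[OF T] by (simp add: hom_def)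
  qed
qed

lemma LR_iter_adj: "is_adjunction (LR_iter i n) \<and> Asrc (LR_iter i n) = PTree_bot i \<and> Atgt (LR_iter i n) = PTree_bot (i + n)"
  by (induction n) (simp_all add: Adj_id PTree_bot_category Adj_comp LR_adj_adjunction)

lemmas LR_iter_adjunction = LR_iter_adj[THEN conjunct1]

lemma LR_iter_src [simp]: "Asrc (LR_iter i n) = PTree_bot i"
  and LR_iter_tgt [simp]: "Atgt (LR_iter i n) = PTree_bot (i + n)"
  using LR_iter_adj by auto

lemma LR_iter_add: "LR_iter i (n + m) = LR_iter i n \<Zsemi>\<^bsub>Adj\<^esub> LR_iter (i + n) m"
proof (induction m)
  case 0
  show ?case using cat_id_right[OF Adj_category, of "LR_iter i n"] by (simp add: LR_iter_adjunction)
next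
  case (Suc m)
  show ?case using cat_assoc[OF Adj_category, of "LR_iter i n" "LR_iter (i + n) m" "LR_adj (i + n + m)"]
    by (simp add: Suc LR_iter_adjunction LR_adj_adjunction add.assoc)
qed

lemma PTree_functor_simps [simp]:
  "Fo PTree_functor = PTree_bot" "i \<le> j \<Longrightarrow> Fa PTree_functor (i, j) = LR_iter i (j - i)"
  by (simp_all add: PTree_functor_def)

lemma PTree_functor_functor: "is_functor omega Adj PTree_functor"
proof (rule is_functorI)
  show "Fa PTree_functor \<in> extensional (Arr omega)" by (simp add: PTree_functor_def)
  show "Fa PTree_functor (f \<Zsemi>\<^bsub>omega\<^esub> g) = Fa PTree_functor f \<Zsemi>\<^bsub>Adj\<^esub> Fa PTree_functor g"
    if "f \<in> Arr omega" "g \<in> Arr omega" "Cod omega f = Dom omega g" for f g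
  proof -
    obtain i j j' l where "f = (i, j)" "g = (j', l)" by (cases f, cases g)
    with that have "f = (i, j)" "g = (j, l)" "i \<le> j" "j \<le> l" by simp_all
    then show ?thesis using LR_iter_add[of i "j - i" "l - j"] by simp
  qed
qed (auto simp: omega_category Adj_category PTree_bot_category LR_iter_adjunction)

lemma PTree_functor_Suc: "Fa PTree_functor (k, Suc k) = LR_adj k"
  using cat_id_left[OF Adj_category, of "LR_adj k"] by (simp add: LR_adj_adjunction)

subsection \<open>Iterated adjunctions\<close>

text \<open>The left adjoint of the composite of \<open>n\<close> of the adjunctions attaches a path of \<open>n\<close> fresh vertices to the mark
of height \<open>i\<close>, as a new leftmost branch; the unit includes the old tree. The lemmas below characterize this
construction up to what is needed: the unit is injective, and its image misses exactly the vertices \<open>0\<close> of the heights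
\<open>i + 1, \<dots>, i + n\<close>.\<close>

abbreviation push_tree :: "nat \<Rightarrow> nat \<Rightarrow> tree \<Rightarrow> tree" where
  "push_tree i n \<equiv> Fo (Aleft (LR_iter i n))"

abbreviation push_unit :: "nat \<Rightarrow> nat \<Rightarrow> tree \<Rightarrow> tree_map" where
  "push_unit i n \<equiv> Ncomp (Aunit (LR_iter i n))"

lemma LR_iter_left: "is_functor (PTree_bot i) (PTree_bot (i + n)) (Aleft (LR_iter i n))"
  using adjn_left[OF LR_iter_adjunction, of i n] by simp

lemma LR_iter_right_Fo [simp]: "T \<in> Obj (PTree_bot (i + n)) \<Longrightarrow> Fo (Aright (LR_iter i n)) T = T"
proof (induction n)
  case (Suc n)
  then show ?case using marked_antimono[OF Suc.prems, of "i + n"] by simp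
qed simp

lemma LR_iter_right_Fa [simp]: "t \<in> Arr (PTree_bot (i + n)) \<Longrightarrow> Fa (Aright (LR_iter i n)) t = t"
proof (induction n)
  case (Suc n)
  then show ?case using marked_hom_antimono[of t "i + Suc n" "Nsrc t" "Ntgt t" "i + n"] by (simp add: hom_def)
qed simp

lemma push_tree_marked: "S \<in> Obj (PTree_bot i) \<Longrightarrow> push_tree i n S \<in> Obj (PTree_bot (i + n))"
  using functor_Fo[OF LR_iter_left] .

lemma push_unit_hom_bot:
  "S \<in> Obj (PTree_bot i) \<Longrightarrow> push_unit i n S \<in> hom (PTree_bot i) S (push_tree i n S)"
  using adjn_unit_arr[OF LR_iter_adjunction, of S i n] adjn_unit_dom[OF LR_iter_adjunction, of S i n]
    adjn_unit_cod[OF LR_iter_adjunction, of S i n] push_tree_marked[of S i n]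
  by (simp add: hom_def)

lemma push_unit_hom: "S \<in> Obj (PTree_bot i) \<Longrightarrow> push_unit i n S \<in> hom PTree S (push_tree i n S)"
  using push_unit_hom_bot by (simp add: hom_PTree_bot)

lemma push_tree_Suc: "S \<in> Obj (PTree_bot i) \<Longrightarrow> push_tree i (Suc n) S = add_leaf (i + n) (push_tree i n S)"
  by (simp add: push_tree_marked)

lemma push_unit_Suc:
  assumes "S \<in> Obj (PTree_bot i)"
  shows "push_unit i (Suc n) S = push_unit i n S \<Zsemi>\<^bsub>PTree\<^esub> leaf_unit (i + n) (push_tree i n S)"
  using assms push_tree_marked[OF assms, of n] leaf_unit_hom[OF push_tree_marked[OF assms, of n]]
  by (simp add: hom_def)

lemma push_unit_bij:
  assumes S: "S \<in> Obj (PTree_bot i)" and T: "T \<in> Obj (PTree_bot (i + n))"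
  shows "bij_betw (\<lambda>a. push_unit i n S \<Zsemi>\<^bsub>PTree\<^esub> a) (hom (PTree_bot (i + n)) (push_tree i n S) T) (hom (PTree_bot i) S T)"
proof -
  have "bij_betw (\<lambda>a. push_unit i n S \<Zsemi>\<^bsub>PTree\<^esub> Fa (Aright (LR_iter i n)) a)
      (hom (PTree_bot (i + n)) (push_tree i n S) T) (hom (PTree_bot i) S T)"
    using adjn_transpose_bij[OF LR_iter_adjunction, of S i n T] S T by simp
  also have "?this \<longleftrightarrow> ?thesis"
    by (rule bij_betw_cong) (auto simp: hom_def)
  finally show ?thesis .
qed

lemma img_push_unit_Suc:
  assumes "S \<in> Obj (PTree_bot i)" "x < Fo S l"
  shows "img (push_unit i (Suc n) S) l x = old (i + n) l (img (push_unit i n S) l x)"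
  unfolding push_unit_Suc[OF assms(1)]
  using tmap_less[OF push_unit_hom[OF assms(1), of n] assms(2)]
  by (simp add: img_comp_hom[OF push_unit_hom[OF assms(1)] assms(2)] img_leaf_unit)

lemma img_push_unit_eq_iff:
  assumes "S \<in> Obj (PTree_bot i)" "x < Fo S l" "y < Fo S l"
  shows "img (push_unit i n S) l x = img (push_unit i n S) l y \<longleftrightarrow> x = y"
proof (induction n)
  case 0
  then show ?case using assms marked_PTree[OF assms(1)] by (simp add: img_id)
qed (use assms in \<open>simp add: img_push_unit_Suc del: LR_iter.simps\<close>)

lemma img_push_unit_nonzero:
  assumes "S \<in> Obj (PTree_bot i)" "x < Fo S l" "i < l" "l \<le> i + n"
  shows "img (push_unit i n S) l x \<noteq> 0"
  using assms(4)
proof (induction n)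
  case (Suc n)
  then show ?case
    by (cases "l = Suc (i + n)") (use assms in \<open>simp_all add: img_push_unit_Suc old_below del: LR_iter.simps\<close>)
qed (use assms in simp)

lemma push_tree_cases:
  assumes "S \<in> Obj (PTree_bot i)" "y < Fo (push_tree i n S) l"
  obtains (new) "i < l" "l \<le> i + n" "y = 0" | (old) x where "x < Fo S l" "y = img (push_unit i n S) l x"
  using assms(2)
proof (induction n arbitrary: y thesis)
  case 0
  then show ?case using assms(1) marked_PTree[OF assms(1)] by (simp add: img_id)
next
  case (Suc n)
  have "y < old (i + n) l (Fo (push_tree i n S) l)"
    using Suc.prems(3) push_tree_Suc[OF assms(1), of n] by simp
  then show ?case
  proof (cases rule: old_cases)
    case leaf
    then show ?thesis using Suc.prems(1) by simp
  next
    case (old x)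
    show ?thesis
    proof (rule Suc.IH[OF _ _ old(1)])
      assume "i < l" "l \<le> i + n" "x = 0"
      then show ?thesis using Suc.prems(1) old by (simp add: old_below)
    next
      fix z assume "z < Fo S l" "x = img (push_unit i n S) l z"
      then show ?thesis
        using Suc.prems(2)[of z] old img_push_unit_Suc[OF assms(1), of z l n] by simp
    qed
  qed
qed

text \<open>The only descendants of a fresh vertex are the fresh vertices above it.\<close>

lemma push_tree_descendant:
  assumes S: "S \<in> Obj (PTree_bot i)" and y: "y < Fo (push_tree i n S) l'" "anc (push_tree i n S) l l' y = 0"
    and l: "i < l" "l \<le> i + n" "l \<le> l'"
  shows "y = 0 \<and> l' \<le> i + n"
  using S y(1)
proof (cases rule: push_tree_cases)
  case (old x)
  then have "img (push_unit i n S) l (anc S l l' x) = 0"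
    using y(2) tmap_anc[OF push_unit_hom[OF S] l(3)] by simp
  then show ?thesis
    using img_push_unit_nonzero[OF S tree_anc_less[OF marked_tree[OF S] l(3) old(1)] l(1,2)] by simp
qed simp

lemma factor_through_push_unit:
  assumes T: "T \<in> Obj (PTree_bot i)" and f: "f \<in> hom PTree S (push_tree i n T)"
    and nz: "\<And>l x. x < Fo S l \<Longrightarrow> i < l \<Longrightarrow> l \<le> i + n \<Longrightarrow> img f l x \<noteq> 0"
  shows "\<exists>g\<in>hom PTree S T. f = g \<Zsemi>\<^bsub>PTree\<^esub> push_unit i n T"
proof -
  let ?u = "push_unit i n T"
  note u = push_unit_hom[OF T, of n] and inj = img_push_unit_eq_iff[OF T, of _ _ _ n]
  define h where "h l x = (SOME y. y < Fo T l \<and> img ?u l y = img f l x)" for l x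
  have h: "h l x < Fo T l" "img ?u l (h l x) = img f l x" if x: "x < Fo S l" for l x
  proof -
    have "\<exists>y. y < Fo T l \<and> img ?u l y = img f l x"
      using T tmap_less[OF f x] by (cases rule: push_tree_cases) (use nz[OF x] in auto)
    from someI_ex[OF this] show "h l x < Fo T l" "img ?u l (h l x) = img f l x" by (auto simp: h_def)
  qed
  define g where "g = mk_map S T h"
  have g: "g \<in> hom PTree S T"
    unfolding g_def
  proof (rule mk_map_hom)
    show "S \<in> Obj PTree" "T \<in> Obj PTree" using tmap_src[OF f] marked_PTree[OF T] by simp_all
    show "h l x < Fo T l" if "x < Fo S l" for l x by (rule h[OF that])
    show "h l x \<le> h l y" if "x \<le> y" "y < Fo S l" for l x y
    proof (rule ccontr)
      assume "\<not> h l x \<le> h l y"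
      then have "img ?u l (h l y) \<le> img ?u l (h l x)" "h l y \<noteq> h l x"
        using tmap_mono[OF u, of "h l y" "h l x" l] h[of x l] that by auto
      moreover have "img f l x \<le> img f l y" by (rule tmap_mono[OF f that])
      ultimately show False using h[of x l] h[of y l] that inj[of "h l y" l "h l x"] by simp
    qed
    show "h l (anc S l l' x) = anc T l l' (h l' x)" if "l \<le> l'" "x < Fo S l'" for l l' x
    proof -
      note a = tree_anc_less[OF PTree_functor_tree[OF tmap_src[OF f]] that]
      have "img ?u l (h l (anc S l l' x)) = img ?u l (anc T l l' (h l' x))"
        using h[OF a] h[OF that(2)] tmap_anc[OF f that] tmap_anc[OF u that(1)] by simp
      then show ?thesis
        using inj[OF h(1)[OF a] tree_anc_less[OF marked_tree[OF T] that(1) h(1)[OF that(2)]]] by simp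
    qed
  qed
  have gi: "img g l x = h l x" if "x < Fo S l" for l x using that by (simp add: g_def)
  have "f = g \<Zsemi>\<^bsub>PTree\<^esub> ?u"
    by (rule tmap_eqI[OF f tmap_comp[OF g u]]) (use h gi in \<open>simp add: img_comp_hom[OF g]\<close>)
  then show ?thesis using g by blast
qed

lemma push_unit_mono:
  assumes T: "T \<in> Obj (PTree_bot i)" and g: "g \<in> hom PTree S T" "h \<in> hom PTree S T"
    and eq: "g \<Zsemi>\<^bsub>PTree\<^esub> push_unit i n T = h \<Zsemi>\<^bsub>PTree\<^esub> push_unit i n T"
  shows "g = h"
proof (rule tmap_eqI[OF g])
  fix l x assume x: "x < Fo S l"
  have "img (push_unit i n T) l (img g l x) = img (push_unit i n T) l (img h l x)"
    using arg_cong[OF eq, of "\<lambda>t. img t l x"] x by (simp add: img_comp_hom[OF g(1)] img_comp_hom[OF g(2)])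
  then show "img g l x = img h l x"
    using img_push_unit_eq_iff[OF T tmap_less[OF g(1) x] tmap_less[OF g(2) x]] by simp
qed

text \<open>The factorization through the unit inherits the preservation of marks at heights at which nothing has been
added.\<close>

lemma factor_marked:
  assumes T: "T \<in> Obj (PTree_bot i)" and g: "g \<in> hom PTree S T" and S: "S \<in> Obj (PTree_bot k)" and ki: "k \<le> i"
    and f: "img (g \<Zsemi>\<^bsub>PTree\<^esub> push_unit i n T) k 0 = 0"
  shows "g \<in> hom (PTree_bot k) S T"
proof -
  have 0: "0 < Fo S k" "0 < Fo T k" using marked_pos[OF S, of k] marked_pos[OF T ki] by simp_all
  have "img (push_unit i n T) k 0 = 0"
    using marked_hom_antimono[OF push_unit_hom_bot[OF T] ki] by (simp add: hom_PTree_bot)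
  then have "img (push_unit i n T) k (img g k 0) = img (push_unit i n T) k 0"
    using f 0 by (simp add: img_comp_hom[OF g])
  then have "img g k 0 = 0"
    using img_push_unit_eq_iff[OF T tmap_less[OF g 0(1)] 0(2)] by simp
  then show ?thesis using g S marked_antimono[OF T ki] by (simp add: hom_PTree_bot)
qed

text \<open>The combinatorial core: a map into a tree with a fresh path that preserves the mark of height \<open>k\<close>
  either preserves the mark of height \<open>k + m\<close> or avoids the fresh path.\<close>

lemma pull_push_dichotomy:
  assumes S: "S \<in> Obj (PTree_bot (k + m))" and T: "T \<in> Obj (PTree_bot l)" and k: "k \<le> l + n"
    and f: "f \<in> hom (PTree_bot k) S (push_tree l n T)"
  obtains (pull) "k + m \<le> l + n" "f \<in> hom (PTree_bot (k + m)) S (push_tree l n T)"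
    | (push) g where "k \<le> l" "g \<in> hom (PTree_bot k) S T" "f = g \<Zsemi>\<^bsub>PTree\<^esub> push_unit l n T"
proof (cases "k \<le> l \<and> (\<forall>j x. x < Fo S j \<longrightarrow> l < j \<longrightarrow> j \<le> l + n \<longrightarrow> img f j x \<noteq> 0)")
  case True
  have f': "f \<in> hom PTree S (push_tree l n T)" using f by (simp add: hom_PTree_bot)
  obtain g where g: "g \<in> hom PTree S T" "f = g \<Zsemi>\<^bsub>PTree\<^esub> push_unit l n T"
    using factor_through_push_unit[OF T f'] True by blast
  have "g \<in> hom (PTree_bot k) S T"
    by (rule factor_marked[where n = n, OF T g(1)]) (use f g True in \<open>simp_all add: hom_PTree_bot\<close>)
  then show thesis using push g True by blast
next
  case False
  let ?L = "push_tree l n T"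
  note L = push_tree_marked[OF T, of n]
  have f': "f \<in> hom PTree S ?L" and f0: "img f k 0 = 0" using f by (simp_all add: hom_PTree_bot)
  have S0: "0 < Fo S j" if "j \<le> k + m" for j using marked_pos[OF S that] .
  have km: "k + m \<le> l + n \<and> img f (k + m) 0 = 0"
  proof -
    \<comment> \<open>If a vertex \<open>0\<close> of \<open>S\<close> at or below the mark hits the fresh path, its descendants must follow the path.\<close>
    have above: ?thesis if j: "l < j" "j \<le> l + n" "j \<le> k + m" "img f j 0 = 0" for j
    proof -
      have "anc ?L j (k + m) (img f (k + m) 0) = 0"
        using tmap_anc[OF f' j(3) S0[OF order_refl]] marked_anc[OF S j(3) order_refl] j(4) by simp
      then show ?thesis
        using push_tree_descendant[OF T tmap_less[OF f' S0[OF order_refl]] _ j(1-3)] by blast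
    qed
    show ?thesis
    proof (cases "k \<le> l")
      case True
      then obtain j x where j: "x < Fo S j" "l < j" "j \<le> l + n" "img f j x = 0" using False by blast
      have j0: "img f j 0 = 0" using tmap_mono[OF f', of 0 x j] j by simp
      show ?thesis
      proof (cases "j \<le> k + m")
        case False
        then have kj: "k + m \<le> j" by simp
        let ?z = "anc S (k + m) j 0"
        have z: "?z < Fo S (k + m)" using tree_anc_less[OF marked_tree[OF S] kj] j(1) by simp
        have "img f (k + m) ?z = 0"
          using tmap_anc[OF f' kj, of 0] j j0 marked_anc[OF L kj] by simp
        then have "img f (k + m) 0 = 0" using tmap_mono[OF f' _ z, of 0] by simp
        then show ?thesis using kj j by simp
      qed (rule above[OF j(2,3) _ j0])
    next
      case False
      then show ?thesis using above[of k] k f0 by simp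
    qed
  qed
  then have "f \<in> hom (PTree_bot (k + m)) S ?L"
    using f' S marked_antimono[OF L] by (simp add: hom_PTree_bot)
  then show thesis using pull km by blast
qed

lemma one_vertex_mk_tree: "one_vertex = mk_tree (\<lambda>i. if i = 0 then 1 else 0) (\<lambda>i j x. 0)"
  by (simp add: one_vertex_def mk_tree_def Let_def)

lemma one_vertex_Fo [simp]: "Fo one_vertex i = (if i = 0 then 1 else 0)"
  by (simp add: one_vertex_mk_tree)

lemma one_vertex_functor: "is_functor (op_cat omega) Delta one_vertex"
  unfolding one_vertex_mk_tree by (rule mk_tree_functor) (auto split: if_splits)

lemma one_vertex_PTree: "one_vertex \<in> Obj PTree"
  by (simp add: PTree_Obj one_vertex_functor)

lemma one_vertex_map_unique:
  assumes "f \<in> hom PTree T one_vertex" "g \<in> hom PTree T one_vertex" shows "f = g"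
  using assms(1,2)
proof (rule tmap_eqI)
  fix i x assume "x < Fo T i"
  then show "img f i x = img g i x"
    using tmap_less[OF assms(1), of x i] tmap_less[OF assms(2), of x i] by (simp split: if_splits)
qed

lemma one_vertex_marked: "one_vertex \<in> Obj (PTree_bot 0)"
  by (simp add: PTree_bot_0 one_vertex_PTree)

text \<open>Deleting the vertex \<open>0\<close> of height \<open>k + 1\<close>, which should be a leaf. The remaining vertices of that height are
renumbered, inverting the renumbering by \<open>old\<close>.\<close>

definition remove_leaf :: "nat \<Rightarrow> tree \<Rightarrow> tree" where
  "remove_leaf k T = mk_tree (\<lambda>i. if i = Suc k then Fo T i - 1 else Fo T i)
     (\<lambda>i j x. if i = Suc k then anc T i j (old k j x) - 1 else anc T i j (old k j x))"

text \<open>If the vertex \<open>0\<close> of height \<open>k + 1\<close> is on the leftmost branch and the branch ends there, it is a leaf.\<close>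

lemma add_remove_leaf:
  assumes T: "T \<in> Obj (PTree_bot (Suc k))" and leaf: "T \<notin> Obj (PTree_bot (Suc (Suc k)))"
  shows "remove_leaf k T \<in> Obj (PTree_bot k)" "add_leaf k (remove_leaf k T) = T"
proof -
  note F = marked_tree[OF T]
  define n where "n i = (if i = Suc k then Fo T i - 1 else Fo T i)" for i
  define a where "a i j x = (if i = Suc k then anc T i j (old k j x) - 1 else anc T i j (old k j x))" for i j x
  have R: "remove_leaf k T = mk_tree n a" by (simp add: remove_leaf_def n_def[abs_def] a_def[abs_def])
  have n: "old k i (n i) = Fo T i" for i
    using marked_pos[OF T, of "Suc k"] by (auto simp: n_def old_def)
  have n_less: "old k i x < Fo T i \<longleftrightarrow> x < n i" for i x using n[of i] by (metis old_less_iff)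
  have no_child: "anc T (Suc k) (Suc (Suc k)) x \<noteq> 0" if x: "x < Fo T (Suc (Suc k))" for x
  proof
    assume x0: "anc T (Suc k) (Suc (Suc k)) x = 0"
    have "anc T (Suc k) (Suc (Suc k)) 0 = 0"
      using tree_anc_mono[OF F _ _ x, of "Suc k" 0] x0 by simp
    then have "anc T j (Suc (Suc k)) 0 = 0" if "j \<le> Suc k" for j
      using tree_anc_trans[OF F that, of "Suc (Suc k)" 0] x marked_anc[OF T that] by simp
    then have "T \<in> Obj (PTree_bot (Suc (Suc k)))"
      using x marked_PTree[OF T] tree_anc_refl[OF F, of 0 "Suc (Suc k)"] by (auto simp: PTree_bot_Obj le_Suc_eq)
    then show False using leaf by simp
  qed
  \<comment> \<open>No old vertex descends from the deleted one, so subtracting one from the ancestors is harmless.\<close>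
  have nonleaf: "anc T (Suc k) j (old k j x) \<noteq> 0" if "Suc k \<le> j" "x < n j" for j x
  proof (cases "j = Suc k")
    case True
    have "old k j x < Fo T j" using that n_less by simp
    from tree_anc_refl[OF F this] show ?thesis using True by simp
  next
    case False
    then have j: "Suc (Suc k) \<le> j" using that by simp
    have x: "old k j x < Fo T j" using that n_less by simp
    show ?thesis using no_child[OF tree_anc_less[OF F j x]] tree_anc_trans[OF F _ j x, of "Suc k"] by simp
  qed
  have a: "old k i (a i j x) = anc T i j (old k j x)" if "i \<le> j" "x < n j" for i j x
    using nonleaf[of j x] that by (auto simp: a_def old_def)
  have RF: "is_functor (op_cat omega) Delta (remove_leaf k T)"
    unfolding R
  proof (rule mk_tree_functor)
    have less: "a i j x < n i" if "i \<le> j" "x < n j" for i j x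
      using tree_anc_less[OF F that(1), of "old k j x"] that n_less a by metis
    then show "a i j x < n i" if "i \<le> j" "x < n j" for i j x using that .
    show "a i j x \<le> a i j y" if "i \<le> j" "x \<le> y" "y < n j" for i j x y
    proof -
      have "old k i (a i j x) \<le> old k i (a i j y)"
        using tree_anc_mono[OF F that(1), of "old k j x" "old k j y"] that n_less by (simp add: a)
      then show ?thesis by simp
    qed
    show "a i i x = x" if "x < n i" for i x
    proof -
      have "old k i (a i i x) = old k i x"
        using tree_anc_refl[OF F, of "old k i x" i] that n_less by (simp add: a)
      then show ?thesis by simp
    qed
    show "a i l x = a i j (a j l x)" if "i \<le> j" "j \<le> l" "x < n l" for i j l x
    proof -
      have "old k i (a i l x) = old k i (a i j (a j l x))"
        using tree_anc_trans[OF F that(1,2), of "old k l x"] that n_less less by (simp add: a)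
      then show ?thesis by simp
    qed
  qed
  have a0: "a i k 0 = 0" if "i \<le> k" for i
    using that marked_anc[OF T, of i k] by (simp add: a_def old_def)
  show R_marked: "remove_leaf k T \<in> Obj (PTree_bot k)"
  proof -
    obtain K where "Fo T (Suc K) = 0" using T by (auto simp: PTree_bot_Obj PTree_Obj)
    then have "n (Suc K) = 0" by (auto simp: n_def)
    moreover have "n 0 = 1" "0 < n k"
      using T marked_pos[OF T, of k] by (simp_all add: n_def PTree_bot_Obj PTree_Obj)
    ultimately show ?thesis
      using RF a0 by (auto simp: PTree_bot_Obj PTree_Obj R)
  qed
  show "add_leaf k (remove_leaf k T) = T"
  proof (rule tree_eqI[OF add_leaf_functor[OF R_marked] F])
    show Fo: "Fo (add_leaf k (remove_leaf k T)) i = Fo T i" for i by (simp add: R n)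
    fix i j y assume ij: "i \<le> j" and y: "y < Fo (add_leaf k (remove_leaf k T)) j"
    show "anc (add_leaf k (remove_leaf k T)) i j y = anc T i j y"
      using y[simplified]
    proof (cases rule: old_cases)
      case leaf
      then show ?thesis using y ij marked_anc[OF T, of i "Suc k"] by (simp add: add_leaf_anc)
    next
      case (old x)
      then show ?thesis using y ij a by (simp add: add_leaf_anc R)
    qed
  qed
qed

lemma root_only:
  assumes T: "T \<in> Obj (PTree_bot 0)" and leaf: "T \<notin> Obj (PTree_bot (Suc 0))"
  shows "T = one_vertex"
proof (rule tree_eqI[OF marked_tree[OF T] one_vertex_functor])
  note F = marked_tree[OF T]
  have T0: "Fo T 0 = 1" using T by (simp add: PTree_bot_Obj PTree_Obj)
  have "Fo T (Suc 0) = 0"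
  proof (rule ccontr)
    assume n: "Fo T (Suc 0) \<noteq> 0"
    have "anc T j (Suc 0) 0 = 0" if "j \<le> Suc 0" for j
      using tree_anc_less[OF F, of 0 "Suc 0" 0] tree_anc_refl[OF F, of 0 "Suc 0"] n T0 that
      by (cases "j = 0") (auto simp: le_Suc_eq)
    then show False using leaf n marked_PTree[OF T] by (simp add: PTree_bot_Obj)
  qed
  then have n: "Fo T i = (if i = 0 then 1 else 0)" for i
    using T0 tree_empty_above[OF F, of "Suc 0" i] by auto
  then show "Fo T i = Fo one_vertex i" for i by simp
  show "anc T i j x = anc one_vertex i j x" if "i \<le> j" "x < Fo T j" for i j x
    using that n tree_anc_refl[OF F, of 0 0] by (auto simp: one_vertex_mk_tree split: if_splits)
qed

section \<open>Formulas\<close>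

text \<open>Formulas over \<open>\<omega>\<close>: the atom, and the pushforward \<open>Ps n A\<close> and the pullback \<open>Pl n A\<close> of a formula
along the arrow of \<open>\<omega>\<close> of length \<open>n\<close> out of (respectively into) the height of \<open>A\<close>. The length
\<open>0\<close> is included, because in a cloven bifibration the liftings of an identity need not be identities.\<close>

datatype fm = At | Ps nat fm | Pl nat fm

instance fm :: countable by countable_datatype

text \<open>The object of \<open>\<omega>\<close> over which a formula lies.\<close>

fun ht :: "fm \<Rightarrow> nat" where
  "ht At = 0" | "ht (Ps n A) = ht A + n" | "ht (Pl n A) = ht A - n"

text \<open>A pullback must not descend below \<open>0\<close>.\<close>

fun wff :: "fm \<Rightarrow> bool" where
  "wff At = True" | "wff (Ps n A) = wff A" | "wff (Pl n A) = (wff A \<and> n \<le> ht A)"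

text \<open>The object denoted by a formula in the bifibration \<open>Q\<close>, where the atom denotes \<open>X\<close>.\<close>

fun itp :: "('eo, 'ea, nat, nat \<times> nat) bif \<Rightarrow> 'eo \<Rightarrow> fm \<Rightarrow> 'eo" where
  "itp Q X At = X"
| "itp Q X (Ps n A) = Cod (Tot Q) (Push Q (ht A, ht A + n) (itp Q X A))"
| "itp Q X (Pl n A) = Dom (Tot Q) (Pull Q (ht A - n, ht A) (itp Q X A))"

text \<open>The second component of the denotation of a formula in the category of elements (\<open>itp_elements\<close>).\<close>

fun tree_of :: "fm \<Rightarrow> tree" where
  "tree_of At = one_vertex"
| "tree_of (Ps n A) = push_tree (ht A) n (tree_of A)"
| "tree_of (Pl n A) = tree_of A"

lemma tree_of_marked: "wff A \<Longrightarrow> tree_of A \<in> Obj (PTree_bot (ht A))"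
proof (induction A)
  case (Ps n A)
  then show ?case using push_tree_marked[of "tree_of A" "ht A" n] by simp
next
  case (Pl n A)
  then show ?case using marked_antimono[of "tree_of A" "ht A" "ht A - n"] by simp
qed (simp add: one_vertex_marked)

lemma itp_elements: "wff A \<Longrightarrow> itp (elements omega PTree_functor) (0, one_vertex) A = (ht A, tree_of A)"
proof (induction A)
  case (Pl n A)
  then show ?case using tree_of_marked[of A] LR_iter_right_Fo[of "tree_of A" "ht A - n" n] by simp
qed simp_all

text \<open>Every marked tree is the denotation of a formula on the nose: descend to the end of the leftmost branch, and if this
end is not the root, remove it. Induction on the number of vertices, counted below a fixed height \<open>K + 1\<close>
at which the tree is empty.\<close>

lemma marked_tree_formula: "T \<in> Obj (PTree_bot k) \<Longrightarrow> \<exists>A. wff A \<and> ht A = k \<and> tree_of A = T"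
proof -
  assume T: "T \<in> Obj (PTree_bot k)"
  obtain K where K: "Fo T (Suc K) = 0" using T by (auto simp: PTree_bot_Obj PTree_Obj)
  show ?thesis
    using T K
  proof (induction "\<Sum>i<Suc K. Fo T i" arbitrary: T k rule: less_induct)
    case less
    \<comment> \<open>The height at which the leftmost branch ends.\<close>
    define m where "m = (GREATEST m. T \<in> Obj (PTree_bot m))"
    have bound: "\<forall>m. T \<in> Obj (PTree_bot m) \<longrightarrow> m \<le> K"
      using marked_pos[of T _ "Suc K"] less.prems(2) by (metis less_numeral_extra(3) not_less_eq_eq)
    have m: "T \<in> Obj (PTree_bot m)" "T \<notin> Obj (PTree_bot (Suc m))" "k \<le> m"
      unfolding m_def using bound less.prems(1)
      by (metis (mono_tags, lifting) GreatestI_nat, metis (mono_tags, lifting) Greatest_le_nat not_less_eq_eq order_refl,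
          metis (mono_tags, lifting) Greatest_le_nat)
    have "\<exists>A. wff A \<and> ht A = m \<and> tree_of A = T"
    proof (cases m)
      case 0
      then have "T = one_vertex" using m by (intro root_only) simp_all
      then show ?thesis using 0 by (intro exI[of _ At]) simp
    next
      case (Suc j)
      let ?R = "remove_leaf j T"
      have R: "?R \<in> Obj (PTree_bot j)" "add_leaf j ?R = T"
        using add_remove_leaf[of T j] m Suc by simp_all
      have Fo: "Fo T i = old j i (Fo ?R i)" for i using arg_cong[OF R(2), of "\<lambda>T. Fo T i"] by simp
      have jK: "Suc j < Suc K" using bound m Suc by (metis less_Suc_eq_le)
      have "(\<Sum>i<Suc K. Fo ?R i) < (\<Sum>i<Suc K. Fo T i)"
      proof (rule sum_strict_mono_ex1)
        show "\<forall>i\<in>{..<Suc K}. Fo ?R i \<le> Fo T i" by (simp add: Fo old_def)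
        show "\<exists>i\<in>{..<Suc K}. Fo ?R i < Fo T i" using jK by (intro bexI[of _ "Suc j"]) (simp_all add: Fo)
      qed simp
      moreover have "Fo ?R (Suc K) = 0" using Fo[of "Suc K"] less.prems(2) by (simp add: old_def split: if_splits)
      ultimately obtain A where A: "wff A" "ht A = j" "tree_of A = ?R" using less.hyps R(1) by blast
      then have "wff (Ps 1 A) \<and> ht (Ps 1 A) = m \<and> tree_of (Ps 1 A) = T"
        using Suc R push_tree_Suc[OF R(1), of 0] by (simp del: LR_iter.simps(2))
      then show ?thesis ..
    qed
    then obtain A where A: "wff A" "ht A = m" "tree_of A = T" by blast
    then have "wff (Pl (m - k) A) \<and> ht (Pl (m - k) A) = k \<and> tree_of (Pl (m - k) A) = T" using m by simp
    then show ?case ..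
  qed
qed

section \<open>The tree map underlying an arrow of the category of elements\<close>

text \<open>The transpose \<open>S \<rightarrow> T\<close> of an arrow \<open>(f, a)\<close> from \<open>(i, S)\<close> to \<open>(j, T)\<close>. The right adjoint does nothing to
\<open>a\<close>, so it is not written.\<close>

definition und :: "(nat \<times> tree) \<times> (nat \<times> tree) \<times> (nat \<times> nat) \<times> tree_map \<Rightarrow> tree_map" where
  "und = (\<lambda>((i, S), (j, T), f, a). push_unit i (j - i) S \<Zsemi>\<^bsub>PTree\<^esub> a)"

abbreviation "Elts \<equiv> elements omega PTree_functor"

lemma Elts_hom: "hom (Tot Elts) (i, S) (j, T) = (if i \<le> j \<and> S \<in> Obj (PTree_bot i) \<and> T \<in> Obj (PTree_bot j)
    then (\<lambda>a. ((i, S), (j, T), (i, j), a)) ` hom (PTree_bot j) (push_tree i (j - i) S) T else {})"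
  (is "?A = ?B")
proof (intro set_eqI iffI)
  fix x assume "x \<in> ?A"
  then have "x \<in> Arr (Tot Elts)" "fst x = (i, S)" "fst (snd x) = (j, T)" by (simp_all add: hom_def)
  then show "x \<in> ?B" by (elim elements_ArrE) auto
qed (auto simp: hom_def split: if_splits)

lemma und_bij:
  assumes "i \<le> j" "S \<in> Obj (PTree_bot i)" "T \<in> Obj (PTree_bot j)"
  shows "bij_betw und (hom (Tot Elts) (i, S) (j, T)) (hom (PTree_bot i) S T)"
proof -
  let ?n = "j - i"
  have j: "i + ?n = j" using assms by simp
  have "bij_betw (\<lambda>a. push_unit i ?n S \<Zsemi>\<^bsub>PTree\<^esub> Fa (Aright (LR_iter i ?n)) a)
      (hom (PTree_bot j) (push_tree i ?n S) T) (hom (PTree_bot i) S T)"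
    using adjn_transpose_bij[OF LR_iter_adjunction, of S i ?n T] assms LR_iter_right_Fo[of T i ?n] by simp
  also have "?this \<longleftrightarrow> bij_betw (\<lambda>a. und ((i, S), (j, T), (i, j), a))
      (hom (PTree_bot j) (push_tree i ?n S) T) (hom (PTree_bot i) S T)"
    by (rule bij_betw_cong) (use LR_iter_right_Fa[of _ i ?n] j in \<open>auto simp: und_def hom_def\<close>)
  finally have bij: "bij_betw (und \<circ> (\<lambda>a. ((i, S), (j, T), (i, j), a)))
      (hom (PTree_bot j) (push_tree i ?n S) T) (hom (PTree_bot i) S T)" by (simp add: comp_def)
  have "bij_betw (\<lambda>a. ((i, S), (j, T), (i, j), a)) (hom (PTree_bot j) (push_tree i ?n S) T) (hom (Tot Elts) (i, S) (j, T))"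
    using assms by (simp add: Elts_hom bij_betw_def inj_on_def)
  then show ?thesis using bij bij_betw_comp_iff by blast
qed

lemma und_id: "X \<in> Obj (Tot Elts) \<Longrightarrow> und (Ident (Tot Elts) X) = Ident PTree (snd X)"
  using cat_id_left[OF PTree_category, of "Ident PTree (snd X)"] id_hom_PTree[of "snd X"] marked_PTree
  by (elim elements_ObjE) (simp add: und_def hom_def)

lemma und_push: "i \<le> j \<Longrightarrow> S \<in> Obj (PTree_bot i) \<Longrightarrow> und (Push Elts (i, j) (i, S)) = push_unit i (j - i) S"
  using push_unit_hom[of S i "j - i"] cat_id_right[OF PTree_category, of "push_unit i (j - i) S"]
  by (simp add: und_def hom_def)

lemma und_pull: "i \<le> j \<Longrightarrow> T \<in> Obj (PTree_bot j) \<Longrightarrow> und (Pull Elts (i, j) (j, T)) = Ident PTree T"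
  using adjn_tri2[OF LR_iter_adjunction, of T i "j - i"] adjn_counit_arr[OF LR_iter_adjunction, of T i "j - i"]
    LR_iter_right_Fo[of T i "j - i"] LR_iter_right_Fa[of "Ncomp (Acounit (LR_iter i (j - i))) T" i "j - i"]
  by (simp add: und_def)

lemma und_comp:
  assumes x: "x \<in> Arr (Tot Elts)" and y: "y \<in> Arr (Tot Elts)" and xy: "Cod (Tot Elts) x = Dom (Tot Elts) y"
  shows "und (x \<Zsemi>\<^bsub>Tot Elts\<^esub> y) = und x \<Zsemi>\<^bsub>PTree\<^esub> und y"
proof -
  obtain S T i j a where x': "x = ((i, S), (j, T), (i, j), a)" "i \<le> j" "S \<in> Obj (PTree_bot i)"
    "T \<in> Obj (PTree_bot j)" "a \<in> hom (PTree_bot j) (push_tree i (j - i) S) T"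
    using x by (elim elements_ArrE) (metis PTree_functor_simps omega_simps(2,3,4) prod.collapse)
  obtain W l b where y': "y = ((j, T), (l, W), (j, l), b)" "j \<le> l"
    "W \<in> Obj (PTree_bot l)" "b \<in> hom (PTree_bot l) (push_tree j (l - j) T) W"
    using y by (elim elements_ArrE) (use x' xy in auto)
  define n m where "n = j - i" and "m = l - j"
  have j: "j = i + n" and l: "l = i + n + m" using x' y' by (simp_all add: n_def m_def)
  let ?u = "push_unit i n S" and ?v = "push_unit j m (push_tree i n S)" and ?w = "push_unit j m T"
  let ?La = "Fa (Aleft (LR_iter j m)) a"
  have S: "push_tree i n S \<in> Obj (PTree_bot j)" using push_tree_marked[OF x'(3)] j by simp
  have a: "a \<in> hom (PTree_bot j) (push_tree i n S) T" "a \<in> Arr (PTree_bot j)"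
    "Nsrc a = push_tree i n S" "Ntgt a = T" using x' by (simp_all add: n_def hom_def)
  have b: "b \<in> hom PTree (push_tree j m T) W" using y' by (simp add: hom_PTree_bot m_def)
  have u: "?u \<in> hom PTree S (push_tree i n S)" "?v \<in> hom PTree (push_tree i n S) (push_tree j m (push_tree i n S))"
    "?w \<in> hom PTree T (push_tree j m T)"
    by (rule push_unit_hom[OF x'(3)] push_unit_hom[OF S] push_unit_hom[OF x'(4)])+
  have La: "?La \<in> Arr (PTree_bot (j + m))" "?La \<in> hom PTree (push_tree j m (push_tree i n S)) (push_tree j m T)"
    using functor_Fa[OF LR_iter_left a(2)] functor_dom[OF LR_iter_left a(2)] functor_cod[OF LR_iter_left a(2)] a
    by (simp_all add: hom_def PTree_bot_Arr)
  have unit: "push_unit i (n + m) S = ?u \<Zsemi>\<^bsub>PTree\<^esub> ?v"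
  proof -
    have "?v \<in> Arr (PTree_bot (i + n))" using push_unit_hom_bot[OF S] j by (simp add: hom_def)
    then show ?thesis unfolding LR_iter_add using x' j by simp
  qed
  have nat: "a \<Zsemi>\<^bsub>PTree\<^esub> ?w = ?v \<Zsemi>\<^bsub>PTree\<^esub> ?La"
    using adjn_unit_nat[OF LR_iter_adjunction, of a j m "push_tree i n S" T] a La by simp
  have comp: "\<And>p q r A B C D. p \<in> hom PTree A B \<Longrightarrow> q \<in> hom PTree B C \<Longrightarrow> r \<in> hom PTree C D \<Longrightarrow>
      (p \<Zsemi>\<^bsub>PTree\<^esub> q) \<Zsemi>\<^bsub>PTree\<^esub> r = p \<Zsemi>\<^bsub>PTree\<^esub> (q \<Zsemi>\<^bsub>PTree\<^esub> r)"
    using cat_assoc[OF PTree_category] unfolding hom_def by simp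
  have a': "a \<in> hom PTree (push_tree i n S) T" using a(1) by (simp add: hom_PTree_bot)
  have "und (x \<Zsemi>\<^bsub>Tot Elts\<^esub> y) = (?u \<Zsemi>\<^bsub>PTree\<^esub> ?v) \<Zsemi>\<^bsub>PTree\<^esub> (?La \<Zsemi>\<^bsub>PTree\<^esub> b)"
    using x'(1) y'(1,2) unit j l by (simp add: und_def)
  also have "\<dots> = ?u \<Zsemi>\<^bsub>PTree\<^esub> ((a \<Zsemi>\<^bsub>PTree\<^esub> ?w) \<Zsemi>\<^bsub>PTree\<^esub> b)"
    unfolding nat using comp[OF u(1,2) tmap_comp[OF La(2) b]] comp[OF u(2) La(2) b] by simp
  also have "\<dots> = (?u \<Zsemi>\<^bsub>PTree\<^esub> a) \<Zsemi>\<^bsub>PTree\<^esub> (?w \<Zsemi>\<^bsub>PTree\<^esub> b)"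
    using comp[OF a' u(3) b] comp[OF u(1) a' tmap_comp[OF u(3) b]] by simp
  also have "\<dots> = und x \<Zsemi>\<^bsub>PTree\<^esub> und y"
    using x'(1) y'(1) by (simp add: und_def n_def m_def)
  finally show ?thesis .
qed

lemma hom_comp: "is_category C \<Longrightarrow> f \<in> hom C A B \<Longrightarrow> g \<in> hom C B D \<Longrightarrow> f \<Zsemi>\<^bsub>C\<^esub> g \<in> hom C A D"
  by (auto simp: hom_def)

lemma hom_assoc: "is_category C \<Longrightarrow> f \<in> hom C A B \<Longrightarrow> g \<in> hom C B D \<Longrightarrow> h \<in> hom C D E \<Longrightarrow>
    (f \<Zsemi>\<^bsub>C\<^esub> g) \<Zsemi>\<^bsub>C\<^esub> h = f \<Zsemi>\<^bsub>C\<^esub> (g \<Zsemi>\<^bsub>C\<^esub> h)"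
  by (auto simp: hom_def cat_assoc)

lemma hom_id: "is_category C \<Longrightarrow> A \<in> Obj C \<Longrightarrow> Ident C A \<in> hom C A A"
  by (simp add: hom_def)

lemma hom_id_left: "is_category C \<Longrightarrow> f \<in> hom C A B \<Longrightarrow> Ident C A \<Zsemi>\<^bsub>C\<^esub> f = f"
  and hom_id_right: "is_category C \<Longrightarrow> f \<in> hom C A B \<Longrightarrow> f \<Zsemi>\<^bsub>C\<^esub> Ident C B = f"
  by (auto simp: hom_def cat_id_left cat_id_right)

section \<open>Bifibrations over \<omega> with an object over \<open>0\<close>\<close>

text \<open>The chosen liftings \<open>A \<rightarrow> Ps n A\<close> and \<open>Pl n A \<rightarrow> A\<close> at the objects denoted by formulas.\<close>

definition psh :: "('eo, 'ea, nat, nat \<times> nat) bif \<Rightarrow> 'eo \<Rightarrow> nat \<Rightarrow> fm \<Rightarrow> 'ea" where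
  "psh Q X n A = Push Q (ht A, ht A + n) (itp Q X A)"

definition pll :: "('eo, 'ea, nat, nat \<times> nat) bif \<Rightarrow> 'eo \<Rightarrow> nat \<Rightarrow> fm \<Rightarrow> 'ea" where
  "pll Q X n A = Pull Q (ht A - n, ht A) (itp Q X A)"

text \<open>The cut-free sequent calculus. \<open>der Q X A B \<alpha>\<close> says that the arrow \<open>\<alpha>\<close> from the denotation of \<open>A\<close> to that
of \<open>B\<close> has a derivation from the identity of the atom by the left and right rules for pushforwards
(\<open>lps\<close>, \<open>rps\<close>) and pullbacks (\<open>lpl\<close>, \<open>rpl\<close>). The rules \<open>rps\<close> and \<open>lpl\<close> compose with a lifting, the rules \<open>lps\<close> and \<open>rpl\<close> factor through
one.\<close>

inductive der :: "('eo, 'ea, nat, nat \<times> nat) bif \<Rightarrow> 'eo \<Rightarrow> fm \<Rightarrow> fm \<Rightarrow> 'ea \<Rightarrow> bool" for Q X where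
  at: "der Q X At At (Ident (Tot Q) X)"
| lps: "der Q X A B \<alpha> \<Longrightarrow> \<beta> \<in> hom (Tot Q) (itp Q X (Ps n A)) (itp Q X B) \<Longrightarrow> \<alpha> = psh Q X n A \<Zsemi>\<^bsub>Tot Q\<^esub> \<beta>
    \<Longrightarrow> der Q X (Ps n A) B \<beta>"
| rps: "der Q X A B \<alpha> \<Longrightarrow> der Q X A (Ps n B) (\<alpha> \<Zsemi>\<^bsub>Tot Q\<^esub> psh Q X n B)"
| lpl: "der Q X A B \<alpha> \<Longrightarrow> n \<le> ht A \<Longrightarrow> der Q X (Pl n A) B (pll Q X n A \<Zsemi>\<^bsub>Tot Q\<^esub> \<alpha>)"
| rpl: "der Q X A B \<alpha> \<Longrightarrow> n \<le> ht B \<Longrightarrow> \<beta> \<in> hom (Tot Q) (itp Q X A) (itp Q X (Pl n B)) \<Longrightarrow>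
    \<alpha> = \<beta> \<Zsemi>\<^bsub>Tot Q\<^esub> pll Q X n B \<Longrightarrow> der Q X A (Pl n B) \<beta>"

text \<open>An arrow is good if cuts with derivable arrows on its left can be eliminated. Good arrows are derivable since
identities are. In contrast to derivable arrows they are closed under composition by definition, so that cut elimination
becomes the statement that good arrows are closed under factorization through liftings.\<close>

definition good :: "('eo, 'ea, nat, nat \<times> nat) bif \<Rightarrow> 'eo \<Rightarrow> fm \<Rightarrow> fm \<Rightarrow> 'ea \<Rightarrow> bool" where
  "good Q X A B \<alpha> \<longleftrightarrow> wff A \<and> wff B \<and> \<alpha> \<in> hom (Tot Q) (itp Q X A) (itp Q X B) \<and>
     (\<forall>C \<gamma>. der Q X C A \<gamma> \<longrightarrow> der Q X C B (\<gamma> \<Zsemi>\<^bsub>Tot Q\<^esub> \<alpha>))"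

text \<open>The test situation of the universal property of the free bifibration on an object over \<open>0\<close>.\<close>

locale pointed_bifibration =
  fixes Q :: "('eo, 'ea, nat, nat \<times> nat) bif" and X :: 'eo
  assumes bif: "is_bifibration omega Q" and X: "X \<in> Obj (Tot Q)" and X0: "Fo (Proj Q) X = 0"
begin

abbreviation "E \<equiv> Tot Q"
abbreviation "over \<equiv> Fo (Proj Q)"
abbreviation "ob \<equiv> itp Q X"

lemma proj: "is_functor E omega (Proj Q)"
  using bif unfolding is_bifibration_def by blast

lemma E_cat: "is_category E"
  by (rule functor_src[OF proj])

lemma proj_arr: "\<alpha> \<in> hom E S T \<Longrightarrow> Fa (Proj Q) \<alpha> = (over S, over T)"
  and over_le: "\<alpha> \<in> hom E S T \<Longrightarrow> over S \<le> over T"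
proof -
  assume a: "\<alpha> \<in> hom E S T"
  then show *: "Fa (Proj Q) \<alpha> = (over S, over T)"
    using functor_dom[OF proj, of \<alpha>] functor_cod[OF proj, of \<alpha>] by (simp add: hom_def prod_eq_iff)
  show "over S \<le> over T" using functor_Fa[OF proj, of \<alpha>] a by (simp add: hom_def * )
qed

lemma push_lift:
  assumes "S \<in> Obj E" "over S \<le> j"
  shows "Push Q (over S, j) S \<in> hom E S (Cod E (Push Q (over S, j) S))" "over (Cod E (Push Q (over S, j) S)) = j"
proof -
  have p: "Push Q (over S, j) S \<in> Arr E \<and> Dom E (Push Q (over S, j) S) = S \<and> Fa (Proj Q) (Push Q (over S, j) S) = (over S, j)"
    using bif assms unfolding is_bifibration_def by simp
  then show h: "Push Q (over S, j) S \<in> hom E S (Cod E (Push Q (over S, j) S))" by (simp add: hom_def)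
  show "over (Cod E (Push Q (over S, j) S)) = j" using proj_arr[OF h] p by simp
qed

lemma push_ex1:
  assumes "S \<in> Obj E" "over S \<le> j" "j \<le> over T" "\<alpha> \<in> hom E S T"
  shows "\<exists>!\<beta>. \<beta> \<in> hom E (Cod E (Push Q (over S, j) S)) T \<and> \<alpha> = Push Q (over S, j) S \<Zsemi>\<^bsub>E\<^esub> \<beta>"
proof -
  let ?p = "Push Q (over S, j) S"
  have "(over S, j) \<in> Arr omega" "(j, over T) \<in> Arr omega" "\<alpha> \<in> Arr E" "Dom E \<alpha> = S" "Cod E \<alpha> = T"
    "Fa (Proj Q) \<alpha> = (over S, over T)"
    using assms proj_arr[OF assms(4)] by (simp_all add: hom_def)
  then have ex1: "\<exists>!\<beta>. \<beta> \<in> Arr E \<and> Dom E \<beta> = Cod E ?p \<and> Cod E \<beta> = Cod E \<alpha> \<and> Fa (Proj Q) \<beta> = (j, over T) \<and> \<alpha> = ?p \<Zsemi>\<^bsub>E\<^esub> \<beta>"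
    using bif[unfolded is_bifibration_def, THEN conjunct2, THEN conjunct1, rule_format, of "(over S, j)" S,
        THEN conjunct2, THEN conjunct2, THEN conjunct2, rule_format, of "(j, over T)" \<alpha>] assms(1) by simp
  have "\<beta> \<in> Arr E \<and> Dom E \<beta> = Cod E ?p \<and> Cod E \<beta> = Cod E \<alpha> \<and> Fa (Proj Q) \<beta> = (j, over T) \<and> \<alpha> = ?p \<Zsemi>\<^bsub>E\<^esub> \<beta>
      \<longleftrightarrow> \<beta> \<in> hom E (Cod E ?p) T \<and> \<alpha> = ?p \<Zsemi>\<^bsub>E\<^esub> \<beta>" for \<beta>
    using proj_arr[of \<beta> "Cod E ?p" T] push_lift(2)[OF assms(1,2)] \<open>Cod E \<alpha> = T\<close> by (auto simp: hom_def)
  then show ?thesis using ex1 by simp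
qed

lemma pull_lift:
  assumes "T \<in> Obj E" "i \<le> over T"
  shows "Pull Q (i, over T) T \<in> hom E (Dom E (Pull Q (i, over T) T)) T" "over (Dom E (Pull Q (i, over T) T)) = i"
proof -
  have p: "Pull Q (i, over T) T \<in> Arr E \<and> Cod E (Pull Q (i, over T) T) = T \<and> Fa (Proj Q) (Pull Q (i, over T) T) = (i, over T)"
    using bif assms unfolding is_bifibration_def by simp
  then show h: "Pull Q (i, over T) T \<in> hom E (Dom E (Pull Q (i, over T) T)) T" by (simp add: hom_def)
  show "over (Dom E (Pull Q (i, over T) T)) = i" using proj_arr[OF h] p by simp
qed

lemma pull_ex1:
  assumes "T \<in> Obj E" "i \<le> over T" "over S \<le> i" "\<alpha> \<in> hom E S T"
  shows "\<exists>!\<beta>. \<beta> \<in> hom E S (Dom E (Pull Q (i, over T) T)) \<and> \<alpha> = \<beta> \<Zsemi>\<^bsub>E\<^esub> Pull Q (i, over T) T"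
proof -
  let ?p = "Pull Q (i, over T) T"
  have "(over S, i) \<in> Arr omega" "(i, over T) \<in> Arr omega" "\<alpha> \<in> Arr E" "Dom E \<alpha> = S" "Cod E \<alpha> = T"
    "Fa (Proj Q) \<alpha> = (over S, over T)"
    using assms proj_arr[OF assms(4)] by (simp_all add: hom_def)
  then have ex1: "\<exists>!\<beta>. \<beta> \<in> Arr E \<and> Cod E \<beta> = Dom E ?p \<and> Dom E \<beta> = Dom E \<alpha> \<and> Fa (Proj Q) \<beta> = (over S, i) \<and> \<alpha> = \<beta> \<Zsemi>\<^bsub>E\<^esub> ?p"
    using bif[unfolded is_bifibration_def, THEN conjunct2, THEN conjunct2, rule_format, of "(i, over T)" T,
        THEN conjunct2, THEN conjunct2, THEN conjunct2, rule_format, of "(over S, i)" \<alpha>] assms(1) by simp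
  have "\<beta> \<in> Arr E \<and> Cod E \<beta> = Dom E ?p \<and> Dom E \<beta> = Dom E \<alpha> \<and> Fa (Proj Q) \<beta> = (over S, i) \<and> \<alpha> = \<beta> \<Zsemi>\<^bsub>E\<^esub> ?p
      \<longleftrightarrow> \<beta> \<in> hom E S (Dom E ?p) \<and> \<alpha> = \<beta> \<Zsemi>\<^bsub>E\<^esub> ?p" for \<beta>
    using proj_arr[of \<beta> S "Dom E ?p"] pull_lift(2)[OF assms(1,2)] \<open>Dom E \<alpha> = S\<close> by (auto simp: hom_def)
  then show ?thesis using ex1 by simp
qed

lemma hom_Obj: "\<alpha> \<in> hom E S T \<Longrightarrow> S \<in> Obj E \<and> T \<in> Obj E"
  using E_cat by (auto simp: hom_def)

lemma ob_over: "wff A \<Longrightarrow> ob A \<in> Obj E \<and> over (ob A) = ht A"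
proof (induction A)
  case (Ps n A)
  then show ?case using push_lift[of "ob A" "ht A + n"] hom_Obj by auto
next
  case (Pl n A)
  then show ?case using pull_lift[of "ob A" "ht A - n"] hom_Obj by auto
qed (simp add: X X0)

lemma ob_Obj: "wff A \<Longrightarrow> ob A \<in> Obj E" and over_ob: "wff A \<Longrightarrow> over (ob A) = ht A"
  using ob_over by auto

lemma ht_le: "wff A \<Longrightarrow> wff B \<Longrightarrow> \<alpha> \<in> hom E (ob A) (ob B) \<Longrightarrow> ht A \<le> ht B"
  using over_le[of \<alpha> "ob A" "ob B"] by (simp add: over_ob)

lemma psh_hom: "wff A \<Longrightarrow> psh Q X n A \<in> hom E (ob A) (ob (Ps n A))"
  using push_lift(1)[of "ob A" "ht A + n"] by (simp add: ob_Obj over_ob psh_def)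

lemma pll_hom: "wff A \<Longrightarrow> n \<le> ht A \<Longrightarrow> pll Q X n A \<in> hom E (ob (Pl n A)) (ob A)"
  using pull_lift(1)[of "ob A" "ht A - n"] by (simp add: ob_Obj over_ob pll_def)

lemma psh_ex1: "wff A \<Longrightarrow> T \<in> Obj E \<Longrightarrow> ht A + n \<le> over T \<Longrightarrow> \<alpha> \<in> hom E (ob A) T \<Longrightarrow>
    \<exists>!\<beta>. \<beta> \<in> hom E (ob (Ps n A)) T \<and> \<alpha> = psh Q X n A \<Zsemi>\<^bsub>E\<^esub> \<beta>"
  using push_ex1[of "ob A" "ht A + n" T \<alpha>] by (simp add: ob_Obj over_ob psh_def)

lemma pll_ex1: "wff A \<Longrightarrow> n \<le> ht A \<Longrightarrow> over S \<le> ht A - n \<Longrightarrow> \<alpha> \<in> hom E S (ob A) \<Longrightarrow>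
    \<exists>!\<beta>. \<beta> \<in> hom E S (ob (Pl n A)) \<and> \<alpha> = \<beta> \<Zsemi>\<^bsub>E\<^esub> pll Q X n A"
  using pull_ex1[of "ob A" "ht A - n" S \<alpha>] by (simp add: ob_Obj over_ob pll_def)

lemma psh_cancel:
  assumes "wff A" "\<beta> \<in> hom E (ob (Ps n A)) T" "\<beta>' \<in> hom E (ob (Ps n A)) T"
    "psh Q X n A \<Zsemi>\<^bsub>E\<^esub> \<beta> = psh Q X n A \<Zsemi>\<^bsub>E\<^esub> \<beta>'"
  shows "\<beta> = \<beta>'"
proof -
  have "ht A + n \<le> over T" using over_le[OF assms(2)] over_ob[of "Ps n A"] assms(1) by simp
  then show ?thesis
    using psh_ex1[OF assms(1) _ _ hom_comp[OF E_cat psh_hom[OF assms(1)] assms(2)], of n] assms hom_Obj[OF assms(2)]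
    by blast
qed

lemma pll_cancel:
  assumes "wff A" "n \<le> ht A" "\<beta> \<in> hom E S (ob (Pl n A))" "\<beta>' \<in> hom E S (ob (Pl n A))"
    "\<beta> \<Zsemi>\<^bsub>E\<^esub> pll Q X n A = \<beta>' \<Zsemi>\<^bsub>E\<^esub> pll Q X n A"
  shows "\<beta> = \<beta>'"
proof -
  have "over S \<le> ht A - n" using over_le[OF assms(3)] over_ob[of "Pl n A"] assms by simp
  then show ?thesis
    using pll_ex1[OF assms(1,2) _ hom_comp[OF E_cat assms(3) pll_hom[OF assms(1,2)]]] assms by blast
qed

subsection \<open>Cut elimination\<close>

lemma der_hom: "der Q X A B \<alpha> \<Longrightarrow> wff A \<and> wff B \<and> \<alpha> \<in> hom E (ob A) (ob B)"
proof (induction rule: der.induct)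
  case at
  then show ?case using hom_id[OF E_cat X] by simp
next
  case (rps A B \<alpha> n)
  then show ?case using hom_comp[OF E_cat _ psh_hom, of \<alpha> "ob A" B n] by simp
next
  case (lpl A B \<alpha> n)
  then show ?case using hom_comp[OF E_cat pll_hom, of A n \<alpha> "ob B"] by simp
qed auto

lemma der_id: "wff A \<Longrightarrow> der Q X A A (Ident E (ob A))"
proof (induction A)
  case At
  then show ?case using der.at[of Q X] by simp
next
  case (Ps n A)
  have p: "psh Q X n A \<in> hom E (ob A) (ob (Ps n A))" using Ps.prems psh_hom by simp
  have "der Q X A (Ps n A) (psh Q X n A)"
    using der.rps[of Q X A A "Ident E (ob A)" n] Ps hom_id_left[OF E_cat p] by simp
  then show ?case
    by (rule der.lps) (use hom_id_right[OF E_cat p] hom_id[OF E_cat ob_Obj[OF Ps.prems]] in simp_all)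
next
  case (Pl n A)
  have p: "pll Q X n A \<in> hom E (ob (Pl n A)) (ob A)" using Pl.prems pll_hom by simp
  have "der Q X (Pl n A) A (pll Q X n A)"
    using der.lpl[of Q X A A "Ident E (ob A)" n] Pl hom_id_right[OF E_cat p] by simp
  then show ?case
    by (rule der.rpl) (use Pl.prems hom_id_left[OF E_cat p] hom_id[OF E_cat ob_Obj[OF Pl.prems]] in simp_all)
qed

lemma good_der: "good Q X A B \<alpha> \<Longrightarrow> der Q X A B \<alpha>"
  using der_id[of A] hom_id_left[OF E_cat, of \<alpha> "ob A" "ob B"] unfolding good_def by metis

lemma good_id: "wff A \<Longrightarrow> good Q X A A (Ident E (ob A))"
  using hom_id[OF E_cat ob_Obj[of A]] hom_id_right[OF E_cat] der_hom unfolding good_def by metis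

lemma good_comp:
  assumes "good Q X A B \<alpha>" "good Q X B C \<beta>" shows "good Q X A C (\<alpha> \<Zsemi>\<^bsub>E\<^esub> \<beta>)"
proof -
  have h: "\<alpha> \<in> hom E (ob A) (ob B)" "\<beta> \<in> hom E (ob B) (ob C)" using assms by (simp_all add: good_def)
  have "der Q X D C (\<gamma> \<Zsemi>\<^bsub>E\<^esub> (\<alpha> \<Zsemi>\<^bsub>E\<^esub> \<beta>))" if d: "der Q X D A \<gamma>" for D \<gamma>
  proof -
    have "der Q X D C ((\<gamma> \<Zsemi>\<^bsub>E\<^esub> \<alpha>) \<Zsemi>\<^bsub>E\<^esub> \<beta>)" using assms d by (simp add: good_def)
    then show ?thesis using hom_assoc[OF E_cat _ h, of \<gamma> "ob D"] der_hom[OF d] by simp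
  qed
  then show ?thesis using assms hom_comp[OF E_cat h] by (simp add: good_def)
qed

lemma good_psh: "wff A \<Longrightarrow> good Q X A (Ps n A) (psh Q X n A)"
  using psh_hom[of A n] der.rps[of Q X _ A _ n] by (simp add: good_def)

text \<open>A cut against the left rule for a pushforward, by induction on the other derivation: the cut is principal when that
derivation ends with the right rule, and is permuted upwards otherwise.\<close>

lemma der_comp_lps:
  assumes "der Q X C B \<gamma>" "B = Ps n S" "good Q X S T \<alpha>" "\<beta> \<in> hom E (ob (Ps n S)) (ob T)" "\<alpha> = psh Q X n S \<Zsemi>\<^bsub>E\<^esub> \<beta>"
  shows "der Q X C T (\<gamma> \<Zsemi>\<^bsub>E\<^esub> \<beta>)"
  using assms(1,2)
proof (induction rule: der.induct)
  case (lps A B \<alpha>' \<gamma> m)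
  have A: "wff A" using der_hom[OF lps(1)] by blast
  have b: "\<gamma> \<in> hom E (ob (Ps m A)) (ob (Ps n S))" using lps by simp
  show ?case
  proof (rule der.lps[of Q X A T "\<alpha>' \<Zsemi>\<^bsub>E\<^esub> \<beta>"])
    show "der Q X A T (\<alpha>' \<Zsemi>\<^bsub>E\<^esub> \<beta>)" using lps by simp
    show "\<gamma> \<Zsemi>\<^bsub>E\<^esub> \<beta> \<in> hom E (ob (Ps m A)) (ob T)" by (rule hom_comp[OF E_cat b assms(4)])
    show "\<alpha>' \<Zsemi>\<^bsub>E\<^esub> \<beta> = psh Q X m A \<Zsemi>\<^bsub>E\<^esub> (\<gamma> \<Zsemi>\<^bsub>E\<^esub> \<beta>)"
      using hom_assoc[OF E_cat psh_hom[OF A] b assms(4)] lps(3) by simp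
  qed
next
  case (rps A B \<gamma> m)
  then have d: "der Q X A S \<gamma>" and m: "m = n" "B = S" by simp_all
  have "der Q X A T (\<gamma> \<Zsemi>\<^bsub>E\<^esub> \<alpha>)" using assms(3) d by (simp add: good_def)
  moreover have "(\<gamma> \<Zsemi>\<^bsub>E\<^esub> psh Q X n S) \<Zsemi>\<^bsub>E\<^esub> \<beta> = \<gamma> \<Zsemi>\<^bsub>E\<^esub> \<alpha>"
    using hom_assoc[OF E_cat _ psh_hom assms(4), of \<gamma> "ob A"] der_hom[OF d] assms(5) by simp
  ultimately show ?case by (simp add: m)
next
  case (lpl A B \<gamma> m)
  then have d: "der Q X A (Ps n S) \<gamma>" and T: "der Q X A T (\<gamma> \<Zsemi>\<^bsub>E\<^esub> \<beta>)" by simp_all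
  have "(pll Q X m A \<Zsemi>\<^bsub>E\<^esub> \<gamma>) \<Zsemi>\<^bsub>E\<^esub> \<beta> = pll Q X m A \<Zsemi>\<^bsub>E\<^esub> (\<gamma> \<Zsemi>\<^bsub>E\<^esub> \<beta>)"
    using hom_assoc[OF E_cat pll_hom _ assms(4), of A m \<gamma>] der_hom[OF d] lpl(2) by simp
  then show ?case using der.lpl[OF T lpl(2)] by simp
qed simp_all

lemma good_lps:
  assumes "good Q X S T \<alpha>" "\<beta> \<in> hom E (ob (Ps n S)) (ob T)" "\<alpha> = psh Q X n S \<Zsemi>\<^bsub>E\<^esub> \<beta>"
  shows "good Q X (Ps n S) T \<beta>"
  using assms der_comp_lps[OF _ refl assms] by (simp add: good_def)

text \<open>The right rule for pullbacks is invertible.\<close>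

lemma der_comp_pll:
  assumes "der Q X C B \<gamma>" "B = Pl n T" "wff T" "n \<le> ht T"
  shows "der Q X C T (\<gamma> \<Zsemi>\<^bsub>E\<^esub> pll Q X n T)"
  using assms(1,2)
proof (induction rule: der.induct)
  case (lps A B \<alpha>' \<gamma> m)
  have A: "wff A" using der_hom[OF lps(1)] by blast
  have b: "\<gamma> \<in> hom E (ob (Ps m A)) (ob (Pl n T))" using lps by simp
  show ?case
  proof (rule der.lps[of Q X A T "\<alpha>' \<Zsemi>\<^bsub>E\<^esub> pll Q X n T"])
    show "der Q X A T (\<alpha>' \<Zsemi>\<^bsub>E\<^esub> pll Q X n T)" using lps by simp
    show "\<gamma> \<Zsemi>\<^bsub>E\<^esub> pll Q X n T \<in> hom E (ob (Ps m A)) (ob T)" by (rule hom_comp[OF E_cat b pll_hom[OF assms(3,4)]])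
    show "\<alpha>' \<Zsemi>\<^bsub>E\<^esub> pll Q X n T = psh Q X m A \<Zsemi>\<^bsub>E\<^esub> (\<gamma> \<Zsemi>\<^bsub>E\<^esub> pll Q X n T)"
      using hom_assoc[OF E_cat psh_hom[OF A] b pll_hom[OF assms(3,4)]] lps(3) by simp
  qed
next
  case (lpl A B \<gamma> m)
  then have d: "der Q X A (Pl n T) \<gamma>" and T: "der Q X A T (\<gamma> \<Zsemi>\<^bsub>E\<^esub> pll Q X n T)" by simp_all
  have "(pll Q X m A \<Zsemi>\<^bsub>E\<^esub> \<gamma>) \<Zsemi>\<^bsub>E\<^esub> pll Q X n T = pll Q X m A \<Zsemi>\<^bsub>E\<^esub> (\<gamma> \<Zsemi>\<^bsub>E\<^esub> pll Q X n T)"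
    using hom_assoc[OF E_cat pll_hom _ pll_hom[OF assms(3,4)], of A m \<gamma>] der_hom[OF d] lpl(2) by simp
  then show ?case using der.lpl[OF T lpl(2)] by simp
qed simp_all

lemma good_pll: "wff T \<Longrightarrow> n \<le> ht T \<Longrightarrow> good Q X (Pl n T) T (pll Q X n T)"
  using pll_hom[of T n] der_comp_pll[OF _ refl] by (simp add: good_def)

lemma good_rpl:
  assumes "good Q X S T \<alpha>" "n \<le> ht T" "\<beta> \<in> hom E (ob S) (ob (Pl n T))" "\<alpha> = \<beta> \<Zsemi>\<^bsub>E\<^esub> pll Q X n T"
  shows "good Q X S (Pl n T) \<beta>"
proof -
  have T: "wff T" using assms(1) by (simp add: good_def)
  have "der Q X C (Pl n T) (\<gamma> \<Zsemi>\<^bsub>E\<^esub> \<beta>)" if d: "der Q X C S \<gamma>" for C \<gamma>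
  proof -
    have g: "\<gamma> \<in> hom E (ob C) (ob S)" using der_hom[OF d] by simp
    show ?thesis
    proof (rule der.rpl[of Q X C T "\<gamma> \<Zsemi>\<^bsub>E\<^esub> \<alpha>"])
      show "der Q X C T (\<gamma> \<Zsemi>\<^bsub>E\<^esub> \<alpha>)" using assms(1) d by (simp add: good_def)
      show "\<gamma> \<Zsemi>\<^bsub>E\<^esub> \<beta> \<in> hom E (ob C) (ob (Pl n T))" by (rule hom_comp[OF E_cat g assms(3)])
      show "\<gamma> \<Zsemi>\<^bsub>E\<^esub> \<alpha> = \<gamma> \<Zsemi>\<^bsub>E\<^esub> \<beta> \<Zsemi>\<^bsub>E\<^esub> pll Q X n T"
        using hom_assoc[OF E_cat g assms(3) pll_hom[OF T assms(2)]] assms(4) by simp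
    qed (rule assms)
  qed
  then show ?thesis using assms by (simp add: good_def)
qed

text \<open>Inversion of the last rule when neither invertible rule applies.\<close>

lemma der_pull_push_cases:
  assumes "der Q X A B \<alpha>" "\<nexists>n A'. A = Ps n A'" "\<nexists>n B'. B = Pl n B'"
  obtains (id) "A = At" "B = At" "\<alpha> = Ident E X"
  | (pull) n A' \<alpha>' where "A = Pl n A'" "\<alpha>' \<in> hom E (ob A') (ob B)" "\<alpha> = pll Q X n A' \<Zsemi>\<^bsub>E\<^esub> \<alpha>'"
  | (push) n B' \<alpha>' where "B = Ps n B'" "\<alpha>' \<in> hom E (ob A) (ob B')" "\<alpha> = \<alpha>' \<Zsemi>\<^bsub>E\<^esub> psh Q X n B'"
  using assms(1)
proof (cases rule: der.cases)
  case at
  then show thesis using id by blast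
next
  case (rps B' \<alpha>' n)
  then show thesis using push[of n B' \<alpha>'] der_hom[of A B' \<alpha>'] by blast
next
  case (lpl A' \<alpha>' n)
  then show thesis using pull[of n A' \<alpha>'] der_hom[of A' B \<alpha>'] by blast
qed (use assms in blast)+

subsection \<open>The sub-bifibration of derivable arrows\<close>

text \<open>The objects denoted by formulas and the good arrows between them, with the liftings of \<open>Q\<close>.\<close>

definition gen :: "('eo, 'ea, nat, nat \<times> nat) bif" where
  "gen = (let Ob = ob ` {A. wff A}; Ar = {\<alpha>. \<exists>A B. good Q X A B \<alpha>} in
    \<lparr>Tot = E\<lparr>Obj := Ob, Arr := Ar\<rparr>, Proj = \<lparr>Fo = restrict over Ob, Fa = restrict (Fa (Proj Q)) Ar\<rparr>,
     Push = Push Q, Pull = Pull Q\<rparr>)"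

lemma gen_simps [simp]:
  "Obj (Tot gen) = ob ` {A. wff A}" "Arr (Tot gen) = {\<alpha>. \<exists>A B. good Q X A B \<alpha>}"
  "Dom (Tot gen) = Dom E" "Cod (Tot gen) = Cod E" "Ident (Tot gen) = Ident E" "Comp (Tot gen) = Comp E"
  "Push gen = Push Q" "Pull gen = Pull Q"
  "S \<in> ob ` {A. wff A} \<Longrightarrow> Fo (Proj gen) S = over S"
  "good Q X A B \<alpha> \<Longrightarrow> Fa (Proj gen) \<alpha> = Fa (Proj Q) \<alpha>"
  by (auto simp: gen_def Let_def)

text \<open>Injectivity is used to compose: a good arrow into an object can be composed with a good arrow out of the same object
only if both are good for the same formula.\<close>

lemma gen_bifibration:
  assumes inj: "inj_on ob {A. wff A}"
  shows "is_bifibration omega gen"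
proof -
  have gh: "\<alpha> \<in> hom E (ob A) (ob B)" "\<alpha> \<in> Arr E" "Dom E \<alpha> = ob A" "Cod E \<alpha> = ob B" "wff A" "wff B"
    if "good Q X A B \<alpha>" for A B \<alpha> using that by (auto simp: good_def hom_def)
  have eq: "A = B" if "ob A = ob B" "wff A" "wff B" for A B using inj that by (auto simp: inj_on_def)
  have gc: "\<exists>A B. good Q X A B (\<alpha> \<Zsemi>\<^bsub>E\<^esub> \<beta>)"
    if "good Q X A B \<alpha>" "good Q X B' C \<beta>" "Cod E \<alpha> = Dom E \<beta>" for A B B' C \<alpha> \<beta>
    using good_comp[of A B \<alpha> C \<beta>] that gh[OF that(1)] gh[OF that(2)] eq[of B B'] by auto
  have cat: "is_category (Tot gen)"
    by (rule is_categoryI) (use E_cat gc in \<open>auto simp: gh cat_id_left cat_id_right cat_assoc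
      cat_id_left[OF E_cat] ob_Obj intro: good_id\<close>)
  have psh_eq: "Push Q f (ob A) = psh Q X (snd f - fst f) A" "ht A + (snd f - fst f) = snd f"
    if "f \<in> Arr omega" "over (ob A) = fst f" "wff A" for f A
    using that over_ob[of A] by (cases f; simp add: psh_def)+
  have pll_eq: "Pull Q f (ob A) = pll Q X (snd f - fst f) A" "snd f - fst f \<le> ht A" "ht A - (snd f - fst f) = fst f"
    if "f \<in> Arr omega" "over (ob A) = snd f" "wff A" for f A
    using that over_ob[of A] by (cases f; simp add: pll_def)+
  show ?thesis
  proof (rule is_bifibrationI)
    show "is_functor (Tot gen) omega (Proj gen)"
    proof (rule is_functorI[OF cat omega_category])
      show "Fo (Proj gen) \<in> extensional (Obj (Tot gen))" "Fa (Proj gen) \<in> extensional (Arr (Tot gen))"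
        by (simp_all add: gen_def Let_def)
      show "Fa (Proj gen) (\<alpha> \<Zsemi>\<^bsub>Tot gen\<^esub> \<beta>) = Fa (Proj gen) \<alpha> \<Zsemi>\<^bsub>omega\<^esub> Fa (Proj gen) \<beta>"
        if ab: "\<alpha> \<in> Arr (Tot gen)" "\<beta> \<in> Arr (Tot gen)" "Cod (Tot gen) \<alpha> = Dom (Tot gen) \<beta>" for \<alpha> \<beta>
      proof -
        obtain A B B' C where "good Q X A B \<alpha>" "good Q X B' C \<beta>" using ab by auto
        moreover obtain A'' B'' where "good Q X A'' B'' (\<alpha> \<Zsemi>\<^bsub>E\<^esub> \<beta>)" using gc[of A B \<alpha> B' C \<beta>] calculation ab(3) by auto
        ultimately show ?thesis using functor_comp[OF proj, of \<alpha> \<beta>] ab(3) gh(2) by simp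
      qed
      show "Fa (Proj gen) (Ident (Tot gen) S) = Ident omega (Fo (Proj gen) S)" if S: "S \<in> Obj (Tot gen)" for S
      proof -
        obtain A where A: "S = ob A" "wff A" using S unfolding gen_simps by blast
        show ?thesis using functor_id[OF proj ob_Obj[OF A(2)]] good_id[OF A(2)] A by simp
      qed
      fix \<alpha> assume "\<alpha> \<in> Arr (Tot gen)"
      then obtain A B where g: "good Q X A B \<alpha>" by auto
      show "Fa (Proj gen) \<alpha> \<in> Arr omega" "Dom omega (Fa (Proj gen) \<alpha>) = Fo (Proj gen) (Dom (Tot gen) \<alpha>)"
        "Cod omega (Fa (Proj gen) \<alpha>) = Fo (Proj gen) (Cod (Tot gen) \<alpha>)"
        using g gh[OF g] functor_Fa[OF proj, of \<alpha>] functor_dom[OF proj, of \<alpha>] functor_cod[OF proj, of \<alpha>] by simp_all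
    qed simp
  next
    fix f S assume f: "f \<in> Arr omega" and S: "S \<in> Obj (Tot gen)" "Fo (Proj gen) S = Dom omega f"
    then obtain A where A: "S = ob A" "wff A" by auto
    let ?n = "snd f - fst f"
    have o: "over (ob A) = fst f" using S A by simp
    note p = psh_eq[OF f o A(2)] and gp = good_psh[OF A(2), of ?n]
    have Pp: "Fa (Proj Q) (psh Q X ?n A) = f"
      using proj_arr[OF psh_hom[OF A(2)], of ?n] over_ob[of "Ps ?n A"] o p(2) A by (simp del: itp.simps)
    show "Push gen f S \<in> Arr (Tot gen) \<and> Dom (Tot gen) (Push gen f S) = S \<and> Fa (Proj gen) (Push gen f S) = f"
      using gp gh[OF gp] Pp A p by auto
    fix g \<alpha> assume g: "g \<in> Arr omega" "Dom omega g = Cod omega f"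
      and a: "\<alpha> \<in> Arr (Tot gen)" "Dom (Tot gen) \<alpha> = S" "Fa (Proj gen) \<alpha> = f \<Zsemi>\<^bsub>omega\<^esub> g"
    obtain A' B where ga': "good Q X A' B \<alpha>" using a by auto
    have "A' = A" by (rule eq) (use a(2) A gh(3,5)[OF ga'] in simp_all)
    then have ga: "good Q X A B \<alpha>" using ga' by simp
    have oB: "over (ob B) = snd g" using a(3) ga proj_arr[OF gh(1)[OF ga]] by simp
    have le: "ht A + ?n \<le> over (ob B)" using oB p(2) g by (cases g) simp
    obtain \<beta> where b: "\<beta> \<in> hom E (ob (Ps ?n A)) (ob B)" "\<alpha> = psh Q X ?n A \<Zsemi>\<^bsub>E\<^esub> \<beta>"
      using psh_ex1[OF A(2) ob_Obj[OF gh(6)[OF ga]] le gh(1)[OF ga]] by blast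
    have gb: "good Q X (Ps ?n A) B \<beta>" by (rule good_lps[OF ga b])
    show "\<exists>!\<beta>. \<beta> \<in> Arr (Tot gen) \<and> Dom (Tot gen) \<beta> = Cod (Tot gen) (Push gen f S) \<and>
        Cod (Tot gen) \<beta> = Cod (Tot gen) \<alpha> \<and> Fa (Proj gen) \<beta> = g \<and> \<alpha> = Push gen f S \<Zsemi>\<^bsub>Tot gen\<^esub> \<beta>"
    proof (rule ex1I[of _ \<beta>])
      show "\<beta> \<in> Arr (Tot gen) \<and> Dom (Tot gen) \<beta> = Cod (Tot gen) (Push gen f S) \<and>
        Cod (Tot gen) \<beta> = Cod (Tot gen) \<alpha> \<and> Fa (Proj gen) \<beta> = g \<and> \<alpha> = Push gen f S \<Zsemi>\<^bsub>Tot gen\<^esub> \<beta>"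
        using gb gh(3,4)[OF gb] gh(4)[OF gp] gh(4)[OF ga] b(2) A p proj_arr[OF b(1)] oB g over_ob[of "Ps ?n A"]
        by (auto simp: prod_eq_iff simp del: itp.simps)
      fix \<beta>' assume b': "\<beta>' \<in> Arr (Tot gen) \<and> Dom (Tot gen) \<beta>' = Cod (Tot gen) (Push gen f S) \<and>
        Cod (Tot gen) \<beta>' = Cod (Tot gen) \<alpha> \<and> Fa (Proj gen) \<beta>' = g \<and> \<alpha> = Push gen f S \<Zsemi>\<^bsub>Tot gen\<^esub> \<beta>'"
      then have "\<beta>' \<in> hom E (ob (Ps ?n A)) (ob B)"
        using gh(2) gh(4)[OF gp] gh(4)[OF ga] A p by (auto simp: hom_def simp del: itp.simps)
      then show "\<beta>' = \<beta>"
        using psh_cancel[OF A(2) _ b(1)] b(2) b' A p by simp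
    qed
  next
    fix f S assume f: "f \<in> Arr omega" and S: "S \<in> Obj (Tot gen)" "Fo (Proj gen) S = Cod omega f"
    then obtain A where A: "S = ob A" "wff A" by auto
    let ?n = "snd f - fst f"
    have o: "over (ob A) = snd f" using S A by simp
    note p = pll_eq[OF f o A(2)]
    note gp = good_pll[OF A(2) p(2)]
    have Pp: "Fa (Proj Q) (pll Q X ?n A) = f"
      using proj_arr[OF pll_hom[OF A(2) p(2)]] over_ob[of "Pl ?n A"] o p A by (simp del: itp.simps)
    show "Pull gen f S \<in> Arr (Tot gen) \<and> Cod (Tot gen) (Pull gen f S) = S \<and> Fa (Proj gen) (Pull gen f S) = f"
      using gp gh[OF gp] Pp A p by auto
    fix g \<alpha> assume g: "g \<in> Arr omega" "Cod omega g = Dom omega f"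
      and a: "\<alpha> \<in> Arr (Tot gen)" "Cod (Tot gen) \<alpha> = S" "Fa (Proj gen) \<alpha> = g \<Zsemi>\<^bsub>omega\<^esub> f"
    obtain B A' where ga': "good Q X B A' \<alpha>" using a by auto
    have "A' = A" by (rule eq) (use a(2) A gh(4,6)[OF ga'] in simp_all)
    then have ga: "good Q X B A \<alpha>" using ga' by simp
    have oB: "over (ob B) = fst g" using a(3) ga proj_arr[OF gh(1)[OF ga]] by simp
    have le: "over (ob B) \<le> ht A - ?n" using oB p(3) g by (cases g) simp
    obtain \<beta> where b: "\<beta> \<in> hom E (ob B) (ob (Pl ?n A))" "\<alpha> = \<beta> \<Zsemi>\<^bsub>E\<^esub> pll Q X ?n A"
      using pll_ex1[OF A(2) p(2) le gh(1)[OF ga]] by blast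
    have gb: "good Q X B (Pl ?n A) \<beta>" by (rule good_rpl[OF ga p(2) b])
    show "\<exists>!\<beta>. \<beta> \<in> Arr (Tot gen) \<and> Cod (Tot gen) \<beta> = Dom (Tot gen) (Pull gen f S) \<and>
        Dom (Tot gen) \<beta> = Dom (Tot gen) \<alpha> \<and> Fa (Proj gen) \<beta> = g \<and> \<alpha> = \<beta> \<Zsemi>\<^bsub>Tot gen\<^esub> Pull gen f S"
    proof (rule ex1I[of _ \<beta>])
      show "\<beta> \<in> Arr (Tot gen) \<and> Cod (Tot gen) \<beta> = Dom (Tot gen) (Pull gen f S) \<and>
        Dom (Tot gen) \<beta> = Dom (Tot gen) \<alpha> \<and> Fa (Proj gen) \<beta> = g \<and> \<alpha> = \<beta> \<Zsemi>\<^bsub>Tot gen\<^esub> Pull gen f S"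
        using gb gh(3,4)[OF gb] gh(3)[OF gp] gh(3)[OF ga] b(2) A p proj_arr[OF b(1)] oB g over_ob[of "Pl ?n A"]
        by (auto simp: prod_eq_iff simp del: itp.simps)
      fix \<beta>' assume b': "\<beta>' \<in> Arr (Tot gen) \<and> Cod (Tot gen) \<beta>' = Dom (Tot gen) (Pull gen f S) \<and>
        Dom (Tot gen) \<beta>' = Dom (Tot gen) \<alpha> \<and> Fa (Proj gen) \<beta>' = g \<and> \<alpha> = \<beta>' \<Zsemi>\<^bsub>Tot gen\<^esub> Pull gen f S"
      then have "\<beta>' \<in> hom E (ob B) (ob (Pl ?n A))"
        using gh(2) gh(3)[OF gp] gh(3)[OF ga] A p by (auto simp: hom_def simp del: itp.simps)
      then show "\<beta>' = \<beta>"
        using pll_cancel[OF A(2) p(2) _ b(1)] b(2) b' A p by simp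
    qed
  qed
qed

end

section \<open>The free bifibration\<close>

subsection \<open>Morphisms of bifibrations out of the free one\<close>

text \<open>The functor from the terminal category that picks the object \<open>X\<close>.\<close>

definition point :: "('o, 'a) cat \<Rightarrow> 'o \<Rightarrow> (unit, unit, 'o, 'a) ftor" where
  "point D X = \<lparr>Fo = (\<lambda>_. X), Fa = (\<lambda>_. Ident D X)\<rparr>"

lemma terminal_category: "is_category terminal_cat"
  by (rule is_categoryI) (simp_all add: terminal_cat_def)

lemma point_functor: "is_category D \<Longrightarrow> X \<in> Obj D \<Longrightarrow> is_functor terminal_cat D (point D X)"
  by (rule is_functorI[OF terminal_category]) (auto simp: point_def terminal_cat_def cat_id_left)

lemma point_fcomp:
  assumes F: "is_functor terminal_cat D F" and G: "is_functor D D' G"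
  shows "fcomp terminal_cat F G = point D' (Fo G (Fo F ()))"
proof (rule functor_eqI[OF fcomp_functor[OF F G] point_functor])
  have o: "Obj terminal_cat = UNIV" "Arr terminal_cat = UNIV" by (simp_all add: terminal_cat_def)
  have X: "Fo F () \<in> Obj D" using functor_Fo[OF F] o by simp
  show "is_category D'" by (rule functor_tgt[OF G])
  show "Fo G (Fo F ()) \<in> Obj D'" using functor_Fo[OF G X] .
  show "Fo (fcomp terminal_cat F G) A = Fo (point D' (Fo G (Fo F ()))) A" for A
    by (simp add: o point_def)
  have "Fa F f = Ident D (Fo F ())" for f
    using functor_id[OF F, of "()"] by (simp add: terminal_cat_def)
  then show "Fa (fcomp terminal_cat F G) f = Fa (point D' (Fo G (Fo F ()))) f" for f
    using functor_id[OF G X] by (simp add: o point_def)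
qed

lemma p_omega_point: "p_omega = point omega 0"
  by (simp add: p_omega_def point_def)

lemma point_eq_iff: "point D X = point D Y \<longleftrightarrow> X = Y"
  by (auto simp: point_def fun_eq_iff)

text \<open>As functors out of the terminal category are objects, the universal property is about objects over
\<open>0\<close>.\<close>

lemma free_unique:
  fixes Q :: "('eo, 'ea, nat, nat \<times> nat) bif"
  assumes free: "free_bifibration TYPE('eo \<times> 'ea) terminal_cat omega p_omega B \<eta>"
    and Q: "is_bifibration omega Q" and X: "X \<in> Obj (Tot Q)" "Fo (Proj Q) X = 0"
  shows "\<exists>!G. bif_morphism omega B Q G \<and> Fo G (Fo \<eta> ()) = X"
proof -
  have pr: "is_functor (Tot Q) omega (Proj Q)" using Q by (simp add: is_bifibration_def)
  have \<eta>: "is_functor terminal_cat (Tot B) \<eta>" using free by (simp add: free_bifibration_def)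
  note pt = point_functor[OF functor_src[OF pr] X(1)]
  have "fcomp terminal_cat (point (Tot Q) X) (Proj Q) = p_omega"
    unfolding point_fcomp[OF pt pr] p_omega_point by (simp add: point_def X)
  then have "\<exists>!G. bif_morphism omega B Q G \<and> fcomp terminal_cat \<eta> G = point (Tot Q) X"
    using free Q pt unfolding free_bifibration_def by blast
  moreover have "(bif_morphism omega B Q G \<and> fcomp terminal_cat \<eta> G = point (Tot Q) X)
      = (bif_morphism omega B Q G \<and> Fo G (Fo \<eta> ()) = X)" for G
  proof -
    have "is_functor (Tot B) (Tot Q) G" if "bif_morphism omega B Q G"
      using that by (simp add: bif_morphism_def)
    then show ?thesis using point_fcomp[OF \<eta>, of "Tot Q" G] point_eq_iff[of "Tot Q" _ X] by metis
  qed
  ultimately show ?thesis by simp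
qed

lemma free_pointed:
  assumes free: "free_bifibration TYPE('eo \<times> 'ea) terminal_cat omega p_omega B \<eta>"
  shows "pointed_bifibration B (Fo \<eta> ())"
proof
  have \<eta>: "is_functor terminal_cat (Tot B) \<eta>" and p: "fcomp terminal_cat \<eta> (Proj B) = p_omega"
    using free by (simp_all add: free_bifibration_def)
  show B: "is_bifibration omega B" using free by (simp add: free_bifibration_def)
  show "Fo \<eta> () \<in> Obj (Tot B)" using functor_Fo[OF \<eta>] by (simp add: terminal_cat_def)
  have "is_functor (Tot B) omega (Proj B)" using B by (simp add: is_bifibration_def)
  from point_fcomp[OF \<eta> this] show "Fo (Proj B) (Fo \<eta> ()) = 0"
    using p point_eq_iff unfolding p_omega_point by metis
qed

text \<open>Morphisms of bifibrations commute with the interpretation of formulas.\<close>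

lemma bif_morphism_psh_pll:
  assumes pt: "pointed_bifibration Q X" and G: "bif_morphism omega Q Q' G"
  shows "wff A \<Longrightarrow> Fo G (itp Q X A) = itp Q' (Fo G X) A"
    and "wff A \<Longrightarrow> Fa G (psh Q X n A) = psh Q' (Fo G X) n A"
    and "wff A \<Longrightarrow> n \<le> ht A \<Longrightarrow> Fa G (pll Q X n A) = pll Q' (Fo G X) n A"
proof -
  interpret pointed_bifibration Q X by (rule pt)
  have F: "is_functor (Tot Q) (Tot Q') G" using G by (simp add: bif_morphism_def)
  have P: "Fa G (psh Q X n A) = Push Q' (ht A, ht A + n) (Fo G (ob A))" if "wff A" for A n
    using G ob_Obj[OF that] over_ob[OF that] by (simp add: bif_morphism_def psh_def)
  have L: "Fa G (pll Q X n A) = Pull Q' (ht A - n, ht A) (Fo G (ob A))" if "wff A" for A n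
    using G ob_Obj[OF that] over_ob[OF that] by (simp add: bif_morphism_def pll_def)
  have *: "Fo G (ob A) = itp Q' (Fo G X) A" if "wff A" for A
    using that
  proof (induction A)
    case (Ps n A)
    then show ?case using P[of A n] functor_cod[OF F, of "psh Q X n A"] psh_hom[of A n] by (simp add: hom_def)
  next
    case (Pl n A)
    then show ?case using L[of A n] functor_dom[OF F, of "pll Q X n A"] pll_hom[of A n] by (simp add: hom_def)
  qed simp
  then show "wff A \<Longrightarrow> Fo G (itp Q X A) = itp Q' (Fo G X) A" .
  show "wff A \<Longrightarrow> Fa G (psh Q X n A) = psh Q' (Fo G X) n A" using P * by (simp add: psh_def)
  show "wff A \<Longrightarrow> n \<le> ht A \<Longrightarrow> Fa G (pll Q X n A) = pll Q' (Fo G X) n A" using L * by (simp add: pll_def)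
qed

subsection \<open>Distinct formulas denote distinct objects\<close>

text \<open>The separating bifibration must have the types of objects and arrows of a category of elements, at which freeness is given. So formulas are
coded by pairs of a number and an arbitrary tree, and arrows are made to carry an arbitrary tree map.\<close>

definition enc :: "fm \<Rightarrow> nat \<times> tree" where "enc A = (to_nat A, undefined)"

definition dec :: "nat \<times> tree \<Rightarrow> fm" where "dec x = from_nat (fst x)"

lemma dec_enc [simp]: "dec (enc A) = A"
  by (simp add: dec_def enc_def)

text \<open>The only arrow from \<open>A\<close> to \<open>B\<close> in the bifibration defined next.\<close>

definition car :: "fm \<Rightarrow> fm \<Rightarrow> (nat \<times> tree) \<times> (nat \<times> tree) \<times> (nat \<times> nat) \<times> tree_map" where
  "car A B = (enc A, enc B, (ht A, ht B), undefined)"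

lemma car_simps [simp]:
  "fst (car A B) = enc A" "fst (snd (car A B)) = enc B" "fst (snd (snd (car A B))) = (ht A, ht B)"
  by (simp_all add: car_def)

lemma enc_eq_iff [simp]: "enc A = enc B \<longleftrightarrow> A = B"
  by (metis dec_enc)

lemma car_eq_iff [simp]: "car A B = car A' B' \<longleftrightarrow> A = A' \<and> B = B'"
  by (auto simp: car_def)

text \<open>The bifibration whose objects are the (codes of) formulas, with exactly one arrow from \<open>A\<close> to \<open>B\<close> over the
arrow of \<open>\<omega>\<close> between their heights, if there is one. In it each formula denotes itself.\<close>

definition codisc :: "(nat \<times> tree, (nat \<times> tree) \<times> (nat \<times> tree) \<times> (nat \<times> nat) \<times> tree_map, nat, nat \<times> nat) bif" where
  "codisc = (let Ob = enc ` {A. wff A}; Ar = {car A B | A B. wff A \<and> wff B \<and> ht A \<le> ht B} in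
    \<lparr>Tot = \<lparr>Obj = Ob, Arr = Ar, Dom = fst, Cod = (\<lambda>a. fst (snd a)), Ident = (\<lambda>x. car (dec x) (dec x)),
        Comp = (\<lambda>a b. car (dec (fst a)) (dec (fst (snd b))))\<rparr>,
      Proj = \<lparr>Fo = (\<lambda>x\<in>Ob. ht (dec x)), Fa = (\<lambda>a\<in>Ar. fst (snd (snd a)))\<rparr>,
      Push = (\<lambda>f x. car (dec x) (Ps (snd f - fst f) (dec x))),
      Pull = (\<lambda>f y. car (Pl (snd f - fst f) (dec y)) (dec y))\<rparr>)"

lemma codisc_simps [simp]:
  "Obj (Tot codisc) = enc ` {A. wff A}"
  "Dom (Tot codisc) = fst" "Cod (Tot codisc) a = fst (snd a)"
  "Ident (Tot codisc) x = car (dec x) (dec x)"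
  "a \<Zsemi>\<^bsub>Tot codisc\<^esub> b = car (dec (fst a)) (dec (fst (snd b)))"
  "wff A \<Longrightarrow> Fo (Proj codisc) (enc A) = ht A"
  "wff A \<Longrightarrow> wff B \<Longrightarrow> ht A \<le> ht B \<Longrightarrow> Fa (Proj codisc) (car A B) = (ht A, ht B)"
  "Push codisc f x = car (dec x) (Ps (snd f - fst f) (dec x))"
  "Pull codisc f x = car (Pl (snd f - fst f) (dec x)) (dec x)"
  by (auto simp: codisc_def Let_def)

lemma codisc_Arr [simp]: "car A B \<in> Arr (Tot codisc) \<longleftrightarrow> wff A \<and> wff B \<and> ht A \<le> ht B"
  by (auto simp: codisc_def Let_def)

lemma codisc_ArrE:
  assumes "a \<in> Arr (Tot codisc)" obtains A B where "a = car A B" "wff A" "wff B" "ht A \<le> ht B"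
  using assms by (auto simp: codisc_def Let_def)

lemma codisc_bifibration: "is_bifibration omega codisc"
proof -
  have cat: "is_category (Tot codisc)"
    by (rule is_categoryI) (auto elim!: codisc_ArrE)
  show ?thesis
  proof (rule is_bifibrationI)
    show "is_functor (Tot codisc) omega (Proj codisc)"
    proof (rule is_functorI[OF cat omega_category])
      show "Fo (Proj codisc) \<in> extensional (Obj (Tot codisc))" "Fa (Proj codisc) \<in> extensional (Arr (Tot codisc))"
        by (simp_all add: codisc_def Let_def)
    qed (auto elim!: codisc_ArrE)
    fix f S assume f: "f \<in> Arr omega" and S: "S \<in> Obj (Tot codisc)" "Fo (Proj codisc) S = Dom omega f"
    then obtain A where A: "S = enc A" "wff A" "f = (ht A, snd f)" "ht A \<le> snd f" by (cases f) auto
    then obtain n where n: "f = (ht A, ht A + n)" by (metis le_add_diff_inverse)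
    show "Push codisc f S \<in> Arr (Tot codisc) \<and> Dom (Tot codisc) (Push codisc f S) = S \<and>
        Fa (Proj codisc) (Push codisc f S) = f"
      using A n by simp
    fix g \<alpha> assume g: "g \<in> Arr omega" "Dom omega g = Cod omega f" and a: "\<alpha> \<in> Arr (Tot codisc)"
      "Dom (Tot codisc) \<alpha> = S" "Fa (Proj codisc) \<alpha> = f \<Zsemi>\<^bsub>omega\<^esub> g"
    from a(1) obtain A' B where a': "\<alpha> = car A' B" "wff A'" "wff B" "ht A' \<le> ht B" by (rule codisc_ArrE)
    then have B: "\<alpha> = car A B" "wff B" "g = (ht A + n, ht B)" "ht A + n \<le> ht B"
      using a A n g by (cases g; auto)+
    show "\<exists>!\<beta>. \<beta> \<in> Arr (Tot codisc) \<and> Dom (Tot codisc) \<beta> = Cod (Tot codisc) (Push codisc f S) \<and>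
        Cod (Tot codisc) \<beta> = Cod (Tot codisc) \<alpha> \<and> Fa (Proj codisc) \<beta> = g \<and> \<alpha> = Push codisc f S \<Zsemi>\<^bsub>Tot codisc\<^esub> \<beta>"
      using A B n by (intro ex1I[of _ "car (Ps n A) B"]) (auto elim!: codisc_ArrE)
  next
    fix f S assume f: "f \<in> Arr omega" and S: "S \<in> Obj (Tot codisc)" "Fo (Proj codisc) S = Cod omega f"
    then obtain A where A: "S = enc A" "wff A" "f = (fst f, ht A)" "fst f \<le> ht A" by (cases f) auto
    then obtain n where n: "f = (ht A - n, ht A)" "n \<le> ht A" by (metis diff_diff_cancel diff_le_self)
    show "Pull codisc f S \<in> Arr (Tot codisc) \<and> Cod (Tot codisc) (Pull codisc f S) = S \<and>
        Fa (Proj codisc) (Pull codisc f S) = f"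
      using A n by simp
    fix g \<alpha> assume g: "g \<in> Arr omega" "Cod omega g = Dom omega f" and a: "\<alpha> \<in> Arr (Tot codisc)"
      "Cod (Tot codisc) \<alpha> = S" "Fa (Proj codisc) \<alpha> = g \<Zsemi>\<^bsub>omega\<^esub> f"
    from a(1) obtain B A' where a': "\<alpha> = car B A'" "wff B" "wff A'" "ht B \<le> ht A'" by (rule codisc_ArrE)
    then have B: "\<alpha> = car B A" "wff B" "g = (ht B, ht A - n)" "ht B \<le> ht A - n"
      using a A n g by (cases g; auto)+
    show "\<exists>!\<beta>. \<beta> \<in> Arr (Tot codisc) \<and> Cod (Tot codisc) \<beta> = Dom (Tot codisc) (Pull codisc f S) \<and>
        Dom (Tot codisc) \<beta> = Dom (Tot codisc) \<alpha> \<and> Fa (Proj codisc) \<beta> = g \<and> \<alpha> = \<beta> \<Zsemi>\<^bsub>Tot codisc\<^esub> Pull codisc f S"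
      using A B n by (intro ex1I[of _ "car B (Pl n A)"]) (auto elim!: codisc_ArrE)
  qed
qed

lemma codisc_itp: "wff A \<Longrightarrow> itp codisc (enc At) A = enc A"
  by (induction A) simp_all

lemma free_itp_inj:
  assumes free: "free_bifibration TYPE((nat \<times> tree) \<times> ((nat \<times> tree) \<times> (nat \<times> tree) \<times> (nat \<times> nat) \<times> tree_map))
       terminal_cat omega p_omega B \<eta>"
  shows "inj_on (itp B (Fo \<eta> ())) {A. wff A}"
proof -
  have "enc At \<in> Obj (Tot codisc)" "Fo (Proj codisc) (enc At) = 0" by simp_all
  then obtain J where J: "bif_morphism omega B codisc J" "Fo J (Fo \<eta> ()) = enc At"
    using free_unique[OF free codisc_bifibration] by blast
  then have "Fo J (itp B (Fo \<eta> ()) A) = enc A" if "wff A" for A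
    using bif_morphism_psh_pll(1)[OF free_pointed[OF free] J(1) that] codisc_itp[OF that] by simp
  then show ?thesis by (intro inj_onI) (metis dec_enc mem_Collect_eq)
qed

subsection \<open>Every arrow of the free bifibration is derivable\<close>

text \<open>The universal property gives a morphism into the sub-bifibration of good arrows. Followed by the inclusion it is an endomorphism fixing
the atom, hence the identity.\<close>

lemma free_generated:
  fixes B :: "('bo, 'ba, nat, nat \<times> nat) bif"
  assumes free: "free_bifibration TYPE('bo \<times> 'ba) terminal_cat omega p_omega B \<eta>"
    and inj: "inj_on (itp B (Fo \<eta> ())) {A. wff A}"
  shows "Obj (Tot B) = itp B (Fo \<eta> ()) ` {A. wff A}"
    and "\<And>A A' \<alpha>. wff A \<Longrightarrow> wff A' \<Longrightarrow> \<alpha> \<in> hom (Tot B) (itp B (Fo \<eta> ()) A) (itp B (Fo \<eta> ()) A') \<Longrightarrow>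
      der B (Fo \<eta> ()) A A' \<alpha>"
proof -
  let ?X = "Fo \<eta> ()"
  interpret pointed_bifibration B ?X by (rule free_pointed[OF free])
  note gb = gen_bifibration[OF inj]
  have "?X \<in> Obj (Tot gen)" using image_eqI[of ?X ob At "{A. wff A}"] by simp
  moreover from this have "Fo (Proj gen) ?X = 0" using X0 by simp
  ultimately obtain G where G: "bif_morphism omega B gen G" "Fo G ?X = ?X"
    using free_unique[OF free gb] by blast
  have F: "is_functor E (Tot gen) G" using G(1) by (simp add: bif_morphism_def)
  have GO: "Fo G S \<in> ob ` {A. wff A}" if "S \<in> Obj E" for S using functor_Fo[OF F that] by simp
  have GA: "\<exists>A A'. good B ?X A A' (Fa G \<alpha>)" if "\<alpha> \<in> Arr E" for \<alpha> using functor_Fa[OF F that] by simp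
  have F': "is_functor E E G"
  proof (rule is_functorI[OF E_cat E_cat functor_Fo_ext[OF F] functor_Fa_ext[OF F]])
    show "Fo G S \<in> Obj E" if "S \<in> Obj E" for S using GO[OF that] ob_Obj by auto
    show "Fa G \<alpha> \<in> Arr E" if "\<alpha> \<in> Arr E" for \<alpha> using GA[OF that] by (auto simp: good_def hom_def)
  qed (use functor_dom[OF F] functor_cod[OF F] functor_id[OF F] functor_comp[OF F] in simp_all)
  have "fcomp E G (Proj gen) = Proj B" using G(1) by (simp add: bif_morphism_def)
  then have pr: "Fo (Proj gen) (Fo G S) = over S" "Fa (Proj gen) (Fa G \<alpha>) = Fa (Proj B) \<alpha>"
    if "S \<in> Obj E" "\<alpha> \<in> Arr E" for S \<alpha> using fcomp_simps that by metis+
  have "fcomp E G (Proj B) = Proj B"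
  proof (rule functor_eqI[OF fcomp_functor[OF F' proj] proj])
    show "Fo (fcomp E G (Proj B)) S = over S" if "S \<in> Obj E" for S
      using pr(1)[OF that cat_id[OF E_cat that]] GO[OF that] that by simp
    show "Fa (fcomp E G (Proj B)) \<alpha> = Fa (Proj B) \<alpha>" if "\<alpha> \<in> Arr E" for \<alpha>
      using pr(2)[OF cat_dom[OF E_cat that] that] GA[OF that] that by auto
  qed
  then have GB: "bif_morphism omega B B G"
    using G(1) bif F' by (simp add: bif_morphism_def)
  have "bif_morphism omega B B (id_functor E)"
  proof -
    have "Push B f S \<in> Arr E" if "f \<in> Arr omega" "S \<in> Obj E" "over S = fst f" for f S
      using push_lift(1)[OF that(2), of "snd f"] that by (cases f) (auto simp: hom_def)
    moreover have "Pull B f S \<in> Arr E" if "f \<in> Arr omega" "S \<in> Obj E" "over S = snd f" for f S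
      using pull_lift(1)[OF that(2), of "fst f"] that by (cases f) (auto simp: hom_def)
    ultimately show ?thesis
      using bif id_functor_functor[OF E_cat] fcomp_id_left[OF proj] by (simp add: bif_morphism_def)
  qed
  then have G_id: "G = id_functor E"
    using free_unique[OF free bif X X0] GB G(2) X by auto
  show O: "Obj E = ob ` {A. wff A}"
    using GO ob_Obj G_id by auto
  fix A A' \<alpha> assume A: "wff A" "wff A'" and a: "\<alpha> \<in> hom E (ob A) (ob A')"
  obtain C C' where g: "good B ?X C C' \<alpha>" using GA[of \<alpha>] a G_id by (auto simp: hom_def)
  then have "wff C" "wff C'" "ob C = ob A" "ob C' = ob A'" using a by (auto simp: good_def hom_def)
  then have "C = A" "C' = A'" using inj A by (auto simp: inj_on_def)
  then show "der B ?X A A' \<alpha>" using good_der[OF g] by simp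
qed

section \<open>Arrows of the free bifibration are tree maps\<close>

lemma fiber_simps [simp]:
  "Obj (fiber C P A) = {S \<in> Obj (Tot P). Fo (Proj P) S = A}"
  "Arr (fiber C P A) = {\<alpha> \<in> Arr (Tot P). Fa (Proj P) \<alpha> = Ident C A}"
  "Dom (fiber C P A) = Dom (Tot P)" "Cod (fiber C P A) = Cod (Tot P)"
  "Ident (fiber C P A) = Ident (Tot P)" "Comp (fiber C P A) = Comp (Tot P)"
  by (simp_all add: fiber_def)

text \<open>A bifibration that is generated from \<open>X\<close> in the sense of \<open>free_generated\<close>, with a morphism \<open>G\<close> to the category of elements
that sends \<open>X\<close> to the one-vertex tree.\<close>

locale bif_to_trees = pointed_bifibration Q X
  for Q :: "('eo, 'ea, nat, nat \<times> nat) bif" and X :: 'eo +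
  fixes G :: "('eo, 'ea, nat \<times> tree, (nat \<times> tree) \<times> (nat \<times> tree) \<times> (nat \<times> nat) \<times> tree_map) ftor"
  assumes G: "bif_morphism omega Q Elts G" and GX: "Fo G X = (0, one_vertex)"
    and objs: "Obj E = ob ` {A. wff A}"
    and ders: "\<And>A A' \<alpha>. wff A \<Longrightarrow> wff A' \<Longrightarrow> \<alpha> \<in> hom E (ob A) (ob A') \<Longrightarrow> der Q X A A' \<alpha>"
begin

text \<open>The tree map underlying the image of an arrow. It depends functorially on the arrow, sends the pushforward liftings
to the units, and sends the pullback liftings to identities.\<close>

definition tm :: "'ea \<Rightarrow> tree_map" where "tm \<alpha> = und (Fa G \<alpha>)"

abbreviation "Th A B \<equiv> hom (PTree_bot (ht A)) (tree_of A) (tree_of B)"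
abbreviation "Bh A B \<equiv> hom E (ob A) (ob B)"

lemma G_functor: "is_functor E (Tot Elts) G"
  using G by (simp add: bif_morphism_def)

lemma G_ob: "wff A \<Longrightarrow> Fo G (ob A) = (ht A, tree_of A)"
  using bif_morphism_psh_pll(1)[OF pointed_bifibration_axioms G] itp_elements GX by simp

lemma G_hom: "\<alpha> \<in> hom E S T \<Longrightarrow> Fa G \<alpha> \<in> hom (Tot Elts) (Fo G S) (Fo G T)"
  using G_functor by (auto simp: hom_def simp del: elements_simps)

lemma G_hom_ob: "wff A \<Longrightarrow> wff B \<Longrightarrow> \<alpha> \<in> Bh A B \<Longrightarrow> Fa G \<alpha> \<in> hom (Tot Elts) (ht A, tree_of A) (ht B, tree_of B)"
  using G_hom[of \<alpha> "ob A" "ob B"] by (simp add: G_ob)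

lemma tm_hom: "wff A \<Longrightarrow> wff B \<Longrightarrow> \<alpha> \<in> Bh A B \<Longrightarrow> tm \<alpha> \<in> Th A B"
  unfolding tm_def
  by (rule bij_betw_apply[OF und_bij G_hom_ob]) (simp_all add: ht_le tree_of_marked)

lemma tm_comp:
  assumes "\<alpha> \<in> hom E S T" "\<beta> \<in> hom E T U"
  shows "tm (\<alpha> \<Zsemi>\<^bsub>E\<^esub> \<beta>) = tm \<alpha> \<Zsemi>\<^bsub>PTree\<^esub> tm \<beta>"
proof -
  have "Fa G (\<alpha> \<Zsemi>\<^bsub>E\<^esub> \<beta>) = Fa G \<alpha> \<Zsemi>\<^bsub>Tot Elts\<^esub> Fa G \<beta>"
    using assms by (intro functor_comp[OF G_functor]) (auto simp: hom_def)
  then show ?thesis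
    unfolding tm_def using G_hom[OF assms(1)] G_hom[OF assms(2)]
    by (simp add: und_comp hom_def)
qed

lemma tm_id:
  assumes "S \<in> Obj E" shows "tm (Ident E S) = Ident PTree (snd (Fo G S))"
  unfolding tm_def functor_id[OF G_functor assms] by (rule und_id[OF functor_Fo[OF G_functor assms]])

lemma tm_psh:
  assumes A: "wff A" shows "tm (psh Q X n A) = push_unit (ht A) n (tree_of A)"
proof -
  have "Fa G (psh Q X n A) = Push Elts (ht A, ht A + n) (ht A, tree_of A)"
    using bif_morphism_psh_pll(2)[OF pointed_bifibration_axioms G A] itp_elements[OF A] GX by (simp add: psh_def)
  then show ?thesis unfolding tm_def using und_push[of "ht A" "ht A + n"] tree_of_marked[OF A] by simp
qed

lemma tm_pll:
  assumes A: "wff A" "n \<le> ht A" shows "tm (pll Q X n A) = Ident PTree (tree_of A)"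
proof -
  have "Fa G (pll Q X n A) = Pull Elts (ht A - n, ht A) (ht A, tree_of A)"
    using bif_morphism_psh_pll(3)[OF pointed_bifibration_axioms G A] itp_elements[OF A(1)] GX by (simp add: pll_def)
  then show ?thesis unfolding tm_def using und_pull[of "ht A - n" "ht A"] tree_of_marked[OF A(1)] by simp
qed

lemma tm_psh_comp: "wff A \<Longrightarrow> \<beta> \<in> hom E (ob (Ps n A)) T \<Longrightarrow>
    tm (psh Q X n A \<Zsemi>\<^bsub>E\<^esub> \<beta>) = push_unit (ht A) n (tree_of A) \<Zsemi>\<^bsub>PTree\<^esub> tm \<beta>"
  using tm_comp[OF psh_hom] tm_psh by simp

lemma tm_comp_psh: "wff A \<Longrightarrow> \<beta> \<in> hom E S (ob A) \<Longrightarrow>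
    tm (\<beta> \<Zsemi>\<^bsub>E\<^esub> psh Q X n A) = tm \<beta> \<Zsemi>\<^bsub>PTree\<^esub> push_unit (ht A) n (tree_of A)"
  using tm_comp[OF _ psh_hom] tm_psh by simp

lemma tm_pll_comp:
  assumes "wff A" "wff B" "n \<le> ht A" "\<beta> \<in> Bh A B"
  shows "tm (pll Q X n A \<Zsemi>\<^bsub>E\<^esub> \<beta>) = tm \<beta>"
proof -
  have "tm \<beta> \<in> hom PTree (tree_of A) (tree_of B)" using tm_hom[OF assms(1,2,4)] by (simp add: hom_PTree_bot)
  then show ?thesis
    using tm_comp[OF pll_hom[OF assms(1,3)] assms(4)] tm_pll[OF assms(1,3)] hom_id_left[OF PTree_category] by simp
qed

lemma tm_comp_pll:
  assumes "wff A" "wff B" "n \<le> ht B" "\<beta> \<in> Bh A (Pl n B)"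
  shows "tm (\<beta> \<Zsemi>\<^bsub>E\<^esub> pll Q X n B) = tm \<beta>"
proof -
  have "tm \<beta> \<in> hom PTree (tree_of A) (tree_of B)" using tm_hom[OF assms(1) _ assms(4)] assms by (simp add: hom_PTree_bot)
  then show ?thesis
    using tm_comp[OF assms(4) pll_hom[OF assms(2,3)]] tm_pll[OF assms(2,3)] hom_id_right[OF PTree_category] by simp
qed

text \<open>If \<open>A\<close> is a pushforward or \<open>B\<close> is a pullback, both sides of the bijection reduce to the same smaller instance.\<close>

lemma tm_bij_Ps:
  assumes "wff A" "wff B" "ht A + n \<le> ht B" and IH: "bij_betw tm (Bh A B) (Th A B)"
  shows "bij_betw tm (Bh (Ps n A) B) (Th (Ps n A) B)"
proof -
  let ?p = "\<lambda>\<beta>. psh Q X n A \<Zsemi>\<^bsub>E\<^esub> \<beta>"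
  have p: "bij_betw ?p (Bh (Ps n A) B) (Bh A B)"
  proof (rule bij_betw_imageI)
    show "inj_on ?p (Bh (Ps n A) B)" using psh_cancel[OF assms(1)] by (intro inj_onI) blast
    show "?p ` Bh (Ps n A) B = Bh A B"
    proof (intro subset_antisym subsetI)
      show "\<alpha> \<in> Bh A B" if "\<alpha> \<in> ?p ` Bh (Ps n A) B" for \<alpha>
        using that hom_comp[OF E_cat psh_hom[OF assms(1)]] by blast
      show "\<alpha> \<in> ?p ` Bh (Ps n A) B" if "\<alpha> \<in> Bh A B" for \<alpha>
        using psh_ex1[OF assms(1) ob_Obj[OF assms(2)], of n \<alpha>] that assms(3) over_ob[OF assms(2)] by auto
    qed
  qed
  have T: "tree_of B \<in> Obj (PTree_bot (ht A + n))"
    by (rule marked_antimono[OF tree_of_marked[OF assms(2)] assms(3)])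
  note u = push_unit_bij[OF tree_of_marked[OF assms(1)] T]
  have "bij_betw (tm \<circ> ?p) (Bh (Ps n A) B) (Th A B)" by (rule bij_betw_trans[OF p IH])
  also have "?this \<longleftrightarrow> bij_betw ((\<lambda>a. push_unit (ht A) n (tree_of A) \<Zsemi>\<^bsub>PTree\<^esub> a) \<circ> tm) (Bh (Ps n A) B) (Th A B)"
    by (rule bij_betw_cong) (simp add: tm_psh_comp[OF assms(1)] del: itp.simps)
  finally show ?thesis
    using bij_betw_comp_iff2[OF u, of tm "Bh (Ps n A) B"] tm_hom[of "Ps n A" B] assms(1,2) by (simp add: image_subset_iff)
qed

lemma tm_bij_Pl:
  assumes "wff A" "wff B" "n \<le> ht B" "ht A \<le> ht B - n" and IH: "bij_betw tm (Bh A B) (Th A B)"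
  shows "bij_betw tm (Bh A (Pl n B)) (Th A (Pl n B))"
proof -
  let ?p = "\<lambda>\<beta>. \<beta> \<Zsemi>\<^bsub>E\<^esub> pll Q X n B"
  have p: "bij_betw ?p (Bh A (Pl n B)) (Bh A B)"
  proof (rule bij_betw_imageI)
    show "inj_on ?p (Bh A (Pl n B))" using pll_cancel[OF assms(2,3)] by (intro inj_onI) blast
    show "?p ` Bh A (Pl n B) = Bh A B"
    proof (intro subset_antisym subsetI)
      show "\<alpha> \<in> Bh A B" if "\<alpha> \<in> ?p ` Bh A (Pl n B)" for \<alpha>
        using that hom_comp[OF E_cat _ pll_hom[OF assms(2,3)]] by blast
      show "\<alpha> \<in> ?p ` Bh A (Pl n B)" if "\<alpha> \<in> Bh A B" for \<alpha>
        using pll_ex1[OF assms(2,3), of "ob A" \<alpha>] that assms(4) over_ob[OF assms(1)] by auto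
    qed
  qed
  have "bij_betw (tm \<circ> ?p) (Bh A (Pl n B)) (Th A B)" by (rule bij_betw_trans[OF p IH])
  also have "?this \<longleftrightarrow> bij_betw tm (Bh A (Pl n B)) (Th A B)"
    by (rule bij_betw_cong) (simp add: tm_comp_pll[OF assms(1-3)] del: itp.simps)
  finally show ?thesis by simp
qed

text \<open>The remaining cases, in which every arrow on the left arises by inversion and every tree map on the right by the
dichotomy.\<close>

lemma tm_bij_inversion:
  assumes A: "wff A" and B: "wff B" and le: "ht A \<le> ht B"
    and nA: "\<nexists>n A'. A = Ps n A'" and nB: "\<nexists>n B'. B = Pl n B'"
    and IH: "\<And>A' B'. wff A' \<Longrightarrow> wff B' \<Longrightarrow> ht A' \<le> ht B' \<Longrightarrow> size A' + size B' < size A + size B \<Longrightarrow>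
        bij_betw tm (Bh A' B') (Th A' B')"
  shows "bij_betw tm (Bh A B) (Th A B)"
proof (rule bij_betw_imageI)
  have IHi: "\<alpha> = \<beta>" if "wff A'" "wff B'" "size A' + size B' < size A + size B" "\<alpha> \<in> Bh A' B'" "\<beta> \<in> Bh A' B'" "tm \<alpha> = tm \<beta>"
    for A' B' \<alpha> \<beta>
    using inj_onD[OF bij_betw_imp_inj_on[OF IH[OF that(1,2) _ that(3)]] that(6,4,5)] ht_le[OF that(1,2,4)] by blast
  have IHs: "\<exists>\<alpha>\<in>Bh A' B'. tm \<alpha> = f" if "wff A'" "wff B'" "ht A' \<le> ht B'" "size A' + size B' < size A + size B" "f \<in> Th A' B'"
    for A' B' f
  proof -
    have "f \<in> tm ` Bh A' B'" using bij_betw_imp_surj_on[OF IH[OF that(1-4)]] that(5) by simp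
    then show ?thesis by blast
  qed
  have PT: "f \<in> hom PTree (tree_of A') (tree_of B')" if "f \<in> Th A' B'" for f A' B'
    using that by (simp add: hom_PTree_bot)
  \<comment> \<open>Arrows with the same tree map, one factoring through the lifting of the source, the other through that of the target.
    Then the tree map avoids the fresh path, so it comes from an arrow \<open>\<gamma> : A' \<rightarrow> B'\<close> through which both factor.\<close>
  have mixed: "\<alpha> = \<beta>" if eq: "tm \<alpha> = tm \<beta>"
      and \<alpha>: "A = Pl n A'" "\<alpha>' \<in> Bh A' B" "\<alpha> = pll Q X n A' \<Zsemi>\<^bsub>E\<^esub> \<alpha>'"
      and \<beta>: "B = Ps m B'" "\<beta>' \<in> Bh A B'" "\<beta> = \<beta>' \<Zsemi>\<^bsub>E\<^esub> psh Q X m B'" for \<alpha> \<beta> n A' \<alpha>' m B' \<beta>'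
  proof -
    have w: "wff A'" "n \<le> ht A'" "wff B'" using A B \<alpha>(1) \<beta>(1) by auto
    have a: "tm \<alpha> = tm \<alpha>'" unfolding \<alpha>(3) by (rule tm_pll_comp[OF w(1) B w(2) \<alpha>(2)])
    have b: "tm \<beta> = tm \<beta>' \<Zsemi>\<^bsub>PTree\<^esub> push_unit (ht B') m (tree_of B')"
      unfolding \<beta>(3) by (rule tm_comp_psh[OF w(3) \<beta>(2)])
    have a': "tm \<alpha>' \<in> Th A' B" by (rule tm_hom[OF w(1) B \<alpha>(2)])
    have b': "tm \<beta>' \<in> hom PTree (tree_of A') (tree_of B')"
      using PT[OF tm_hom[OF A w(3) \<beta>(2)]] \<alpha>(1) by simp
    note mA = tree_of_marked[OF w(1)] and mB = tree_of_marked[OF w(3)]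
    have 0: "img (tm \<beta>' \<Zsemi>\<^bsub>PTree\<^esub> push_unit (ht B') m (tree_of B')) (ht A') 0 = 0"
      using a' eq a b by (simp add: hom_PTree_bot)
    have le': "ht A' \<le> ht B' + m" using ht_le[OF w(1) B \<alpha>(2)] \<beta>(1) by simp
    have pos: "0 < Fo (tree_of A') (ht A')" by (rule marked_pos[OF mA order_refl])
    \<comment> \<open>Otherwise the mark of \<open>A'\<close> goes both to a fresh vertex and into the image of the unit.\<close>
    have leB: "ht A' \<le> ht B'"
    proof (rule ccontr)
      assume "\<not> ht A' \<le> ht B'"
      then have "img (push_unit (ht B') m (tree_of B')) (ht A') (img (tm \<beta>') (ht A') 0) \<noteq> 0"
        using img_push_unit_nonzero[OF mB tmap_less[OF b' pos], of m] le' by simp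
      then show False using 0 by (simp add: img_comp_hom[OF b' pos])
    qed
    have "tm \<beta>' \<in> Th A' B'" by (rule factor_marked[OF mB b' mA leB 0])
    then obtain \<gamma> where \<gamma>: "\<gamma> \<in> Bh A' B'" "tm \<gamma> = tm \<beta>'"
      using IHs[OF w(1,3) leB] \<alpha>(1) \<beta>(1) by auto
    note p = psh_hom[OF w(3), of m] and l = pll_hom[OF w(1,2)]
    have "\<alpha>' = \<gamma> \<Zsemi>\<^bsub>E\<^esub> psh Q X m B'"
    proof (rule IHi[OF w(1) B _ \<alpha>(2)])
      show "\<gamma> \<Zsemi>\<^bsub>E\<^esub> psh Q X m B' \<in> Bh A' B" unfolding \<beta>(1) by (rule hom_comp[OF E_cat \<gamma>(1) p])
      show "tm \<alpha>' = tm (\<gamma> \<Zsemi>\<^bsub>E\<^esub> psh Q X m B')" using tm_comp_psh[OF w(3) \<gamma>(1)] \<gamma>(2) eq a b by simp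
    qed (simp add: \<alpha>(1))
    moreover have "\<beta>' = pll Q X n A' \<Zsemi>\<^bsub>E\<^esub> \<gamma>"
    proof (rule IHi[OF A w(3) _ \<beta>(2)])
      show "pll Q X n A' \<Zsemi>\<^bsub>E\<^esub> \<gamma> \<in> Bh A B'" unfolding \<alpha>(1) by (rule hom_comp[OF E_cat l \<gamma>(1)])
      show "tm \<beta>' = tm (pll Q X n A' \<Zsemi>\<^bsub>E\<^esub> \<gamma>)" using tm_pll_comp[OF w(1,3,2) \<gamma>(1)] \<gamma>(2) by simp
    qed (simp add: \<beta>(1))
    ultimately show ?thesis
      unfolding \<alpha>(3) \<beta>(3) using hom_assoc[OF E_cat l \<gamma>(1) p] by simp
  qed
  show "inj_on tm (Bh A B)"
  proof (rule inj_onI)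
    fix \<alpha> \<beta> assume a: "\<alpha> \<in> Bh A B" and b: "\<beta> \<in> Bh A B" and eq: "tm \<alpha> = tm \<beta>"
    show "\<alpha> = \<beta>"
      using ders[OF A B a] nA nB
    proof (cases rule: der_pull_push_cases)
      case id
      show ?thesis using ders[OF A B b] nA nB by (cases rule: der_pull_push_cases) (use id in auto)
    next
      case (pull n A' \<alpha>')
      note \<alpha> = pull
      have w: "wff A'" "n \<le> ht A'" using A \<alpha>(1) by auto
      show ?thesis using ders[OF A B b] nA nB
      proof (cases rule: der_pull_push_cases)
        case (pull m A'' \<beta>')
        then have b': "\<beta>' \<in> Bh A' B" "\<beta> = pll Q X n A' \<Zsemi>\<^bsub>E\<^esub> \<beta>'" using \<alpha>(1) by auto
        have "\<alpha>' = \<beta>'"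
          by (rule IHi[OF w(1) B _ \<alpha>(2) b'(1)])
            (use eq \<alpha>(1,3) b' tm_pll_comp[OF w(1) B w(2)] \<alpha>(2) in simp_all)
        then show ?thesis using \<alpha>(3) b' by simp
      next
        case (push m B' \<beta>')
        show ?thesis by (rule mixed[OF eq \<alpha> push])
      qed (use \<alpha> in simp)
    next
      case (push n B' \<alpha>')
      note \<alpha> = push
      have w: "wff B'" using B \<alpha>(1) by auto
      show ?thesis using ders[OF A B b] nA nB
      proof (cases rule: der_pull_push_cases)
        case (pull m A' \<beta>')
        show ?thesis by (rule mixed[OF eq[symmetric] pull \<alpha>, symmetric])
      next
        case (push m B'' \<beta>')
        then have b': "\<beta>' \<in> Bh A B'" "\<beta> = \<beta>' \<Zsemi>\<^bsub>E\<^esub> psh Q X n B'" using \<alpha>(1) by auto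
        have "tm \<alpha>' = tm \<beta>'"
          by (rule push_unit_mono[OF tree_of_marked[OF w] PT[OF tm_hom[OF A w \<alpha>(2)]] PT[OF tm_hom[OF A w b'(1)]]])
            (use eq \<alpha>(3) b'(2) tm_comp_psh[OF w \<alpha>(2)] tm_comp_psh[OF w b'(1)] in simp)
        then have "\<alpha>' = \<beta>'"
          by (intro IHi[OF A w _ \<alpha>(2) b'(1)]) (simp_all add: \<alpha>(1))
        then show ?thesis using \<alpha>(3) b' by simp
      qed (use \<alpha> in simp)
    qed
  qed
  have tm_surj: "\<exists>\<alpha>\<in>Bh A B. tm \<alpha> = f" if f: "f \<in> Th A B" for f
  proof -
    have pull: ?thesis if A': "A = Pl n A'" and fA': "f \<in> Th A' B" and leA': "ht A' \<le> ht B" for n A'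
    proof -
      have w: "wff A'" "n \<le> ht A'" using A A' by auto
      obtain \<alpha> where "\<alpha> \<in> Bh A' B" "tm \<alpha> = f" using IHs[OF w(1) B leA' _ fA'] A' by auto
      then show ?thesis
        using hom_comp[OF E_cat pll_hom[OF w] , of \<alpha> "ob B"] tm_pll_comp[OF w(1) B w(2), of \<alpha>] A'
        by (intro bexI[of _ "pll Q X n A' \<Zsemi>\<^bsub>E\<^esub> \<alpha>"]) simp_all
    qed
    have push: ?thesis if B': "B = Ps m B'" and g: "g \<in> Th A B'" and fg: "f = g \<Zsemi>\<^bsub>PTree\<^esub> push_unit (ht B') m (tree_of B')" and leB': "ht A \<le> ht B'"
      for m B' g
    proof -
      have w: "wff B'" using B B' by auto
      obtain \<alpha> where "\<alpha> \<in> Bh A B'" "tm \<alpha> = g" using IHs[OF A w leB' _ g] B' by auto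
      then show ?thesis
        using hom_comp[OF E_cat _ psh_hom[OF w], of \<alpha> "ob A" m] tm_comp_psh[OF w, of \<alpha> "ob A" m] B' fg
        by (intro bexI[of _ "\<alpha> \<Zsemi>\<^bsub>E\<^esub> psh Q X m B'"]) simp_all
    qed
    show ?thesis
    proof (cases A)
      case At
      show ?thesis
      proof (cases B)
        case B': At
        have X1: "snd (Fo G X) = one_vertex" by (simp add: GX)
        have "tm (Ident E X) = f"
          unfolding tm_id[OF X] X1
          by (rule one_vertex_map_unique[OF id_hom_PTree[OF one_vertex_PTree]]) (use PT[OF f] At B' in simp)
        then show ?thesis using hom_id[OF E_cat X] At B' by auto
      next
        case (Ps m B')
        have w: "wff B'" using B Ps by auto
        note mB = tree_of_marked[OF w]
        have f': "f \<in> hom PTree one_vertex (push_tree (ht B') m (tree_of B'))" using PT[OF f] At Ps by simp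
        obtain g where g: "g \<in> hom PTree one_vertex (tree_of B')" "f = g \<Zsemi>\<^bsub>PTree\<^esub> push_unit (ht B') m (tree_of B')"
          using factor_through_push_unit[OF mB f'] by (auto split: if_splits)
        have "g \<in> Th At B'"
          using g(1) mB marked_PTree[OF mB] by (simp add: PTree_bot_0)
        then show ?thesis using push[of m B' g] g(2) At Ps by simp
      qed (use nB in simp)
    next
      case (Pl n A')
      have w: "wff A'" "n \<le> ht A'" using A Pl by auto
      note mA = tree_of_marked[OF w(1)]
      show ?thesis
      proof (cases B)
        case At
        have "ht A' = 0"
          using tmap_less[OF PT[OF f], of 0 "ht A'"] marked_pos[OF mA order_refl] At Pl by (simp split: if_splits)
        then show ?thesis using pull[OF Pl] f Pl by simp
      next
        case (Ps m B')
        have w': "wff B'" using B Ps by auto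
        have S: "tree_of A' \<in> Obj (PTree_bot (ht A' - n + n))" using mA w by simp
        have f': "f \<in> hom (PTree_bot (ht A' - n)) (tree_of A') (push_tree (ht B') m (tree_of B'))"
          using f Pl Ps by simp
        have k: "ht A' - n \<le> ht B' + m" using le Pl Ps by simp
        show ?thesis
        proof (cases rule: pull_push_dichotomy[OF S tree_of_marked[OF w'] k f', case_names c1 c2])
          case c1
          then show ?thesis using pull[OF Pl] w Ps by simp
        next
          case (c2 g)
          then show ?thesis using push[OF Ps, of g] Pl by simp
        qed
      qed (use nB in simp)
    qed (use nA in simp)
  qed
  show "tm ` Bh A B = Th A B"
    using tm_hom[OF A B] tm_surj by (auto simp: image_iff)
qed

lemma tm_bij: "wff A \<Longrightarrow> wff B \<Longrightarrow> ht A \<le> ht B \<Longrightarrow> bij_betw tm (Bh A B) (Th A B)"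
proof (induction "size A + size B" arbitrary: A B rule: less_induct)
  case less
  show ?case
  proof (cases "\<exists>n A'. A = Ps n A'")
    case True
    then obtain n A' where A: "A = Ps n A'" by blast
    have "bij_betw tm (Bh A' B) (Th A' B)" by (rule less.hyps) (use less.prems A in auto)
    then show ?thesis unfolding A by (intro tm_bij_Ps) (use less.prems A in auto)
  next
    case nA: False
    show ?thesis
    proof (cases "\<exists>n B'. B = Pl n B'")
      case True
      then obtain n B' where B: "B = Pl n B'" by blast
      have "bij_betw tm (Bh A B') (Th A B')" by (rule less.hyps) (use less.prems B in auto)
      then show ?thesis unfolding B by (intro tm_bij_Pl) (use less.prems B in auto)
    next
      case False
      show ?thesis by (rule tm_bij_inversion[OF less.prems nA False]) (rule less.hyps)
    qed
  qed
qed

lemma G_bij: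
  assumes "S \<in> Obj E" "T \<in> Obj E"
  shows "bij_betw (Fa G) (hom E S T) (hom (Tot Elts) (Fo G S) (Fo G T))"
proof -
  obtain A B where A: "wff A" "S = ob A" and B: "wff B" "T = ob B" using assms unfolding objs by blast
  have sub: "Fa G ` Bh A B \<subseteq> hom (Tot Elts) (ht A, tree_of A) (ht B, tree_of B)"
    using G_hom_ob[OF A(1) B(1)] by blast
  show ?thesis
  proof (cases "ht A \<le> ht B")
    case True
    have "bij_betw (und \<circ> Fa G) (Bh A B) (Th A B)"
      using tm_bij[OF A(1) B(1) True] by (simp add: tm_def[abs_def] comp_def)
    then show ?thesis
      using bij_betw_comp_iff2[OF und_bij[OF True tree_of_marked[OF A(1)] tree_of_marked[OF B(1)]] sub] A B G_ob by simp
  next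
    case False
    then have "Bh A B = {}" using ht_le[OF A(1) B(1)] by blast
    moreover have "hom (Tot Elts) (ht A, tree_of A) (ht B, tree_of B) = {}" using False by (simp add: Elts_hom)
    ultimately show ?thesis using A B G_ob by (simp add: bij_betw_def)
  qed
qed

lemma G_surj: "Fo G ` Obj E = Obj (Tot Elts)"
proof (intro subset_antisym subsetI)
  show "Y \<in> Obj (Tot Elts)" if "Y \<in> Fo G ` Obj E" for Y using that functor_Fo[OF G_functor] by blast
  fix Y assume "Y \<in> Obj (Tot Elts)"
  then obtain k T where Y: "Y = (k, T)" "T \<in> Obj (PTree_bot k)" by (auto elim: elements_ObjE)
  then obtain A where A: "wff A" "ht A = k" "tree_of A = T" using marked_tree_formula by blast
  then show "Y \<in> Fo G ` Obj E" using G_ob[OF A(1)] ob_Obj[OF A(1)] Y by (metis imageI)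
qed

lemma G_equivalence: "is_equivalence E (Tot Elts) G"
  by (rule ff_surj_equivalence[OF G_functor G_surj G_bij])

lemma fiber_Arr: "\<alpha> \<in> Arr (fiber omega Q 0) \<longleftrightarrow> \<alpha> \<in> Arr E \<and> over (Dom E \<alpha>) = 0 \<and> over (Cod E \<alpha>) = 0"
  using proj_arr[of \<alpha> "Dom E \<alpha>" "Cod E \<alpha>"] by (auto simp: hom_def)

lemma fiber_category: "is_category (fiber omega Q 0)"
proof (rule is_categoryI)
  fix \<alpha> assume a: "\<alpha> \<in> Arr (fiber omega Q 0)"
  show "\<alpha> \<Zsemi>\<^bsub>fiber omega Q 0\<^esub> \<beta> \<in> Arr (fiber omega Q 0)"
    if "\<beta> \<in> Arr (fiber omega Q 0)" "Cod (fiber omega Q 0) \<alpha> = Dom (fiber omega Q 0) \<beta>" for \<beta>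
    using a that E_cat unfolding fiber_Arr by simp
  show "Dom (fiber omega Q 0) \<alpha> \<in> Obj (fiber omega Q 0)" "Cod (fiber omega Q 0) \<alpha> \<in> Obj (fiber omega Q 0)"
    using a E_cat unfolding fiber_Arr by simp_all
next
  show "Ident (fiber omega Q 0) S \<in> Arr (fiber omega Q 0)" if "S \<in> Obj (fiber omega Q 0)" for S
    using that E_cat unfolding fiber_Arr by simp
qed (use E_cat in \<open>simp_all add: cat_id_left cat_id_right cat_assoc\<close>)

lemma fiber_hom: "over S = 0 \<Longrightarrow> over T = 0 \<Longrightarrow> hom (fiber omega Q 0) S T = hom E S T"
  using fiber_Arr by (auto simp: hom_def)

lemma fiber_equivalent: "equivalent_cats PTree (fiber omega Q 0)"
proof -
  let ?F = "fiber omega Q 0"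
  define K where "K = \<lparr>Fo = (\<lambda>S\<in>Obj ?F. snd (Fo G S)), Fa = restrict tm (Arr ?F)\<rparr>"
  have obF: "\<exists>A. S = ob A \<and> wff A \<and> ht A = 0" if "S \<in> Obj ?F" for S
    using that objs over_ob by auto
  have KO: "Fo K (ob A) = tree_of A" if "wff A" "ht A = 0" for A
    using that ob_Obj over_ob by (simp add: K_def G_ob)
  have tmT: "tm \<alpha> \<in> hom PTree (Fo K S) (Fo K T)" if a: "\<alpha> \<in> hom ?F S T" for \<alpha> S T
  proof -
    have ST: "S \<in> Obj ?F" "T \<in> Obj ?F" using cat_dom[OF fiber_category] cat_cod[OF fiber_category] a
      unfolding hom_def by blast+
    obtain A B where AB: "S = ob A" "wff A" "ht A = 0" "T = ob B" "wff B" "ht B = 0" using obF ST by metis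
    have "\<alpha> \<in> Bh A B" using a AB over_ob fiber_hom by simp
    then show ?thesis using tm_hom[OF AB(2,5)] AB KO by (simp add: PTree_bot_0)
  qed
  have hm: "\<alpha> \<in> hom ?F (Dom E \<alpha>) (Cod E \<alpha>)" if "\<alpha> \<in> Arr ?F" for \<alpha> using that by (simp add: hom_def)
  have Ka: "Fa K \<alpha> = tm \<alpha>" if "\<alpha> \<in> Arr ?F" for \<alpha> using that by (simp add: K_def)
  have K: "is_functor ?F PTree K"
  proof (rule is_functorI[OF fiber_category PTree_category])
    show "Fo K \<in> extensional (Obj ?F)" "Fa K \<in> extensional (Arr ?F)" by (simp_all add: K_def)
    show "Fo K S \<in> Obj PTree" if "S \<in> Obj ?F" for S
      using obF[OF that] KO marked_PTree[OF tree_of_marked] by auto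
    show "Fa K \<alpha> \<in> Arr PTree" "Dom PTree (Fa K \<alpha>) = Fo K (Dom ?F \<alpha>)" "Cod PTree (Fa K \<alpha>) = Fo K (Cod ?F \<alpha>)"
      if "\<alpha> \<in> Arr ?F" for \<alpha>
      using tmT[OF hm[OF that]] Ka[OF that] by (auto simp: hom_def)
    show "Fa K (Ident ?F S) = Ident PTree (Fo K S)" if "S \<in> Obj ?F" for S
      using Ka[OF cat_id[OF fiber_category that]] that tm_id[of S] by (simp add: K_def)
    show "Fa K (\<alpha> \<Zsemi>\<^bsub>?F\<^esub> \<beta>) = Fa K \<alpha> \<Zsemi>\<^bsub>PTree\<^esub> Fa K \<beta>"
      if ab: "\<alpha> \<in> Arr ?F" "\<beta> \<in> Arr ?F" "Cod ?F \<alpha> = Dom ?F \<beta>" for \<alpha> \<beta>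
      using Ka[OF cat_comp[OF fiber_category ab]] Ka[OF ab(1)] Ka[OF ab(2)] ab
        tm_comp[of \<alpha> "Dom E \<alpha>" "Cod E \<alpha>" \<beta> "Cod E \<beta>"] by (simp add: hom_def)
  qed
  have "is_equivalence ?F PTree K"
  proof (rule ff_surj_equivalence[OF K])
    show "Fo K ` Obj ?F = Obj PTree"
    proof (intro subset_antisym subsetI)
      show "T \<in> Obj PTree" if "T \<in> Fo K ` Obj ?F" for T using that functor_Fo[OF K] by blast
      fix T assume "T \<in> Obj PTree"
      then obtain A where A: "wff A" "ht A = 0" "tree_of A = T"
        using marked_tree_formula[of T 0] by (auto simp: PTree_bot_0)
      then have "ob A \<in> Obj ?F" using ob_Obj over_ob by simp
      then show "T \<in> Fo K ` Obj ?F" using KO[OF A(1,2)] A(3) by (metis imageI)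
    qed
    fix S T assume ST: "S \<in> Obj ?F" "T \<in> Obj ?F"
    obtain A B where AB: "S = ob A" "wff A" "ht A = 0" "T = ob B" "wff B" "ht B = 0" using obF ST by metis
    have h: "hom ?F S T = Bh A B" using AB over_ob fiber_hom by simp
    have "bij_betw tm (Bh A B) (hom PTree (Fo K S) (Fo K T))"
      using tm_bij[OF AB(2,5)] AB KO by (simp add: PTree_bot_0)
    also have "?this \<longleftrightarrow> bij_betw (Fa K) (Bh A B) (hom PTree (Fo K S) (Fo K T))"
    proof (rule bij_betw_cong)
      fix \<alpha> assume "\<alpha> \<in> Bh A B"
      then have "\<alpha> \<in> hom ?F S T" using h by simp
      then show "tm \<alpha> = Fa K \<alpha>" using Ka[of \<alpha>] by (simp add: hom_def del: fiber_simps(2))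
    qed
    finally show "bij_betw (Fa K) (hom ?F S T) (hom PTree (Fo K S) (Fo K T))" using h by simp
  qed
  then show ?thesis unfolding equivalent_cats_def by (rule equivalence_inverse)
qed

end

theorem theorem5p3:
  fixes Bif :: "('bo, 'ba, nat, nat \<times> nat) bif"
    and \<eta> :: "(unit, unit, 'bo, 'ba) ftor"
  assumes "free_bifibration TYPE('bo \<times> 'ba) terminal_cat omega p_omega Bif \<eta>"
    and "free_bifibration
           TYPE((nat \<times> tree) \<times> ((nat \<times> tree) \<times> (nat \<times> tree) \<times> (nat \<times> nat) \<times> tree_map))
           terminal_cat omega p_omega Bif \<eta>"
  shows "is_functor omega Adj PTree_functor \<and>
    (\<forall>k. Fa PTree_functor (k, Suc k) = LR_adj k) \<and>
    (\<exists>!G. bif_morphism omega Bif (elements omega PTree_functor) G \<and>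
           Fo G (Fo \<eta> ()) = (0, one_vertex)) \<and>
    (\<forall>G. bif_morphism omega Bif (elements omega PTree_functor) G \<longrightarrow>
           Fo G (Fo \<eta> ()) = (0, one_vertex) \<longrightarrow>
           is_equivalence (Tot Bif) (Tot (elements omega PTree_functor)) G) \<and>
    equivalent_cats PTree (fiber omega Bif 0)"
proof -
  have inj: "inj_on (itp Bif (Fo \<eta> ())) {A. wff A}" by (rule free_itp_inj[OF assms(2)])
  have loc: "bif_to_trees Bif (Fo \<eta> ()) G"
    if "bif_morphism omega Bif Elts G" "Fo G (Fo \<eta> ()) = (0, one_vertex)" for G
    using free_pointed[OF assms(1)] that free_generated[OF assms(1) inj]
    by (simp add: bif_to_trees_def bif_to_trees_axioms_def)
  have ex1: "\<exists>!G. bif_morphism omega Bif Elts G \<and> Fo G (Fo \<eta> ()) = (0, one_vertex)"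
    by (rule free_unique[OF assms(2) elements_bifibration[OF PTree_functor_functor]])
      (simp_all add: one_vertex_marked)
  then obtain G where "bif_to_trees Bif (Fo \<eta> ()) G" using loc by blast
  then have "equivalent_cats PTree (fiber omega Bif 0)" by (rule bif_to_trees.fiber_equivalent)
  moreover have "is_equivalence (Tot Bif) (Tot Elts) G"
    if "bif_morphism omega Bif Elts G" "Fo G (Fo \<eta> ()) = (0, one_vertex)" for G
    by (rule bif_to_trees.G_equivalence[OF loc[OF that]])
  ultimately show ?thesis
    using ex1 PTree_functor_functor PTree_functor_Suc by blast
qed

end
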